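(* Let $N\ge 1$ be an integer and let $A\in GR_{N\times N}(\mathbb{T})$, that is, $A:\mathbb{T}\to\mathbb{C}^{N\times N}$ is a rational matrix function without poles on the unit circle $\mathbb{T}$ and $\det A(t)\neq 0$ for all $t\in\mathbb{T}$. Put $\tilde A(t)=A(1/t)$. Suppose that at least one of the operators $T(A)$ or $T(\tilde A)$ is not invertible on $\ell^2_N$. If $0\notin\Lambda(A)$, then there exist constants $d_1,d_2>0$ and $\alpha,\beta>0$ such that $$d_1e^{\alpha n}\le\kappa(T_n(A))\le d_2e^{\beta n}$$ for all sufficiently large $n$.
   Context: $\mathbb{T}$ is the complex unit circle. $\ell^2_N$ is the Hilbert space of square-summable sequences $(x_0,x_1,\dots)$ with $x_j\in\mathbb{C}^N$. For a bounded measurable $A:\mathbb{T}\to\mathbb{C}^{N\times N}$ with Fourier coefficients $\hat A_k=\frac1{2\pi}\int_0^{2\pi}A(e^{i\theta})e^{-ik\theta}\,d\theta$, $T(A)=(\hat A_{j-k})_{j,k=0}^\infty$ is the block Toeplitz operator on $\ell^2_N$, and $T_n(A)=(\hat A_{j-k})_{j,k=0}^{n-1}\in\mathbb{C}^{nN\times nN}$. $\kappa(M)=\|M\|\,\|M^{-1}\|$ with the spectral norm, and $\kappa(M)=\infty$ if $M$ is not invertible. $\operatorname{sp}T_n(A)$ is the set of eigenvalues of $T_n(A)$, and the limit set $\Lambda(A)=\limsup_{n\to\infty}\operatorname{sp}T_n(A)$ is the set of all partial limits of the sequence $\{\operatorname{sp}T_n(A)\}_{n\ge1}$, i.e. the set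 of all $\lambda\in\mathbb{C}$ for which there are $n_1<n_2<\cdots$ and $\lambda_{k}\in\operatorname{sp}T_{n_k}(A)$ with $\lambda_k\to\lambda$. *)

theory Defs
  imports
    "HOL-Analysis.Analysis"
    "HOL-Library.Extended_Real"
    "Jordan_Normal_Form.Gauss_Jordan_Elimination"
    "Jordan_Normal_Form.Spectral_Radius"
begin

no_notation Finite_Cartesian_Product.vec_nth (infixl "$" 90)

abbreviation unit_circle :: "complex set" where
  "unit_circle \<equiv> sphere 0 1"

text \<open>
  Matrix functions on the unit circle are functions \<open>complex \<Rightarrow> complex mat\<close>; their values off the
  circle are irrelevant. A rational function without poles on the circle is one that has, on the
  circle, a representation \<open>p / q\<close> with \<open>q\<close> free of zeros there (reduce to lowest terms).
\<close>

definition rational_matrix_fun :: "nat \<Rightarrow> (complex \<Rightarrow> complex mat) \<Rightarrow> bool" where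
  "rational_matrix_fun N A \<longleftrightarrow>
     (\<forall>t\<in>unit_circle. A t \<in> carrier_mat N N) \<and>
     (\<forall>r<N. \<forall>s<N. \<exists>p q :: complex poly.
        \<forall>t\<in>unit_circle. poly q t \<noteq> 0 \<and> A t $$ (r, s) = poly p t / poly q t)"

definition GR :: "nat \<Rightarrow> (complex \<Rightarrow> complex mat) set" where
  "GR N = {A. rational_matrix_fun N A \<and> (\<forall>t\<in>unit_circle. Determinant.det (A t) \<noteq> 0)}"

definition reflect_symbol :: "(complex \<Rightarrow> complex mat) \<Rightarrow> complex \<Rightarrow> complex mat" where
  "reflect_symbol A t = A (1 / t)"

definition fourier_coeff :: "nat \<Rightarrow> (complex \<Rightarrow> complex mat) \<Rightarrow> int \<Rightarrow> complex mat" where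
  "fourier_coeff N A k = mat N N (\<lambda>(r, s).
     1 / (2 * complex_of_real pi) *
     integral {0..2 * pi} (\<lambda>\<theta>. A (exp (\<i> * complex_of_real \<theta>)) $$ (r, s) *
                                exp (- \<i> * of_int k * complex_of_real \<theta>)))"

definition vnorm :: "complex vec \<Rightarrow> real" where
  "vnorm v = L2_set (\<lambda>i. cmod (v $ i)) {..<dim_vec v}"

definition ell2 :: "nat \<Rightarrow> (nat \<Rightarrow> complex vec) set" where
  "ell2 N = {x. (\<forall>j. x j \<in> carrier_vec N) \<and> summable (\<lambda>j. (vnorm (x j))\<^sup>2)}"

definition ell2_norm :: "(nat \<Rightarrow> complex vec) \<Rightarrow> real" where
  "ell2_norm x = sqrt (\<Sum>j. (vnorm (x j))\<^sup>2)"

definition bounded_op ::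
  "nat \<Rightarrow> ((nat \<Rightarrow> complex vec) \<Rightarrow> (nat \<Rightarrow> complex vec)) \<Rightarrow> bool" where
  "bounded_op N F \<longleftrightarrow>
     (\<forall>x\<in>ell2 N. F x \<in> ell2 N) \<and>
     (\<forall>x\<in>ell2 N. \<forall>y\<in>ell2 N. F (\<lambda>j. x j + y j) = (\<lambda>j. F x j + F y j)) \<and>
     (\<forall>c. \<forall>x\<in>ell2 N. F (\<lambda>j. c \<cdot>\<^sub>v x j) = (\<lambda>j. c \<cdot>\<^sub>v F x j)) \<and>
     (\<exists>C. \<forall>x\<in>ell2 N. ell2_norm (F x) \<le> C * ell2_norm x)"

definition invertible_op ::
  "nat \<Rightarrow> ((nat \<Rightarrow> complex vec) \<Rightarrow> (nat \<Rightarrow> complex vec)) \<Rightarrow> bool" where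
  "invertible_op N F \<longleftrightarrow> bounded_op N F \<and>
     (\<exists>G. bounded_op N G \<and> (\<forall>x\<in>ell2 N. G (F x) = x \<and> F (G x) = x))"

text \<open>The series over \<open>k\<close> is formed in each of the \<open>N\<close> components of the \<open>j\<close>-th block.\<close>

definition toeplitz_op ::
  "nat \<Rightarrow> (complex \<Rightarrow> complex mat) \<Rightarrow> (nat \<Rightarrow> complex vec) \<Rightarrow> (nat \<Rightarrow> complex vec)" where
  "toeplitz_op N A x = (\<lambda>j. vec N (\<lambda>r.
     \<Sum>k. (fourier_coeff N A (int j - int k) *\<^sub>v x k) $ r))"

text \<open>Row \<open>i\<close> of the block matrix is row \<open>i mod N\<close> of block row \<open>i div N\<close>; likewise for columns.\<close>

definition toeplitz_mat :: "nat \<Rightarrow> (complex \<Rightarrow> complex mat) \<Rightarrow> nat \<Rightarrow> complex mat" where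
  "toeplitz_mat N A n = mat (n * N) (n * N) (\<lambda>(i, j).
     fourier_coeff N A (int (i div N) - int (j div N)) $$ (i mod N, j mod N))"

definition spectral_norm :: "complex mat \<Rightarrow> real" where
  "spectral_norm M = (SUP v \<in> {v \<in> carrier_vec (dim_col M). vnorm v \<le> 1}. vnorm (M *\<^sub>v v))"

definition cond_number :: "complex mat \<Rightarrow> ereal" where
  "cond_number M = (case mat_inverse M of
       None \<Rightarrow> \<infinity>
     | Some B \<Rightarrow> ereal (spectral_norm M * spectral_norm B))"

definition limit_set :: "nat \<Rightarrow> (complex \<Rightarrow> complex mat) \<Rightarrow> complex set" where
  "limit_set N A = {z. \<exists>(ns :: nat \<Rightarrow> nat) (zs :: nat \<Rightarrow> complex).
     strict_mono ns \<and> (\<forall>k. 1 \<le> ns k) \<and>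
     (\<forall>k. zs k \<in> spectrum (toeplitz_mat N A (ns k))) \<and> zs \<longlonglongrightarrow> z}"

end

theory Submission
  imports Defs
begin

text \<open>
  Let \<open>a\<close> be the infinite matrix of \<open>T(A)\<close>, with the index pair (block, component) merged
  into one index, and let \<open>m = n N\<close> be the size of \<open>T\<^sub>n(A)\<close>, which is the leading section of
  \<open>a\<close>.

  The lower bound comes from an exponentially small vector of the section. An entry of \<open>A\<close> is
  a quotient of polynomials without zeros of the denominator on the circle, hence the sum of a
  Laurent series with exponentially decaying coefficients (\<open>laurent_expansion_rational\<close>), and
  by Cramer's rule the entries of the pointwise inverse \<open>B\<close> of \<open>A\<close> have the same property. If
  \<open>b\<close> is the matrix of \<open>T(B)\<close>, then \<open>a b\<close> and \<open>b a\<close> differ from the identity by products of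
  Hankel matrices, whose entries are \<open>O(r ^ (i + j))\<close> with \<open>r < 1\<close>
  (\<open>block_toeplitz_parametrix\<close>). For such an \<open>a\<close> there is a strong form of the Fredholm
  alternative (\<open>invertible_or_decaying_kernel\<close>): either \<open>a\<close> is invertible on the
  square-summable sequences, or \<open>a\<close> or its transpose annihilates a nonzero sequence \<open>z\<close> that
  decays exponentially. If \<open>T(A)\<close> is not invertible, the second case holds. Cutting \<open>z\<close> off
  after \<open>m\<close> entries leaves a vector whose norm does not tend to zero and which the section
  maps to a vector of size \<open>O(r ^ m)\<close>, so the inverse of the section has an entry of size at
  least \<open>c (1/r) ^ m\<close> (\<open>exp_growing_inverses_kernel\<close>). The matrix of \<open>T(A(1/t))\<close> is treated in
  the same way, because its finite sections arise from those of \<open>T(A)\<close> by reversing the order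
  of the blocks, which only permutes the entries of the inverses. The norms of the sections
  themselves stay away from zero, since a nonzero entry of one section is an entry of all
  later ones.

  For the upper bound, \<open>0 \<notin> \<Lambda>(A)\<close> says that the eigenvalues of \<open>T\<^sub>n(A)\<close> have modulus at least
  some \<open>\<epsilon> > 0\<close> for large \<open>n\<close> (\<open>spectrum_bounded_away\<close>). Then the determinant, being the
  product of the eigenvalues, is at least \<open>\<epsilon> ^ m\<close> in modulus, whereas the cofactors are at
  most \<open>R ^ m\<close>, where \<open>R \<ge> 1\<close> bounds the absolute row sums of \<open>a\<close>. Cramer's rule bounds the
  entries of the inverse by \<open>(R / \<epsilon>) ^ m\<close>.
\<close>

section \<open>The Hilbert space of square-summable sequences\<close>

lemma summable_on_if_bounded_partial_sums:
  fixes f :: "'a \<Rightarrow> real"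
  assumes "\<And>i. 0 \<le> f i" "\<And>F. finite F \<Longrightarrow> sum f F \<le> B"
  shows "f summable_on UNIV" and "infsum f UNIV \<le> B"
proof -
  have *: "bdd_above (sum f ` {F. F \<subseteq> UNIV \<and> finite F})"
    using assms(2) by (intro bdd_aboveI[of _ B]) auto
  show s: "f summable_on UNIV"
    using assms(1) * by (intro nonneg_bdd_above_summable_on)
  show "infsum f UNIV \<le> B"
    using s assms(2) by (intro infsum_le_finite_sums) auto
qed

text \<open>
  Blocks are flattened: a sequence in \<open>ell2 N\<close> becomes a scalar sequence. The inner product below is
  the real part of the Hermitian one, which induces the same norm and the same adjoints.
\<close>

typedef sqsum = "{x :: nat \<Rightarrow> complex. (\<lambda>i. (cmod (x i))\<^sup>2) summable_on UNIV}"
  morphisms coords Abs_sqsum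
  by (intro exI[of _ "\<lambda>_. 0"]) auto

setup_lifting type_definition_sqsum

lemma sqsum_summable: "(\<lambda>i. (cmod (coords x i))\<^sup>2) summable_on UNIV"
  using coords[of x] by simp

lemma summable_inner_coords:
  fixes x y :: "nat \<Rightarrow> complex"
  assumes "(\<lambda>i. (cmod (x i))\<^sup>2) summable_on UNIV" "(\<lambda>i. (cmod (y i))\<^sup>2) summable_on UNIV"
  shows "(\<lambda>i. inner (x i) (y i)) summable_on UNIV"
proof -
  have "(\<lambda>i. (cmod (x i))\<^sup>2 + (cmod (y i))\<^sup>2) summable_on UNIV"
    using assms by (rule summable_on_add)
  moreover have "norm (inner (x i) (y i)) \<le> (cmod (x i))\<^sup>2 + (cmod (y i))\<^sup>2" for i
  proof -
    have "norm (inner (x i) (y i)) \<le> cmod (x i) * cmod (y i)"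
      using Cauchy_Schwarz_ineq2[of "x i" "y i"] by simp
    moreover have "2 * (cmod (x i) * cmod (y i)) \<le> (cmod (x i))\<^sup>2 + (cmod (y i))\<^sup>2"
      using sum_squares_bound[of "cmod (x i)" "cmod (y i)"] by (simp add: algebra_simps)
    moreover have "0 \<le> cmod (x i) * cmod (y i)" by simp
    ultimately show ?thesis by linarith
  qed
  ultimately have "(\<lambda>i. norm (inner (x i) (y i))) summable_on UNIV"
    by (intro Infinite_Sum.abs_summable_on_comparison_test'[where g = "\<lambda>i. (cmod (x i))\<^sup>2 + (cmod (y i))\<^sup>2"]) auto
  then show ?thesis by (rule abs_summable_summable)
qed

lemma summable_sq_add:
  fixes x y :: "nat \<Rightarrow> complex"
  assumes "(\<lambda>i. (cmod (x i))\<^sup>2) summable_on UNIV" "(\<lambda>i. (cmod (y i))\<^sup>2) summable_on UNIV"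
  shows "(\<lambda>i. (cmod (x i + y i))\<^sup>2) summable_on UNIV"
proof -
  have "(\<lambda>i. (cmod (x i))\<^sup>2 + (cmod (y i))\<^sup>2 + 2 * inner (x i) (y i)) summable_on UNIV"
    using assms by (intro summable_on_add summable_on_cmult_right summable_inner_coords)
  moreover have "(cmod (x i + y i))\<^sup>2 = (cmod (x i))\<^sup>2 + (cmod (y i))\<^sup>2 + 2 * inner (x i) (y i)" for i
    by (simp add: power2_norm_eq_inner inner_add_left inner_add_right inner_commute)
  ultimately show ?thesis by simp
qed

lemma summable_sq_scale:
  fixes x :: "nat \<Rightarrow> complex"
  assumes "(\<lambda>i. (cmod (x i))\<^sup>2) summable_on UNIV"
  shows "(\<lambda>i. (cmod (c * x i))\<^sup>2) summable_on UNIV"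
  using assms by (simp add: norm_mult power_mult_distrib summable_on_cmult_right)

instantiation sqsum :: real_inner
begin

lift_definition zero_sqsum :: sqsum is "\<lambda>_. 0" by simp

lift_definition plus_sqsum :: "sqsum \<Rightarrow> sqsum \<Rightarrow> sqsum" is "\<lambda>x y i. x i + y i"
  by (rule summable_sq_add)

lift_definition uminus_sqsum :: "sqsum \<Rightarrow> sqsum" is "\<lambda>x i. - x i" by simp

lift_definition minus_sqsum :: "sqsum \<Rightarrow> sqsum \<Rightarrow> sqsum" is "\<lambda>x y i. x i - y i"
  using summable_sq_add[of _ "\<lambda>i. - _ i"] by (simp del: add_uminus_conv_diff add: diff_conv_add_uminus)

lift_definition scaleR_sqsum :: "real \<Rightarrow> sqsum \<Rightarrow> sqsum" is "\<lambda>r x i. r *\<^sub>R x i"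
  using summable_sq_scale by (simp add: scaleR_conv_of_real)

lift_definition inner_sqsum :: "sqsum \<Rightarrow> sqsum \<Rightarrow> real"
  is "\<lambda>x y. \<Sum>\<^sub>\<infinity>i. inner (x i) (y i)" .

definition norm_sqsum :: "sqsum \<Rightarrow> real" where "norm_sqsum x = sqrt (inner x x)"
definition dist_sqsum :: "sqsum \<Rightarrow> sqsum \<Rightarrow> real" where "dist_sqsum x y = norm (x - y)"
definition sgn_sqsum :: "sqsum \<Rightarrow> sqsum" where "sgn_sqsum x = inverse (norm x) *\<^sub>R x"
definition uniformity_sqsum :: "(sqsum \<times> sqsum) filter" where
  "uniformity_sqsum = (INF e\<in>{0 <..}. principal {(x, y). dist x y < e})"
definition open_sqsum :: "sqsum set \<Rightarrow> bool" where
  "open_sqsum U \<longleftrightarrow> (\<forall>x\<in>U. \<forall>\<^sub>F (x', y) in uniformity. x' = x \<longrightarrow> y \<in> U)"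

instance
proof
  fix x y z :: sqsum and r s :: real
  show "x + y + z = x + (y + z)" by transfer (simp add: algebra_simps)
  show "x + y = y + x" by transfer (simp add: algebra_simps)
  show "0 + x = x" by transfer simp
  show "- x + x = 0" by transfer simp
  show "x - y = x + - y" by transfer simp
  show "r *\<^sub>R (x + y) = r *\<^sub>R x + r *\<^sub>R y" by transfer (simp add: algebra_simps)
  show "(r + s) *\<^sub>R x = r *\<^sub>R x + s *\<^sub>R x" by transfer (simp add: algebra_simps)
  show "r *\<^sub>R s *\<^sub>R x = (r * s) *\<^sub>R x" by transfer simp
  show "1 *\<^sub>R x = x" by transfer simp
  show "dist x y = norm (x - y)" by (rule dist_sqsum_def)
  show "sgn x = inverse (norm x) *\<^sub>R x" by (rule sgn_sqsum_def)
  show "(uniformity :: (sqsum \<times> sqsum) filter) = (INF e\<in>{0 <..}. principal {(x, y). dist x y < e})"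
    by (rule uniformity_sqsum_def)
  show "open U = (\<forall>x\<in>U. \<forall>\<^sub>F (x', y) in uniformity. x' = x \<longrightarrow> y \<in> U)" for U :: "sqsum set"
    by (rule open_sqsum_def)
  show "inner x y = inner y x" by transfer (simp add: inner_commute)
  show "inner (x + y) z = inner x z + inner y z"
    by transfer (simp add: inner_add_left infsum_add summable_inner_coords)
  show "inner (r *\<^sub>R x) y = r * inner x y"
    by transfer (simp add: infsum_cmult_right summable_inner_coords)
  show "0 \<le> inner x x" by transfer (simp add: infsum_nonneg)
  show "inner x x = 0 \<longleftrightarrow> x = 0"
  proof
    assume "inner x x = 0"
    then have 0: "(\<Sum>\<^sub>\<infinity>i. inner (coords x i) (coords x i)) = 0" by (simp add: inner_sqsum.rep_eq)
    have s: "(\<lambda>i. inner (coords x i) (coords x i)) summable_on UNIV"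
      by (intro summable_inner_coords sqsum_summable)
    have "coords x i = 0" for i
      using nonneg_infsum_le_0D[OF eq_refl[OF 0] s, of i] by simp
    then show "x = 0" by (intro coords_inject[THEN iffD1] ext) (simp add: zero_sqsum.rep_eq)
  next
    assume "x = 0" then show "inner x x = 0" by transfer simp
  qed
  show "norm x = sqrt (inner x x)" by (rule norm_sqsum_def)
qed

end

lemma coords_eqI: "(\<And>i. coords x i = coords y i) \<Longrightarrow> x = y"
  by (metis coords_inject ext)

lemma norm_sqsum_sq: "(norm x)\<^sup>2 = (\<Sum>\<^sub>\<infinity>i. (cmod (coords x i))\<^sup>2)"
  by (simp add: power2_norm_eq_inner inner_sqsum.rep_eq)

lemma sum_le_norm_sqsum:
  assumes "finite F"
  shows "(\<Sum>i\<in>F. (cmod (coords x i))\<^sup>2) \<le> (norm x)\<^sup>2"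
  unfolding norm_sqsum_sq using assms by (intro finite_sum_le_infsum sqsum_summable) auto

lemma coord_le_norm: "cmod (coords x i) \<le> norm x"
  by (rule power2_le_imp_le) (use sum_le_norm_sqsum[of "{i}" x] in simp_all)

text \<open>
  Bounds for finite partial sums survive limits taken coordinate by coordinate.
\<close>

lemma norm_sqsum_leI:
  assumes "0 \<le> c" "\<And>F. finite F \<Longrightarrow> (\<Sum>i\<in>F. (cmod (coords x i))\<^sup>2) \<le> c\<^sup>2"
  shows "norm x \<le> c"
proof -
  have "(norm x)\<^sup>2 \<le> c\<^sup>2"
    unfolding norm_sqsum_sq by (rule summable_on_if_bounded_partial_sums(2)) (simp_all add: assms(2))
  then show ?thesis using assms(1) by (rule power2_le_imp_le)
qed

lemma Abs_sqsum_bounded: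
  assumes "\<And>F. finite F \<Longrightarrow> (\<Sum>i\<in>F. (cmod (f i))\<^sup>2) \<le> B"
  shows "coords (Abs_sqsum f) = f"
  using summable_on_if_bounded_partial_sums(1)[OF _ assms] by (intro Abs_sqsum_inverse) auto

instance sqsum :: complete_space
proof
  fix X :: "nat \<Rightarrow> sqsum"
  assume "Cauchy X"
  then have C: "\<exists>M. \<forall>m\<ge>M. \<forall>n\<ge>M. norm (X m - X n) < e" if "e > 0" for e
    using that by (auto simp: Cauchy_def dist_norm)
  have "Cauchy (\<lambda>n. coords (X n) i)" for i
  proof (rule CauchyI)
    fix e :: real assume "e > 0"
    then obtain M where M: "\<And>m n. m \<ge> M \<Longrightarrow> n \<ge> M \<Longrightarrow> norm (X m - X n) < e" using C by blast
    have "norm (coords (X m) i - coords (X n) i) < e" if "m \<ge> M" "n \<ge> M" for m n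
      using coord_le_norm[of "X m - X n" i] M[OF that] by (simp add: minus_sqsum.rep_eq)
    then show "\<exists>M. \<forall>m\<ge>M. \<forall>n\<ge>M. norm (coords (X m) i - coords (X n) i) < e" by blast
  qed
  then have "\<forall>i. \<exists>l. (\<lambda>n. coords (X n) i) \<longlonglongrightarrow> l"
    by (simp add: Cauchy_convergent_iff convergent_def)
  then obtain f where f: "\<And>i. (\<lambda>n. coords (X n) i) \<longlonglongrightarrow> f i"
    by metis
  have *: "\<exists>M. \<forall>m\<ge>M. \<forall>F. finite F \<longrightarrow> (\<Sum>i\<in>F. (cmod (coords (X m) i - f i))\<^sup>2) \<le> e\<^sup>2" if e: "e > 0" for e :: real
  proof -
    obtain M where M: "\<And>m n. m \<ge> M \<Longrightarrow> n \<ge> M \<Longrightarrow> norm (X m - X n) < e" using C[OF e] by blast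
    have "(\<Sum>i\<in>F. (cmod (coords (X m) i - f i))\<^sup>2) \<le> e\<^sup>2" if "finite F" "m \<ge> M" for m F
    proof (rule tendsto_upperbound)
      show "(\<lambda>n. \<Sum>i\<in>F. (cmod (coords (X m) i - coords (X n) i))\<^sup>2)
              \<longlonglongrightarrow> (\<Sum>i\<in>F. (cmod (coords (X m) i - f i))\<^sup>2)"
        by (intro tendsto_intros f)
      show "\<forall>\<^sub>F n in sequentially. (\<Sum>i\<in>F. (cmod (coords (X m) i - coords (X n) i))\<^sup>2) \<le> e\<^sup>2"
      proof (rule eventually_sequentiallyI[of M])
        fix n assume "n \<ge> M"
        then have "norm (X m - X n) \<le> e" using M[OF \<open>m \<ge> M\<close>] by (simp add: less_imp_le)
          then have "(norm (X m - X n))\<^sup>2 \<le> e\<^sup>2" by (intro power_mono) simp_all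
        then show "(\<Sum>i\<in>F. (cmod (coords (X m) i - coords (X n) i))\<^sup>2) \<le> e\<^sup>2"
          using sum_le_norm_sqsum[OF \<open>finite F\<close>, of "X m - X n"] by (simp add: minus_sqsum.rep_eq)
      qed
    qed simp
    then show ?thesis by blast
  qed
  have "(0 :: real) < 1" by simp
  from *[OF this] obtain M
    where "\<forall>m\<ge>M. \<forall>F. finite F \<longrightarrow> (\<Sum>i\<in>F. (cmod (coords (X m) i - f i))\<^sup>2) \<le> 1\<^sup>2"
    by (rule exE)
  then have "\<forall>F. finite F \<longrightarrow> (\<Sum>i\<in>F. (cmod (coords (X M) i - f i))\<^sup>2) \<le> 1\<^sup>2"
    by (rule allE[of _ M]) simp
  then have "coords (Abs_sqsum (\<lambda>i. coords (X M) i - f i)) = (\<lambda>i. coords (X M) i - f i)"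
    by (intro Abs_sqsum_bounded[of _ "1\<^sup>2"]) auto
  then have f': "coords (X M - Abs_sqsum (\<lambda>i. coords (X M) i - f i)) = f"
    by (simp add: minus_sqsum.rep_eq)
  define l where "l = X M - Abs_sqsum (\<lambda>i. coords (X M) i - f i)"
  have l: "coords l = f" unfolding l_def by (rule f')
  have "X \<longlonglongrightarrow> l"
  proof (rule LIMSEQ_I)
    fix e :: real assume "e > 0"
    then obtain M where M: "\<And>m F. m \<ge> M \<Longrightarrow> finite F \<Longrightarrow> (\<Sum>i\<in>F. (cmod (coords (X m) i - f i))\<^sup>2) \<le> (e/2)\<^sup>2"
      using *[of "e/2"] by (meson half_gt_zero)
    have "norm (X m - l) \<le> e / 2" if "m \<ge> M" for m
      using \<open>e > 0\<close> M[OF that] by (intro norm_sqsum_leI) (auto simp: minus_sqsum.rep_eq l)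
    moreover have "e / 2 < e" using \<open>e > 0\<close> by simp
    ultimately show "\<exists>M. \<forall>m\<ge>M. norm (X m - l) < e" by (meson le_less_trans)
  qed
  then show "convergent X" by (auto simp: convergent_def)
qed

section \<open>Infinite matrices acting on square-summable sequences\<close>

lemma abs_summable_double:
  fixes f :: "'a \<Rightarrow> 'b \<Rightarrow> 'c :: banach"
  assumes "\<And>F G. finite F \<Longrightarrow> finite G \<Longrightarrow> (\<Sum>i\<in>F. \<Sum>j\<in>G. norm (f i j)) \<le> B"
  shows "(\<lambda>(i, j). f i j) summable_on UNIV"
proof (rule abs_summable_summable)
  show "(\<lambda>p. norm (case p of (i, j) \<Rightarrow> f i j)) summable_on UNIV"
  proof (rule summable_on_if_bounded_partial_sums(1))
    fix H :: "('a \<times> 'b) set" assume H: "finite H"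
    have "(\<Sum>p\<in>H. norm (case p of (i, j) \<Rightarrow> f i j)) \<le>
          (\<Sum>p\<in>fst ` H \<times> snd ` H. norm (case p of (i, j) \<Rightarrow> f i j))"
      using H by (intro sum_mono2) (auto intro: rev_image_eqI)
    also have "\<dots> = (\<Sum>i\<in>fst ` H. \<Sum>j\<in>snd ` H. norm (f i j))"
      by (simp add: sum.cartesian_product case_prod_unfold)
    also have "\<dots> \<le> B" using H by (intro assms) auto
    finally show "(\<Sum>p\<in>H. norm (case p of (i, j) \<Rightarrow> f i j)) \<le> B" .
  qed simp
qed

text \<open>
  Fubini's theorem for series, with absolute summability expressed by a bound for the sums over
  finite rectangles.
\<close>

lemma infsum_swap_bounded:
  fixes f :: "'a \<Rightarrow> 'b \<Rightarrow> 'c :: banach"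
  assumes "\<And>F G. finite F \<Longrightarrow> finite G \<Longrightarrow> (\<Sum>i\<in>F. \<Sum>j\<in>G. norm (f i j)) \<le> B"
  shows "(\<Sum>\<^sub>\<infinity>i. \<Sum>\<^sub>\<infinity>j. f i j) = (\<Sum>\<^sub>\<infinity>j. \<Sum>\<^sub>\<infinity>i. f i j)"
  by (rule infsum_swap_banach) (use abs_summable_double[of f, OF assms] in simp)

lemma abs_summable_bounded:
  fixes f :: "'a \<Rightarrow> 'c :: banach"
  assumes "\<And>F. finite F \<Longrightarrow> (\<Sum>i\<in>F. norm (f i)) \<le> B"
  shows "(\<lambda>i. norm (f i)) summable_on UNIV" "f summable_on UNIV" "norm (infsum f UNIV) \<le> B"
proof -
  show s: "(\<lambda>i. norm (f i)) summable_on UNIV"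
    by (rule summable_on_if_bounded_partial_sums(1)) (use assms in auto)
  show "f summable_on UNIV" using s by (rule abs_summable_summable)
  have "norm (infsum f UNIV) \<le> (\<Sum>\<^sub>\<infinity>i. norm (f i))" using s by (rule norm_infsum_bound)
  also have "\<dots> \<le> B" by (rule summable_on_if_bounded_partial_sums(2)) (use assms in auto)
  finally show "norm (infsum f UNIV) \<le> B" .
qed

type_synonym inf_mat = "nat \<Rightarrow> nat \<Rightarrow> complex"

text \<open>
  The hypotheses of the Schur test with one constant for rows and columns; finite partial sums
  make the condition independent of any summability assumption.
\<close>

definition schur_bound :: "real \<Rightarrow> inf_mat \<Rightarrow> bool" where
  "schur_bound C a \<longleftrightarrow>
     (\<forall>i F. finite F \<longrightarrow> (\<Sum>j\<in>F. cmod (a i j)) \<le> C) \<and>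
     (\<forall>j F. finite F \<longrightarrow> (\<Sum>i\<in>F. cmod (a i j)) \<le> C)"

definition mat_app :: "inf_mat \<Rightarrow> (nat \<Rightarrow> complex) \<Rightarrow> nat \<Rightarrow> complex" where
  "mat_app a x i = (\<Sum>\<^sub>\<infinity>j. a i j * x j)"

definition mat_prod :: "inf_mat \<Rightarrow> inf_mat \<Rightarrow> inf_mat" where
  "mat_prod a b i k = (\<Sum>\<^sub>\<infinity>j. a i j * b j k)"

definition adj :: "inf_mat \<Rightarrow> inf_mat" where
  "adj a i j = cnj (a j i)"

lemma schur_bound_nonneg: "schur_bound C a \<Longrightarrow> 0 \<le> C"
  unfolding schur_bound_def by (metis finite.emptyI sum.empty)

lemma schur_bound_row: "schur_bound C a \<Longrightarrow> finite F \<Longrightarrow> (\<Sum>j\<in>F. cmod (a i j)) \<le> C"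
  and schur_bound_col: "schur_bound C a \<Longrightarrow> finite F \<Longrightarrow> (\<Sum>i\<in>F. cmod (a i j)) \<le> C"
  unfolding schur_bound_def by auto

lemma schur_bound_adj: "schur_bound C a \<Longrightarrow> schur_bound C (adj a)"
  unfolding schur_bound_def adj_def by simp

lemma sum_row_le:
  assumes a: "schur_bound C a" and x: "\<And>j. cmod (x j) \<le> D" and F: "finite F"
  shows "(\<Sum>j\<in>F. cmod (a i j * x j)) \<le> C * D"
proof -
  have D: "0 \<le> D" using x[of 0] norm_ge_zero order_trans by blast
  have "(\<Sum>j\<in>F. cmod (a i j * x j)) \<le> (\<Sum>j\<in>F. cmod (a i j) * D)"
    unfolding norm_mult by (intro sum_mono mult_left_mono x) auto
  also have "\<dots> = (\<Sum>j\<in>F. cmod (a i j)) * D" by (simp add: sum_distrib_right)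
  also have "\<dots> \<le> C * D" using D by (intro mult_right_mono schur_bound_row[OF a F])
  finally show ?thesis .
qed

lemma row_abs_summable:
  assumes "schur_bound C a" "\<And>j. cmod (x j) \<le> D"
  shows "(\<lambda>j. norm (a i j * x j)) summable_on UNIV"
  using abs_summable_bounded(1)[OF sum_row_le[of C a x D]] assms by blast

lemma row_summable:
  assumes "schur_bound C a" "\<And>j. cmod (x j) \<le> D"
  shows "(\<lambda>j. a i j * x j) summable_on UNIV"
  using row_abs_summable[OF assms] by (rule abs_summable_summable)

text \<open>
  Fubini's theorem applies because \<open>x\<close> is bounded and the absolute row sums of both matrices are too.
\<close>

lemma mat_app_assoc:
  assumes a: "schur_bound C a" and b: "schur_bound C' b" and x: "\<And>j. cmod (x j) \<le> D"
  shows "mat_app b (mat_app a x) = mat_app (mat_prod b a) x"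
proof
  fix i
  have D: "0 \<le> D" using x[of 0] norm_ge_zero order_trans by blast
  have "mat_app b (mat_app a x) i = (\<Sum>\<^sub>\<infinity>j. \<Sum>\<^sub>\<infinity>k. b i j * (a j k * x k))"
    unfolding mat_app_def by (simp add: infsum_cmult_right[OF row_summable[OF a x]])
  also have "\<dots> = (\<Sum>\<^sub>\<infinity>k. \<Sum>\<^sub>\<infinity>j. b i j * (a j k * x k))"
  proof (rule infsum_swap_bounded[where B = "C' * (C * D)"])
    fix F G :: "nat set" assume "finite F" "finite G"
    have "(\<Sum>j\<in>F. \<Sum>k\<in>G. norm (b i j * (a j k * x k))) =
          (\<Sum>j\<in>F. cmod (b i j) * (\<Sum>k\<in>G. cmod (a j k * x k)))"
      by (simp add: norm_mult sum_distrib_left)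
    also have "\<dots> \<le> (\<Sum>j\<in>F. cmod (b i j) * (C * D))"
      using \<open>finite G\<close> by (intro sum_mono mult_left_mono sum_row_le[OF a x]) auto
    also have "\<dots> = (\<Sum>j\<in>F. cmod (b i j)) * (C * D)" by (simp add: sum_distrib_right)
    also have "\<dots> \<le> C' * (C * D)"
      using \<open>finite F\<close> D schur_bound_nonneg[OF a] by (intro mult_right_mono schur_bound_row[OF b]) auto
    finally show "(\<Sum>j\<in>F. \<Sum>k\<in>G. norm (b i j * (a j k * x k))) \<le> C' * (C * D)" .
  qed
  also have "\<dots> = (\<Sum>\<^sub>\<infinity>k. mat_prod b a i k * x k)"
  proof (rule infsum_cong)
    fix k
    have bnd: "cmod (a j k) \<le> C" for j using schur_bound_row[OF a, of "{k}" j] by simp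
    show "(\<Sum>\<^sub>\<infinity>j. b i j * (a j k * x k)) = mat_prod b a i k * x k"
      unfolding mat_prod_def using infsum_cmult_left[OF row_summable[OF b bnd, of i], where c = "x k"]
      by (simp add: mult.assoc)
  qed
  finally show "mat_app b (mat_app a x) i = mat_app (mat_prod b a) x i"
    by (simp add: mat_app_def)
qed

text \<open>
  The Schur test. Writing \<open>\<bar>a i j\<bar>\<close> as the square of its square root, Cauchy--Schwarz in \<open>j\<close> costs
  one factor \<open>C\<close> for the row sums, and the summation over \<open>i\<close> then costs another one for the column
  sums. This is done for finite rectangles; the sum over \<open>j\<close> is completed by a limit.
\<close>

lemma mat_app_sq_sum_le:
  assumes a: "schur_bound C a" and F: "finite F"
  shows "(\<Sum>i\<in>F. (cmod (mat_app a (coords x) i))\<^sup>2) \<le> (C * norm x)\<^sup>2"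
proof (rule tendsto_upperbound)
  have C: "0 \<le> C" by (rule schur_bound_nonneg[OF a])
  have "((\<lambda>G. \<Sum>j\<in>G. a i j * coords x j) \<longlongrightarrow> mat_app a (coords x) i) (finite_subsets_at_top UNIV)" for i
    unfolding mat_app_def by (rule infsum_tendsto, rule row_summable[OF a coord_le_norm])
  then show "((\<lambda>G. \<Sum>i\<in>F. (cmod (\<Sum>j\<in>G. a i j * coords x j))\<^sup>2)
       \<longlongrightarrow> (\<Sum>i\<in>F. (cmod (mat_app a (coords x) i))\<^sup>2)) (finite_subsets_at_top UNIV)"
    by (intro tendsto_intros)
  show "\<forall>\<^sub>F G in finite_subsets_at_top UNIV. (\<Sum>i\<in>F. (cmod (\<Sum>j\<in>G. a i j * coords x j))\<^sup>2) \<le> (C * norm x)\<^sup>2"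
  proof (rule eventually_finite_subsets_at_top_weakI)
    fix G :: "nat set" assume G: "finite G"
    have row: "(cmod (\<Sum>j\<in>G. a i j * coords x j))\<^sup>2 \<le> C * (\<Sum>j\<in>G. cmod (a i j) * (cmod (coords x j))\<^sup>2)" for i
    proof -
      have "cmod (\<Sum>j\<in>G. a i j * coords x j) \<le>
            (\<Sum>j\<in>G. sqrt (cmod (a i j)) * (sqrt (cmod (a i j)) * cmod (coords x j)))"
        by (rule order_trans[OF norm_sum]) (simp add: norm_mult mult.assoc[symmetric])
      then have "(cmod (\<Sum>j\<in>G. a i j * coords x j))\<^sup>2 \<le>
            (\<Sum>j\<in>G. sqrt (cmod (a i j)) * (sqrt (cmod (a i j)) * cmod (coords x j)))\<^sup>2"
        by (intro power_mono) auto
      also have "\<dots> \<le> (\<Sum>j\<in>G. (sqrt (cmod (a i j)))\<^sup>2) * (\<Sum>j\<in>G. (sqrt (cmod (a i j)) * cmod (coords x j))\<^sup>2)"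
        by (rule Cauchy_Schwarz_ineq_sum)
      also have "\<dots> = (\<Sum>j\<in>G. cmod (a i j)) * (\<Sum>j\<in>G. cmod (a i j) * (cmod (coords x j))\<^sup>2)"
        by (simp add: power_mult_distrib)
      also have "\<dots> \<le> C * (\<Sum>j\<in>G. cmod (a i j) * (cmod (coords x j))\<^sup>2)"
        by (intro mult_right_mono schur_bound_row[OF a G] sum_nonneg) auto
      finally show ?thesis .
    qed
    have "(\<Sum>i\<in>F. (cmod (\<Sum>j\<in>G. a i j * coords x j))\<^sup>2)
       \<le> (\<Sum>i\<in>F. C * (\<Sum>j\<in>G. cmod (a i j) * (cmod (coords x j))\<^sup>2))"
      by (intro sum_mono row)
    also have "\<dots> = C * (\<Sum>j\<in>G. (\<Sum>i\<in>F. cmod (a i j)) * (cmod (coords x j))\<^sup>2)"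
    proof -
      have "(\<Sum>i\<in>F. \<Sum>j\<in>G. cmod (a i j) * (cmod (coords x j))\<^sup>2)
          = (\<Sum>j\<in>G. \<Sum>i\<in>F. cmod (a i j) * (cmod (coords x j))\<^sup>2)"
        by (rule sum.swap)
      then show ?thesis by (simp add: sum_distrib_left[symmetric] sum_distrib_right)
    qed
    also have "\<dots> \<le> C * (\<Sum>j\<in>G. C * (cmod (coords x j))\<^sup>2)"
      using C by (intro mult_left_mono sum_mono mult_right_mono schur_bound_col[OF a F]) auto
    also have "\<dots> = C\<^sup>2 * (\<Sum>j\<in>G. (cmod (coords x j))\<^sup>2)"
      by (simp add: sum_distrib_left power2_eq_square mult.assoc)
    also have "\<dots> \<le> C\<^sup>2 * (norm x)\<^sup>2"
      by (intro mult_left_mono sum_le_norm_sqsum G) auto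
    finally show "(\<Sum>i\<in>F. (cmod (\<Sum>j\<in>G. a i j * coords x j))\<^sup>2) \<le> (C * norm x)\<^sup>2"
      by (simp add: power_mult_distrib)
  qed
qed simp

definition mat_op :: "inf_mat \<Rightarrow> sqsum \<Rightarrow> sqsum" where
  "mat_op a x = Abs_sqsum (mat_app a (coords x))"

lemma coords_mat_op:
  assumes "schur_bound C a"
  shows "coords (mat_op a x) = mat_app a (coords x)"
  unfolding mat_op_def by (rule Abs_sqsum_bounded) (rule mat_app_sq_sum_le[OF assms])

lemma mat_app_add:
  assumes "schur_bound C a" "\<And>j. cmod (x j) \<le> D" "\<And>j. cmod (y j) \<le> D'"
  shows "mat_app a (\<lambda>j. x j + y j) i = mat_app a x i + mat_app a y i"
  unfolding mat_app_def distrib_left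
  by (intro infsum_add row_summable[OF assms(1,2)] row_summable[OF assms(1,3)])

lemma mat_app_scale: "mat_app a (\<lambda>j. c * x j) i = c * mat_app a x i"
  unfolding mat_app_def by (simp add: mult.left_commute infsum_cmult_right')

lemma bounded_linear_mat_op:
  assumes a: "schur_bound C a"
  shows "bounded_linear (mat_op a)"
proof (rule bounded_linear_intro[where K = C])
  fix x y :: sqsum and r :: real
  show "mat_op a (x + y) = mat_op a x + mat_op a y"
    by (rule coords_eqI)
       (simp add: coords_mat_op[OF a] plus_sqsum.rep_eq mat_app_add[OF a coord_le_norm coord_le_norm])
  show "mat_op a (r *\<^sub>R x) = r *\<^sub>R mat_op a x"
    by (rule coords_eqI) (simp add: coords_mat_op[OF a] scaleR_sqsum.rep_eq scaleR_conv_of_real mat_app_scale)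
  show "norm (mat_op a x) \<le> norm x * C"
    using schur_bound_nonneg[OF a] mat_app_sq_sum_le[OF a, of _ x]
    by (intro norm_sqsum_leI) (auto simp: coords_mat_op[OF a] mult.commute)
qed

text \<open>
  Both sides are iterated sums of one double series. It converges absolutely because of
  \<open>\<bar>x j\<bar> \<bar>y i\<bar> \<le> \<bar>x j\<bar>\<^sup>2 + \<bar>y i\<bar>\<^sup>2\<close> and the bounds for the column sums and row sums of \<open>a\<close>.
\<close>

lemma inner_mat_op:
  assumes a: "schur_bound C a"
  shows "inner (mat_op a x) y = inner x (mat_op (adj a) y)"
proof -
  define X Y where "X = coords x" and "Y = coords y"
  have bl: "bounded_linear (\<lambda>u. inner u w)" "bounded_linear (\<lambda>u. inner w u)" for w :: complex
    by (rule bounded_linear_inner_left bounded_linear_inner_right)+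
  have "inner (mat_op a x) y = (\<Sum>\<^sub>\<infinity>i. inner (\<Sum>\<^sub>\<infinity>j. a i j * X j) (Y i))"
    by (simp add: inner_sqsum.rep_eq coords_mat_op[OF a] mat_app_def X_def Y_def)
  also have "\<dots> = (\<Sum>\<^sub>\<infinity>i. \<Sum>\<^sub>\<infinity>j. inner (a i j * X j) (Y i))"
    unfolding X_def
    by (intro infsum_cong infsumI[symmetric] has_sum_bounded_linear[OF bl(1)] has_sum_infsum
        row_summable[OF a coord_le_norm])
  also have "\<dots> = (\<Sum>\<^sub>\<infinity>j. \<Sum>\<^sub>\<infinity>i. inner (a i j * X j) (Y i))"
  proof (rule infsum_swap_bounded[where B = "C * (norm x)\<^sup>2 + C * (norm y)\<^sup>2"])
    fix F G :: "nat set" assume F: "finite F" and G: "finite G"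
    have C: "0 \<le> C" by (rule schur_bound_nonneg[OF a])
    have "norm (inner (a i j * X j) (Y i)) \<le> cmod (a i j) * (cmod (X j))\<^sup>2 + cmod (a i j) * (cmod (Y i))\<^sup>2" for i j
    proof -
      have "norm (inner (a i j * X j) (Y i)) \<le> cmod (a i j) * (cmod (X j) * cmod (Y i))"
        using Cauchy_Schwarz_ineq2[of "a i j * X j" "Y i"] by (simp add: norm_mult mult.assoc)
      also have "\<dots> \<le> cmod (a i j) * ((cmod (X j))\<^sup>2 + (cmod (Y i))\<^sup>2)"
      proof (rule mult_left_mono)
        have "2 * (cmod (X j) * cmod (Y i)) \<le> (cmod (X j))\<^sup>2 + (cmod (Y i))\<^sup>2"
          using sum_squares_bound[of "cmod (X j)" "cmod (Y i)"] by (simp add: algebra_simps)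
        moreover have "0 \<le> cmod (X j) * cmod (Y i)" by simp
        ultimately show "cmod (X j) * cmod (Y i) \<le> (cmod (X j))\<^sup>2 + (cmod (Y i))\<^sup>2" by linarith
      qed simp
      finally show ?thesis by (simp add: distrib_left)
    qed
    then have "(\<Sum>i\<in>F. \<Sum>j\<in>G. norm (inner (a i j * X j) (Y i))) \<le>
        (\<Sum>i\<in>F. \<Sum>j\<in>G. cmod (a i j) * (cmod (X j))\<^sup>2 + cmod (a i j) * (cmod (Y i))\<^sup>2)"
      by (intro sum_mono)
    also have "\<dots> = (\<Sum>j\<in>G. (\<Sum>i\<in>F. cmod (a i j)) * (cmod (X j))\<^sup>2) + (\<Sum>i\<in>F. (\<Sum>j\<in>G. cmod (a i j)) * (cmod (Y i))\<^sup>2)"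
      by (simp add: sum.distrib sum_distrib_right sum.swap[of _ F])
    also have "\<dots> \<le> (\<Sum>j\<in>G. C * (cmod (X j))\<^sup>2) + (\<Sum>i\<in>F. C * (cmod (Y i))\<^sup>2)"
      by (intro add_mono sum_mono mult_right_mono schur_bound_row[OF a G] schur_bound_col[OF a F]) auto
    also have "\<dots> \<le> C * (norm x)\<^sup>2 + C * (norm y)\<^sup>2"
      unfolding sum_distrib_left[symmetric] X_def Y_def using C
      by (intro add_mono mult_left_mono sum_le_norm_sqsum F G)
    finally show "(\<Sum>i\<in>F. \<Sum>j\<in>G. norm (inner (a i j * X j) (Y i))) \<le> C * (norm x)\<^sup>2 + C * (norm y)\<^sup>2" .
  qed
  also have "\<dots> = (\<Sum>\<^sub>\<infinity>j. \<Sum>\<^sub>\<infinity>i. inner (X j) (adj a j i * Y i))"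
    by (intro infsum_cong) (simp add: inner_complex_def adj_def algebra_simps)
  also have "\<dots> = (\<Sum>\<^sub>\<infinity>j. inner (X j) (\<Sum>\<^sub>\<infinity>i. adj a j i * Y i))"
    unfolding Y_def
    by (intro infsum_cong infsumI has_sum_bounded_linear[OF bl(2)] has_sum_infsum
        row_summable[OF schur_bound_adj[OF a] coord_le_norm])
  also have "\<dots> = inner x (mat_op (adj a) y)"
    by (simp add: inner_sqsum.rep_eq coords_mat_op[OF schur_bound_adj[OF a]] mat_app_def X_def Y_def)
  finally show ?thesis .
qed

section \<open>Adjoint pairs\<close>

text \<open>
  If the adjoint \<open>g\<close> of \<open>f\<close> is bounded below, then \<open>f g\<close> is a self-adjoint operator between
  \<open>c\<^sup>2\<close> and \<open>M\<close>, for \<open>M\<close> large. So \<open>1 - f g / M\<close> is a strict contraction, and the fixed point of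
  \<open>x \<mapsto> x - (f g x - y) / M\<close> solves \<open>f g x = y\<close>.
\<close>

lemma adjoint_pair_bounded_below_surj:
  fixes f g :: "'h :: {real_inner, complete_space} \<Rightarrow> 'h"
  assumes f: "bounded_linear f" and g: "bounded_linear g"
    and adj: "\<And>x y. inner (f x) y = inner x (g y)"
    and c: "0 < c" "\<And>x. c * norm x \<le> norm (g x)"
  shows "\<exists>z. f (g z) = y"
proof -
  interpret f: bounded_linear f by (rule f)
  interpret g: bounded_linear g by (rule g)
  obtain B where B: "B > 0" "\<And>x. norm (f x) \<le> norm x * B" using f.pos_bounded by blast
  \<comment> \<open>The summand \<open>c\<^sup>2\<close> keeps \<open>1 - c\<^sup>2 / M\<close> nonnegative without a comparison of \<open>c\<close> and \<open>B\<close>.\<close>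
  define M where "M = B\<^sup>2 + c\<^sup>2"
  have M: "M > 0" "B\<^sup>2 \<le> M" "c\<^sup>2 \<le> M"
    using B(1) c(1) by (simp_all add: M_def add_pos_pos)
  define q where "q = sqrt (1 - c\<^sup>2 / M)"
  have "c\<^sup>2 / M \<le> 1" "0 < c\<^sup>2 / M" using M c(1) by simp_all
  then have q: "0 \<le> q" "q < 1" "q\<^sup>2 = 1 - c\<^sup>2 / M"
    by (simp_all add: q_def)
  have contr: "norm (x - (1/M) *\<^sub>R f (g x)) \<le> q * norm x" for x
  proof (rule power2_le_imp_le)
    have n: "(norm (x - (1/M) *\<^sub>R f (g x)))\<^sup>2
       = (norm x)\<^sup>2 - 2 / M * (norm (g x))\<^sup>2 + (1/M)\<^sup>2 * (norm (f (g x)))\<^sup>2"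
    proof -
      have "inner x (f (g x)) = inner (g x) (g x)"
        using adj[of "g x" x] by (simp add: inner_commute)
      moreover have "inner (x - k *\<^sub>R b) (x - k *\<^sub>R b) = inner x x - 2 * k * inner x b + k\<^sup>2 * inner b b" for k b
        by (simp add: inner_diff_left inner_diff_right inner_commute[of b x] power2_eq_square algebra_simps)
      ultimately show ?thesis unfolding power2_norm_eq_inner by simp
    qed
    have "(norm (f (g x)))\<^sup>2 \<le> (norm (g x) * B)\<^sup>2"
      using B by (intro power_mono) auto
    also have "\<dots> \<le> (norm (g x))\<^sup>2 * M" unfolding power_mult_distrib using M by (intro mult_left_mono) auto
    finally have "(1/M)\<^sup>2 * (norm (f (g x)))\<^sup>2 \<le> (1/M)\<^sup>2 * ((norm (g x))\<^sup>2 * M)"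
      by (intro mult_left_mono) auto
    also have "\<dots> = (norm (g x))\<^sup>2 / M" using M by (simp add: power2_eq_square)
    finally have 1: "(norm (x - (1/M) *\<^sub>R f (g x)))\<^sup>2 \<le> (norm x)\<^sup>2 - (norm (g x))\<^sup>2 / M"
      unfolding n by simp
    have "(c * norm x)\<^sup>2 \<le> (norm (g x))\<^sup>2" using c by (intro power_mono) auto
    then have "(c * norm x)\<^sup>2 / M \<le> (norm (g x))\<^sup>2 / M" using M by (intro divide_right_mono) auto
    moreover have "(q * norm x)\<^sup>2 = (norm x)\<^sup>2 - (c * norm x)\<^sup>2 / M"
      unfolding power_mult_distrib q(3) by (simp add: left_diff_distrib)
    ultimately show "(norm (x - (1/M) *\<^sub>R f (g x)))\<^sup>2 \<le> (q * norm x)\<^sup>2"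
      using 1 by linarith
    show "0 \<le> q * norm x" using q by simp
  qed
  define h where "h = (\<lambda>x. x - (1/M) *\<^sub>R (f (g x) - y))"
  have "\<exists>!x. h x = x"
  proof (rule banach_fix_type)
    show "0 \<le> q" "q < 1" by fact+
    show "\<forall>x z. dist (h x) (h z) \<le> q * dist x z"
    proof (intro allI)
      fix x z
      have "h x - h z = (x - z) - (1/M) *\<^sub>R f (g (x - z))"
        by (simp add: h_def g.diff f.diff scaleR_diff_right)
      then show "dist (h x) (h z) \<le> q * dist x z" using contr[of "x - z"] by (simp add: dist_norm)
    qed
  qed
  then obtain z where "h z = z" by blast
  then have "(1/M) *\<^sub>R (f (g z) - y) = 0" by (simp add: h_def)
  then show ?thesis using M by auto
qed

section \<open>A Fredholm alternative for infinite matrices\<close>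

definition exp_decaying :: "(nat \<Rightarrow> complex) \<Rightarrow> bool" where
  "exp_decaying z \<longleftrightarrow> (\<exists>C r. 0 < r \<and> r < 1 \<and> (\<forall>i. cmod (z i) \<le> C * r ^ i))"

text \<open>
  Decay in both indices, away from the corner of the matrix. This is how products of two Hankel
  matrices of analytic symbols behave, and it makes the operator compact.
\<close>

definition exp_decaying_mat :: "inf_mat \<Rightarrow> bool" where
  "exp_decaying_mat L \<longleftrightarrow> (\<exists>C r. 0 < r \<and> r < 1 \<and> (\<forall>i j. cmod (L i j) \<le> C * r ^ (i + j)))"

lemma sum_geometric_le:
  fixes r :: real
  assumes "0 < r" "r < 1" "finite F"
  shows "(\<Sum>i\<in>F. r ^ i) \<le> 1 / (1 - r)"
  using sum_le_suminf[OF summable_geometric \<open>finite F\<close>, of r] assms by (simp add: suminf_geometric)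

lemma norm_le_sum_coords:
  assumes "\<And>F. finite F \<Longrightarrow> (\<Sum>i\<in>F. cmod (coords x i)) \<le> B"
  shows "norm x \<le> B"
proof (rule norm_sqsum_leI)
  show "0 \<le> B" using assms[of "{}"] by simp
  fix F :: "nat set" assume F: "finite F"
  have "(L2_set (\<lambda>i. cmod (coords x i)) F)\<^sup>2 \<le> B\<^sup>2"
    using L2_set_le_sum[of F "\<lambda>i. cmod (coords x i)"] assms[OF F]
    by (intro power_mono) auto
  then show "(\<Sum>i\<in>F. (cmod (coords x i))\<^sup>2) \<le> B\<^sup>2"
    unfolding L2_set_def by (simp add: sum_nonneg)
qed

lemma exp_decaying_mat_schur:
  assumes "exp_decaying_mat L"
  obtains C where "schur_bound C L"
proof -
  from assms obtain C r where r: "0 < r" "r < 1" and L: "\<And>i j. cmod (L i j) \<le> C * r ^ (i + j)"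
    unfolding exp_decaying_mat_def by blast
  have C: "0 \<le> C" using order_trans[OF norm_ge_zero L[of 0 0]] by simp
  have le: "C * r ^ (i + j) \<le> C * r ^ j" for i j
    using r C by (intro mult_left_mono) (auto simp: power_add mult_le_cancel_right1 power_le_one)
  have "(\<Sum>j\<in>F. cmod (L i j)) \<le> C * (1 / (1 - r))" if "finite F" for i F
  proof -
    have "(\<Sum>j\<in>F. cmod (L i j)) \<le> (\<Sum>j\<in>F. C * r ^ j)"
      by (intro sum_mono order_trans[OF L le])
    also have "\<dots> \<le> C * (1 / (1 - r))"
      unfolding sum_distrib_left[symmetric] using C that r by (intro mult_left_mono sum_geometric_le)
    finally show ?thesis .
  qed
  moreover have "(\<Sum>i\<in>F. cmod (L i j)) \<le> C * (1 / (1 - r))" if "finite F" for j F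
  proof -
    have "(\<Sum>i\<in>F. cmod (L i j)) \<le> (\<Sum>i\<in>F. C * r ^ i)"
      by (intro sum_mono order_trans[OF L]) (subst add.commute, rule le)
    also have "\<dots> \<le> C * (1 / (1 - r))"
      unfolding sum_distrib_left[symmetric] using C that r by (intro mult_left_mono sum_geometric_le)
    finally show ?thesis .
  qed
  ultimately have "schur_bound (C * (1 / (1 - r))) L" unfolding schur_bound_def by blast
  then show ?thesis by (rule that)
qed

lemma mat_app_one_minus:
  assumes L: "schur_bound C L" and x: "\<And>j. cmod (x j) \<le> D"
  shows "mat_app (\<lambda>i j. (if i = j then 1 else 0) - L i j) x i = x i - mat_app L x i"
proof -
  have 1: "((\<lambda>j. (if i = j then 1 else 0) * x j) has_sum x i) UNIV"
    using has_sum_finite_neutralI[of "{i}" UNIV "\<lambda>j. (if i = j then 1 else 0) * x j" "x i"] by simp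
  have "((\<lambda>j. (if i = j then 1 else 0) * x j - L i j * x j) has_sum (x i - mat_app L x i)) UNIV"
    unfolding mat_app_def diff_conv_add_uminus
    by (intro has_sum_add 1 has_sum_uminusI has_sum_infsum row_summable[OF L x])
  then show ?thesis
    unfolding mat_app_def by (intro infsumI) (simp add: left_diff_distrib)
qed

text \<open>
  Tychonoff's theorem for a product of countably many discs, which is first countable.
\<close>

lemma bounded_seq_pointwise_subseq:
  fixes u :: "nat \<Rightarrow> nat \<Rightarrow> complex"
  assumes "\<And>k i. cmod (u k i) \<le> B"
  obtains \<xi> r where "strict_mono (r :: nat \<Rightarrow> nat)" "\<And>i. (\<lambda>k. u (r k) i) \<longlonglongrightarrow> \<xi> i"
proof -
  let ?S = "PiE UNIV (\<lambda>_ :: nat. cball (0 :: complex) B)"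
  have "compactin (product_topology (\<lambda>_. euclidean) UNIV) ?S"
    unfolding compactin_PiE by auto
  then have "compact ?S" unfolding euclidean_product_topology by simp
  then have "seq_compact ?S" by (rule compact_imp_seq_compact)
  moreover have "\<forall>k. u k \<in> ?S" using assms by auto
  ultimately obtain \<xi> r where r: "strict_mono r" "(u \<circ> r) \<longlonglongrightarrow> \<xi>"
    by (rule seq_compactE)
  have "(\<lambda>k. u (r k) i) \<longlonglongrightarrow> \<xi> i" for i
    using continuous_on_tendsto_compose[OF continuous_on_product_coordinates r(2), of i]
    by (simp add: o_def)
  with r(1) show ?thesis by (rule that)
qed

text \<open>
  A quantitative form of compactness. The weighted sum in the first estimate tends to zero along
  every norm-bounded sequence that tends to zero in each coordinate; the second estimate says that
  the range of \<open>L\<close> consists of exponentially decaying sequences.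
\<close>

lemma norm_decaying_op_le:
  assumes r: "0 < r" "r < 1" and L: "\<And>i j. cmod (L i j) \<le> C * r ^ (i + j)"
    and S: "schur_bound C' L"
  shows "norm (mat_op L y) \<le> C / (1 - r) * (\<Sum>j. r ^ j * cmod (coords y j))"
    and "cmod (mat_app L (coords y) i) \<le> C / (1 - r) * norm y * r ^ i"
proof -
  have C: "0 \<le> C" using order_trans[OF norm_ge_zero L[of 0 0]] by simp
  have bnd: "(\<Sum>j\<in>F. norm (r ^ j * cmod (coords y j))) \<le> norm y * (1 / (1 - r))" if "finite F" for F
  proof -
    have "(\<Sum>j\<in>F. norm (r ^ j * cmod (coords y j))) \<le> (\<Sum>j\<in>F. r ^ j * norm y)"
      using r by (intro sum_mono) (auto simp: coord_le_norm mult_left_mono)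
    also have "\<dots> = norm y * (\<Sum>j\<in>F. r ^ j)" by (simp add: sum_distrib_left mult.commute)
    also have "\<dots> \<le> norm y * (1 / (1 - r))" using r that by (intro mult_left_mono sum_geometric_le) auto
    finally show ?thesis .
  qed
  define \<delta> where "\<delta> = (\<Sum>\<^sub>\<infinity>j. r ^ j * cmod (coords y j))"
  have s: "((\<lambda>j. r ^ j * cmod (coords y j)) has_sum \<delta>) UNIV"
    unfolding \<delta>_def by (intro has_sum_infsum abs_summable_bounded(2)[OF bnd])
  have \<delta>: "\<delta> = (\<Sum>j. r ^ j * cmod (coords y j))"
    using has_sum_imp_sums[OF s] by (simp add: sums_iff)
  have \<delta>0: "0 \<le> \<delta>" unfolding \<delta>_def using r by (intro infsum_nonneg) auto
  have \<delta>_le: "\<delta> \<le> norm y * (1 / (1 - r))"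
    unfolding \<delta>_def by (rule order_trans[OF abs_ge_self])
      (use abs_summable_bounded(3)[of "\<lambda>j. r ^ j * cmod (coords y j)", OF bnd] in simp)
  have row: "cmod (mat_app L (coords y) i) \<le> C * \<delta> * r ^ i" for i
  proof -
    have "cmod (mat_app L (coords y) i) \<le> C * r ^ i * \<delta>"
    proof (rule norm_infsum_le)
      show "((\<lambda>j. L i j * coords y j) has_sum mat_app L (coords y) i) UNIV"
        unfolding mat_app_def by (intro has_sum_infsum row_summable[OF S coord_le_norm])
      show "((\<lambda>j. C * r ^ i * (r ^ j * cmod (coords y j))) has_sum C * r ^ i * \<delta>) UNIV"
        by (intro has_sum_cmult_right s)
      show "norm (L i j * coords y j) \<le> C * r ^ i * (r ^ j * cmod (coords y j))" for j
        using mult_right_mono[OF L[of i j], of "cmod (coords y j)"]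
        by (simp add: norm_mult power_add mult.assoc)
    qed
    then show ?thesis by (simp add: mult.commute mult.left_commute)
  qed
  have "norm (mat_op L y) \<le> C * \<delta> * (1 / (1 - r))"
  proof (rule norm_le_sum_coords)
    fix F :: "nat set" assume F: "finite F"
    have "(\<Sum>i\<in>F. cmod (coords (mat_op L y) i)) \<le> (\<Sum>i\<in>F. C * \<delta> * r ^ i)"
      unfolding coords_mat_op[OF S] by (intro sum_mono row)
    also have "\<dots> \<le> C * \<delta> * (1 / (1 - r))"
      unfolding sum_distrib_left[symmetric] using C \<delta>0 r F
      by (intro mult_left_mono sum_geometric_le) auto
    finally show "(\<Sum>i\<in>F. cmod (coords (mat_op L y) i)) \<le> C * \<delta> * (1 / (1 - r))" .
  qed
  then show "norm (mat_op L y) \<le> C / (1 - r) * (\<Sum>j. r ^ j * cmod (coords y j))"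
    by (simp add: \<delta>)
  have "C * \<delta> * r ^ i \<le> C * (norm y * (1 / (1 - r))) * r ^ i"
    using C r \<delta>_le by (intro mult_right_mono mult_left_mono) auto
  then show "cmod (mat_app L (coords y) i) \<le> C / (1 - r) * norm y * r ^ i"
    using row[of i] by simp
qed

text \<open>
  If \<open>a\<close> is not bounded below, there are unit vectors \<open>v k\<close> with \<open>a (v k) \<rightarrow> 0\<close>, and a subsequence
  converges in each coordinate to some \<open>x\<close>. Compactness of \<open>L\<close> gives \<open>L (v k) \<rightarrow> L x\<close> in norm, and
  because of \<open>v k = L (v k) + b (a (v k))\<close> the vectors \<open>v k\<close> themselves converge in norm to \<open>L x\<close>. Hence \<open>L x\<close> is
  a unit vector annihilated by \<open>a\<close>, and it decays because it lies in the range of \<open>L\<close>.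
\<close>

lemma bounded_below_or_decaying_kernel:
  assumes a: "schur_bound Ca a" and b: "schur_bound Cb b" and L: "exp_decaying_mat L"
    and ba: "mat_prod b a = (\<lambda>i j. (if i = j then 1 else 0) - L i j)"
  shows "(\<exists>c>0. \<forall>x. c * norm x \<le> norm (mat_op a x)) \<or>
         (\<exists>z. (\<exists>i. z i \<noteq> 0) \<and> exp_decaying z \<and> mat_app a z = (\<lambda>_. 0))"
proof (cases "\<exists>c>0. \<forall>x. c * norm x \<le> norm (mat_op a x)")
  case False
  from L obtain C r where r: "0 < r" "r < 1" and Lb: "\<And>i j. cmod (L i j) \<le> C * r ^ (i + j)"
    unfolding exp_decaying_mat_def by blast
  obtain CL where S: "schur_bound CL L" using exp_decaying_mat_schur[OF L] .
  interpret A: bounded_linear "mat_op a" by (rule bounded_linear_mat_op[OF a])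
  interpret B: bounded_linear "mat_op b" by (rule bounded_linear_mat_op[OF b])
  interpret L: bounded_linear "mat_op L" by (rule bounded_linear_mat_op[OF S])
  have split: "x = mat_op L x + mat_op b (mat_op a x)" for x
  proof (rule coords_eqI)
    fix i
    have "mat_app b (mat_app a (coords x)) i = coords x i - mat_app L (coords x) i"
      unfolding mat_app_assoc[OF a b coord_le_norm] ba by (rule mat_app_one_minus[OF S coord_le_norm])
    then show "coords x i = coords (mat_op L x + mat_op b (mat_op a x)) i"
      by (simp add: plus_sqsum.rep_eq coords_mat_op[OF S] coords_mat_op[OF a] coords_mat_op[OF b])
  qed
  have "\<exists>x. norm x = 1 \<and> norm (mat_op a x) < inverse (real (Suc k))" for k
  proof -
    have "inverse (real (Suc k)) > 0" by simp
    then obtain x where x: "norm (mat_op a x) < inverse (real (Suc k)) * norm x"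
      using False not_le by blast
    then have "x \<noteq> 0" by (auto simp: A.zero)
    then have "norm (mat_op a (inverse (norm x) *\<^sub>R x)) < inverse (real (Suc k))"
      using x by (simp add: A.scaleR divide_simps mult.commute)
    with \<open>x \<noteq> 0\<close> show ?thesis by (intro exI[of _ "inverse (norm x) *\<^sub>R x"]) simp
  qed
  then obtain u where u: "\<And>k. norm (u k) = 1" "\<And>k. norm (mat_op a (u k)) < inverse (real (Suc k))"
    by metis
  have "cmod (coords (u k) i) \<le> 1" for k i using coord_le_norm[of "u k" i] u(1) by simp
  then obtain \<xi> s where s: "strict_mono s" and lim: "\<And>i. (\<lambda>k. coords (u (s k)) i) \<longlonglongrightarrow> \<xi> i"
    using bounded_seq_pointwise_subseq[of "\<lambda>k. coords (u k)" 1] by blast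
  define v where "v k = u (s k)" for k
  have v: "norm (v k) = 1" for k by (simp add: v_def u)
  have Av: "(\<lambda>k. mat_op a (v k)) \<longlonglongrightarrow> 0"
  proof (rule Lim_null_comparison)
    show "\<forall>\<^sub>F k in sequentially. norm (mat_op a (v k)) \<le> inverse (real (Suc k))"
    proof (intro always_eventually allI)
      fix k
      have "k \<le> s k" by (rule seq_suble[OF s])
      then have "inverse (real (Suc (s k))) \<le> inverse (real (Suc k))" by (simp add: divide_simps)
      then show "norm (mat_op a (v k)) \<le> inverse (real (Suc k))"
        using u(2)[of "s k"] unfolding v_def by linarith
    qed
    show "(\<lambda>k. inverse (real (Suc k))) \<longlonglongrightarrow> 0" by (rule LIMSEQ_inverse_real_of_nat)
  qed
  have "(\<Sum>i\<in>F. (cmod (\<xi> i))\<^sup>2) \<le> 1" if F: "finite F" for F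
  proof (rule tendsto_upperbound)
    show "(\<lambda>k. \<Sum>i\<in>F. (cmod (coords (v k) i))\<^sup>2) \<longlonglongrightarrow> (\<Sum>i\<in>F. (cmod (\<xi> i))\<^sup>2)"
      unfolding v_def by (intro tendsto_intros lim)
    show "\<forall>\<^sub>F k in sequentially. (\<Sum>i\<in>F. (cmod (coords (v k) i))\<^sup>2) \<le> 1"
      using sum_le_norm_sqsum[OF F, of "v _"] v by simp
  qed simp
  then obtain x where x: "coords x = \<xi>" using Abs_sqsum_bounded by blast
  have "(\<lambda>k. mat_op L (v k - x)) \<longlonglongrightarrow> 0"
  proof (rule Lim_null_comparison)
    let ?\<delta> = "\<lambda>k. \<Sum>j. r ^ j * cmod (coords (v k - x) j)"
    show "\<forall>\<^sub>F k in sequentially. norm (mat_op L (v k - x)) \<le> C / (1 - r) * ?\<delta> k"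
      using norm_decaying_op_le(1)[OF r Lb S] by simp
    have "?\<delta> \<longlonglongrightarrow> (\<Sum>j. (0 :: real))"
    proof (rule tannerys_theorem[THEN conjunct2, THEN conjunct2])
      show "(\<lambda>k. r ^ j * cmod (coords (v k - x) j)) \<longlonglongrightarrow> 0" for j
      proof -
        have "(\<lambda>k. r ^ j * cmod (coords (v k) j - \<xi> j)) \<longlonglongrightarrow> r ^ j * cmod (\<xi> j - \<xi> j)"
          unfolding v_def by (intro tendsto_intros lim)
        then show ?thesis by (simp add: minus_sqsum.rep_eq x)
      qed
      show "\<forall>\<^sub>F (j, k) in at_top \<times>\<^sub>F sequentially.
              norm (r ^ j * cmod (coords (v k - x) j)) \<le> r ^ j * (1 + norm x)"
      proof (intro always_eventually allI, clarify)
        fix j k :: nat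
        have "cmod (coords (v k - x) j) \<le> 1 + norm x"
          using coord_le_norm[of "v k - x" j] norm_triangle_ineq4[of "v k" x] v[of k] by linarith
        then show "norm (r ^ j * cmod (coords (v k - x) j)) \<le> r ^ j * (1 + norm x)"
          using r by (simp add: mult_left_mono)
      qed
      show "summable (\<lambda>j. r ^ j * (1 + norm x))"
        using r by (intro summable_mult2 summable_geometric) simp
    qed simp
    then have "?\<delta> \<longlonglongrightarrow> 0" by simp
    then show "(\<lambda>k. C / (1 - r) * ?\<delta> k) \<longlonglongrightarrow> 0" by (rule tendsto_mult_right_zero)
  qed
  then have Lv: "(\<lambda>k. mat_op L (v k)) \<longlonglongrightarrow> mat_op L x"
    unfolding L.diff by (simp add: LIM_zero_iff)
  have "(\<lambda>k. mat_op L (v k) + mat_op b (mat_op a (v k))) \<longlonglongrightarrow> mat_op L x + 0"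
    by (intro tendsto_add Lv) (use B.tendsto[OF Av] in \<open>simp add: B.zero\<close>)
  then have vlim: "v \<longlonglongrightarrow> mat_op L x" unfolding split[symmetric] by simp
  have n1: "norm (mat_op L x) = 1"
    using LIMSEQ_unique[OF tendsto_norm[OF vlim]] v by simp
  have "mat_op a (mat_op L x) = 0" by (rule LIMSEQ_unique[OF A.tendsto[OF vlim] Av])
  then have "mat_app a (coords (mat_op L x)) = (\<lambda>_. 0)"
    by (metis coords_mat_op[OF a] zero_sqsum.rep_eq)
  moreover have "exp_decaying (coords (mat_op L x))"
    unfolding exp_decaying_def coords_mat_op[OF S]
    using norm_decaying_op_le(2)[OF r Lb S, of x] r by blast
  moreover have "\<exists>i. coords (mat_op L x) i \<noteq> 0"
  proof (rule ccontr)
    assume "\<not> (\<exists>i. coords (mat_op L x) i \<noteq> 0)"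
    then have "mat_op L x = 0" by (intro coords_eqI) (simp add: zero_sqsum.rep_eq)
    with n1 show False by simp
  qed
  ultimately show ?thesis by blast
qed blast

lemma mat_prod_adj: "mat_prod (adj b) (adj a) = adj (mat_prod a b)"
  by (intro ext) (simp add: mat_prod_def adj_def mult.commute flip: infsum_cnj)

text \<open>
  Taking adjoints turns the right parametrix of \<open>a\<close> into a left parametrix of its adjoint, so the
  previous alternative applies to both. If both are bounded below, then \<open>a\<close> is onto by
  \<open>adjoint_pair_bounded_below_surj\<close>. Otherwise there is a decaying null vector of \<open>a\<close> or, after
  complex conjugation, of the transpose.
\<close>

lemma invertible_or_decaying_kernel:
  assumes a: "schur_bound Ca a" and b: "schur_bound Cb b"
    and L: "exp_decaying_mat L" and ba: "mat_prod b a = (\<lambda>i j. (if i = j then 1 else 0) - L i j)"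
    and K: "exp_decaying_mat K" and ab: "mat_prod a b = (\<lambda>i j. (if i = j then 1 else 0) - K i j)"
  obtains (invertible) c where "0 < c" "\<And>x. c * norm x \<le> norm (mat_op a x)" "surj (mat_op a)"
  | (kernel) z i where "z i \<noteq> 0" "exp_decaying z" "mat_app a z = (\<lambda>_. 0)"
  | (cokernel) z i where "z i \<noteq> 0" "exp_decaying z" "mat_app (\<lambda>i j. a j i) z = (\<lambda>_. 0)"
proof (cases "\<exists>z. (\<exists>i. z i \<noteq> 0) \<and> exp_decaying z \<and> mat_app a z = (\<lambda>_. 0)")
  case False
  then obtain c where c: "c > 0" "\<And>x. c * norm x \<le> norm (mat_op a x)"
    using bounded_below_or_decaying_kernel[OF a b L ba] by blast
  have K': "exp_decaying_mat (adj K)"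
    using K unfolding exp_decaying_mat_def adj_def complex_mod_cnj by (metis add.commute)
  have ba': "mat_prod (adj b) (adj a) = (\<lambda>i j. (if i = j then 1 else 0) - adj K i j)"
    unfolding mat_prod_adj ab adj_def by (intro ext) simp
  show ?thesis
  proof (cases "\<exists>z. (\<exists>i. z i \<noteq> 0) \<and> exp_decaying z \<and> mat_app (adj a) z = (\<lambda>_. 0)")
    case True
    then obtain z i where z: "z i \<noteq> 0" "exp_decaying z" "mat_app (adj a) z = (\<lambda>_. 0)" by blast
    have "mat_app (\<lambda>i j. a j i) (\<lambda>j. cnj (z j)) i = cnj (mat_app (adj a) z i)" for i
      unfolding mat_app_def adj_def by (simp flip: infsum_cnj)
    then show ?thesis
      using z by (intro cokernel[of "\<lambda>j. cnj (z j)" i]) (auto simp: exp_decaying_def)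
  next
    case False
    then obtain c' where c': "c' > 0" "\<And>x. c' * norm x \<le> norm (mat_op (adj a) x)"
      using bounded_below_or_decaying_kernel[OF schur_bound_adj[OF a] schur_bound_adj[OF b] K' ba'] by blast
    have "\<exists>z. mat_op a (mat_op (adj a) z) = y" for y
      by (rule adjoint_pair_bounded_below_surj[OF bounded_linear_mat_op[OF a]
            bounded_linear_mat_op[OF schur_bound_adj[OF a]] inner_mat_op[OF a] c'])
    then have "surj (mat_op a)" unfolding surj_def by metis
    with c show ?thesis by (rule invertible)
  qed
qed (blast intro: kernel)

section \<open>Exponentially convergent Laurent series on the circle\<close>

definition laurent_decay :: "(int \<Rightarrow> complex) \<Rightarrow> bool" where
  "laurent_decay c \<longleftrightarrow> (\<exists>C r. 0 < r \<and> r < 1 \<and> (\<forall>k. cmod (c k) \<le> C * r ^ nat \<bar>k\<bar>))"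

text \<open>
  Decay of the coefficients encodes that \<open>f\<close> extends analytically to an annulus around the circle.
\<close>

definition laurent_expansion :: "(complex \<Rightarrow> complex) \<Rightarrow> (int \<Rightarrow> complex) \<Rightarrow> bool" where
  "laurent_expansion f c \<longleftrightarrow> laurent_decay c \<and>
     (\<forall>t\<in>unit_circle. ((\<lambda>k. c k * t powi k) has_sum f t) UNIV)"

lemma laurent_decayI:
  "0 < r \<Longrightarrow> r < 1 \<Longrightarrow> (\<And>k. cmod (c k) \<le> C * r ^ nat \<bar>k\<bar>) \<Longrightarrow> laurent_decay c"
  unfolding laurent_decay_def by blast

lemma sum_geometric_int_le:
  fixes r :: real
  assumes r: "0 < r" "r < 1" and F: "finite F"
  shows "(\<Sum>k\<in>F. r ^ nat \<bar>k\<bar>) \<le> 2 / (1 - r)"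
proof -
  have half: "(\<Sum>k\<in>G. r ^ nat \<bar>k\<bar>) \<le> 1 / (1 - r)" if G: "finite G" "inj_on (\<lambda>k. nat \<bar>k\<bar>) G" for G
  proof -
    have "(\<Sum>k\<in>G. r ^ nat \<bar>k\<bar>) = (\<Sum>n\<in>(\<lambda>k. nat \<bar>k\<bar>) ` G. r ^ n)"
      by (simp add: sum.reindex[OF G(2)])
    also have "\<dots> \<le> 1 / (1 - r)" using r G by (intro sum_geometric_le) auto
    finally show ?thesis .
  qed
  have "(\<Sum>k\<in>F. r ^ nat \<bar>k\<bar>) = (\<Sum>k\<in>F \<inter> {0..}. r ^ nat \<bar>k\<bar>) + (\<Sum>k\<in>F - {0..}. r ^ nat \<bar>k\<bar>)"
    using F by (rule sum.Int_Diff)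
  also have "\<dots> \<le> 1 / (1 - r) + 1 / (1 - r)"
    using F by (intro add_mono half) (auto simp: inj_on_def)
  finally show ?thesis by simp
qed

lemma laurent_decay_common_rate:
  assumes "laurent_decay c" "laurent_decay d"
  obtains C r where "0 < r" "r < 1" "0 \<le> C"
    "\<And>k. cmod (c k) \<le> C * r ^ nat \<bar>k\<bar>" "\<And>k. cmod (d k) \<le> C * r ^ nat \<bar>k\<bar>"
proof -
  from assms obtain C1 r1 C2 r2 where
    1: "0 < r1" "r1 < 1" "\<And>k. cmod (c k) \<le> C1 * r1 ^ nat \<bar>k\<bar>" and
    2: "0 < r2" "r2 < 1" "\<And>k. cmod (d k) \<le> C2 * r2 ^ nat \<bar>k\<bar>"
    unfolding laurent_decay_def by metis
  have C: "0 \<le> C1" "0 \<le> C2"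
    using order_trans[OF norm_ge_zero 1(3)[of 0]] order_trans[OF norm_ge_zero 2(3)[of 0]] by auto
  have "C1 * r1 ^ nat \<bar>k\<bar> \<le> max C1 C2 * max r1 r2 ^ nat \<bar>k\<bar>" for k
    using C 1 by (intro mult_mono power_mono) auto
  moreover have "C2 * r2 ^ nat \<bar>k\<bar> \<le> max C1 C2 * max r1 r2 ^ nat \<bar>k\<bar>" for k
    using C 2 by (intro mult_mono power_mono) auto
  ultimately show ?thesis
    using 1 2 C by (intro that[of "max r1 r2" "max C1 C2"] order_trans[OF 1(3)] order_trans[OF 2(3)]) auto
qed

lemma laurent_decay_add:
  assumes "laurent_decay c" "laurent_decay d"
  shows "laurent_decay (\<lambda>k. c k + d k)"
proof -
  obtain C r where r: "0 < r" "r < 1" "0 \<le> C"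
    and c: "\<And>k. cmod (c k) \<le> C * r ^ nat \<bar>k\<bar>" and d: "\<And>k. cmod (d k) \<le> C * r ^ nat \<bar>k\<bar>"
    by (rule laurent_decay_common_rate[OF assms]) auto
  have "cmod (c k + d k) \<le> (2 * C) * r ^ nat \<bar>k\<bar>" for k
    using norm_triangle_mono[OF c[of k] d[of k]] by simp
  then show ?thesis by (rule laurent_decayI[OF r(1,2)])
qed

lemma laurent_decay_sum:
  assumes "finite S" "\<And>s. s \<in> S \<Longrightarrow> laurent_decay (c s)"
  shows "laurent_decay (\<lambda>k. \<Sum>s\<in>S. c s k)"
  using assms
proof (induction S rule: finite_induct)
  case empty
  show ?case by (rule laurent_decayI[of "1/2" _ 0]) auto
next
  case (insert s S)
  then show ?case using laurent_decay_add[of "c s"] by simp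
qed

lemma laurent_decay_reflect:
  assumes "laurent_decay c"
  shows "laurent_decay (\<lambda>k. c (- k))"
proof -
  from assms obtain C r where r: "0 < r" "r < 1" and c: "\<And>k. cmod (c k) \<le> C * r ^ nat \<bar>k\<bar>"
    unfolding laurent_decay_def by blast
  have "cmod (c (- k)) \<le> C * r ^ nat \<bar>k\<bar>" for k using c[of "- k"] by simp
  then show ?thesis by (rule laurent_decayI[OF r])
qed

lemma laurent_decay_summable:
  assumes "laurent_decay c" and t: "cmod t = 1"
  shows "(\<lambda>k. norm (c k * t powi k)) summable_on UNIV" "(\<lambda>k. c k * t powi k) summable_on UNIV"
proof -
  from assms(1) obtain C r where r: "0 < r" "r < 1" and c: "\<And>k. cmod (c k) \<le> C * r ^ nat \<bar>k\<bar>"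
    unfolding laurent_decay_def by blast
  have C: "0 \<le> C" using order_trans[OF norm_ge_zero c[of 0]] by simp
  have *: "(\<Sum>k\<in>F. norm (c k * t powi k)) \<le> C * (2 / (1 - r))" if "finite F" for F
  proof -
    have "(\<Sum>k\<in>F. norm (c k * t powi k)) \<le> (\<Sum>k\<in>F. C * r ^ nat \<bar>k\<bar>)"
      using t c by (intro sum_mono) (simp add: norm_mult norm_power_int)
    also have "\<dots> \<le> C * (2 / (1 - r))"
      unfolding sum_distrib_left[symmetric] using C r that by (intro mult_left_mono sum_geometric_int_le)
    finally show ?thesis .
  qed
  show "(\<lambda>k. norm (c k * t powi k)) summable_on UNIV" "(\<lambda>k. c k * t powi k) summable_on UNIV"
    using abs_summable_bounded(1,2)[of "\<lambda>k. c k * t powi k", OF *] by auto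
qed

lemma laurent_expansion_cong:
  "laurent_expansion f c \<Longrightarrow> (\<And>t. cmod t = 1 \<Longrightarrow> f t = g t) \<Longrightarrow> laurent_expansion g c"
  unfolding laurent_expansion_def by simp

lemma laurent_expansion_const: "laurent_expansion (\<lambda>_. a) (\<lambda>k. if k = 0 then a else 0)"
  unfolding laurent_expansion_def
proof (intro conjI ballI)
  show "laurent_decay (\<lambda>k. if k = 0 then a else 0)"
    unfolding laurent_decay_def by (intro exI[of _ "cmod a"] exI[of _ "1/2"]) auto
  fix t :: complex
  show "((\<lambda>k. (if k = 0 then a else 0) * t powi k) has_sum a) UNIV"
    by (rule has_sum_finite_neutralI[of "{0}"]) auto
qed

lemma laurent_expansion_ident: "laurent_expansion (\<lambda>t. t) (\<lambda>k. if k = 1 then 1 else 0)"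
  unfolding laurent_expansion_def
proof (intro conjI ballI)
  show "laurent_decay (\<lambda>k. if k = 1 then 1 else 0)"
    unfolding laurent_decay_def by (intro exI[of _ 2] exI[of _ "1/2"]) auto
  fix t :: complex
  show "((\<lambda>k. (if k = 1 then 1 else 0) * t powi k) has_sum t) UNIV"
    by (rule has_sum_finite_neutralI[of "{1}"]) auto
qed

lemma laurent_decay_geometric:
  assumes "cmod a < 1"
  shows "laurent_decay (\<lambda>k. if 0 \<le> k then a ^ nat k else 0)"
proof -
  obtain r where r: "cmod a < r" "r < 1" using assms dense by blast
  have "cmod a ^ n \<le> r ^ n" for n using r by (intro power_mono) auto
  moreover have "0 < r" using r(1) norm_ge_zero[of a] by linarith
  ultimately show ?thesis
    unfolding laurent_decay_def using r
    by (intro exI[of _ 1] exI[of _ r]) (auto simp: norm_power)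
qed

lemma laurent_expansion_geometric:
  assumes a: "cmod a < 1"
  shows "laurent_expansion (\<lambda>t. 1 / (1 - a * t)) (\<lambda>k. if 0 \<le> k then a ^ nat k else 0)"
  unfolding laurent_expansion_def
proof (intro conjI ballI laurent_decay_geometric[OF a])
  fix t :: complex assume "t \<in> unit_circle"
  then have n: "norm (a * t) < 1" using a by (simp add: norm_mult)
  have "((\<lambda>n. (a * t) ^ n) has_sum 1 / (1 - a * t)) UNIV"
    using n by (intro norm_summable_imp_has_sum geometric_sums) (simp_all add: norm_power summable_geometric)
  moreover have "(\<lambda>n. (a * t) ^ n) = (\<lambda>k. (if 0 \<le> k then a ^ nat k else 0) * t powi k) \<circ> int"
    by (auto simp: power_mult_distrib)
  ultimately have "((\<lambda>k. (if 0 \<le> k then a ^ nat k else 0) * t powi k) has_sum 1 / (1 - a * t)) (range int)"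
    by (subst has_sum_reindex) (simp_all only: inj_on_of_nat)
  moreover have "k \<in> range int" if "0 \<le> k" for k using that by (metis nat_0_le rangeI)
  then have "((\<lambda>k. (if 0 \<le> k then a ^ nat k else 0) * t powi k) has_sum 1 / (1 - a * t)) (range int) \<longleftrightarrow>
      ((\<lambda>k. (if 0 \<le> k then a ^ nat k else 0) * t powi k) has_sum 1 / (1 - a * t)) UNIV"
    by (intro has_sum_cong_neutral) auto
  ultimately show "((\<lambda>k. (if 0 \<le> k then a ^ nat k else 0) * t powi k) has_sum 1 / (1 - a * t)) UNIV"
    by (simp only:)
qed

lemma laurent_expansion_reflect:
  assumes "laurent_expansion f c"
  shows "laurent_expansion (\<lambda>t. f (1 / t)) (\<lambda>k. c (- k))"
  unfolding laurent_expansion_def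
proof (intro conjI ballI)
  show "laurent_decay (\<lambda>k. c (- k))"
    using assms unfolding laurent_expansion_def by (intro laurent_decay_reflect) blast
  fix t :: complex assume "t \<in> unit_circle"
  then have "((\<lambda>k. c k * (1 / t) powi k) has_sum f (1 / t)) UNIV"
    using assms unfolding laurent_expansion_def by (simp add: norm_divide)
  moreover have "bij (uminus :: int \<Rightarrow> int)" by (rule bij_uminus)
  ultimately have "((\<lambda>k. c (- k) * (1 / t) powi (- k)) has_sum f (1 / t)) UNIV"
    using has_sum_reindex_bij_betw[of uminus UNIV UNIV "\<lambda>k. c k * (1 / t) powi k" "f (1 / t)"] by simp
  then show "((\<lambda>k. c (- k) * t powi k) has_sum f (1 / t)) UNIV"
    by (simp add: power_int_minus power_int_divide_distrib)
qed

lemma laurent_expansion_add: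
  assumes "laurent_expansion f c" "laurent_expansion g d"
  shows "laurent_expansion (\<lambda>t. f t + g t) (\<lambda>k. c k + d k)"
  unfolding laurent_expansion_def
proof (intro conjI ballI)
  show "laurent_decay (\<lambda>k. c k + d k)"
    using assms unfolding laurent_expansion_def by (intro laurent_decay_add) blast+
  fix t :: complex assume "t \<in> unit_circle"
  then show "((\<lambda>k. (c k + d k) * t powi k) has_sum f t + g t) UNIV"
    using assms unfolding laurent_expansion_def distrib_right by (intro has_sum_add) auto
qed

lemma laurent_expansion_sum:
  assumes "finite S" "\<And>s. s \<in> S \<Longrightarrow> laurent_expansion (f s) (c s)"
  shows "laurent_expansion (\<lambda>t. \<Sum>s\<in>S. f s t) (\<lambda>k. \<Sum>s\<in>S. c s k)"
  using assms
proof (induction S rule: finite_induct)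
  case empty
  show ?case using laurent_expansion_const[of 0] by simp
next
  case (insert s S)
  then show ?case using laurent_expansion_add[of "f s" "c s"] by simp
qed

text \<open>
  Since \<open>2 (\<bar>j\<bar> + \<bar>k - j\<bar>) \<ge> \<bar>j\<bar> + \<bar>k\<bar>\<close>, passing from \<open>r\<close> to its square root leaves decay in \<open>k\<close> as well
  as summability in \<open>j\<close>.
\<close>

lemma laurent_convolution_bound:
  assumes r: "0 < r" "r < 1" and C: "0 \<le> C"
    and c: "\<And>k. cmod (c k) \<le> C * r ^ nat \<bar>k\<bar>" and d: "\<And>k. cmod (d k) \<le> C * r ^ nat \<bar>k\<bar>"
  shows "cmod (c j * d (k - j)) \<le> C\<^sup>2 * (sqrt r ^ nat \<bar>j\<bar> * sqrt r ^ nat \<bar>k\<bar>)"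
proof -
  have "cmod (c j * d (k - j)) \<le> (C * r ^ nat \<bar>j\<bar>) * (C * r ^ nat \<bar>k - j\<bar>)"
    unfolding norm_mult using C r by (intro mult_mono c d) auto
  also have "\<dots> = C\<^sup>2 * (r ^ (nat \<bar>j\<bar> + nat \<bar>k - j\<bar>))" by (simp add: power2_eq_square power_add)
  also have "r ^ (nat \<bar>j\<bar> + nat \<bar>k - j\<bar>) = sqrt r ^ (2 * (nat \<bar>j\<bar> + nat \<bar>k - j\<bar>))"
    using r by (subst power_mult) simp
  also have "C\<^sup>2 * \<dots> \<le> C\<^sup>2 * sqrt r ^ (nat \<bar>j\<bar> + nat \<bar>k\<bar>)"
    using r by (intro mult_left_mono power_decreasing) auto
  finally show ?thesis by (simp add: power_add)
qed

lemma laurent_expansion_mult: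
  assumes f: "laurent_expansion f c" and g: "laurent_expansion g d"
  shows "laurent_expansion (\<lambda>t. f t * g t) (\<lambda>k. \<Sum>\<^sub>\<infinity>j. c j * d (k - j))"
proof -
  obtain C r where r: "0 < r" "r < 1" and C: "0 \<le> C"
    and c: "\<And>k. cmod (c k) \<le> C * r ^ nat \<bar>k\<bar>" and d: "\<And>k. cmod (d k) \<le> C * r ^ nat \<bar>k\<bar>"
    by (rule laurent_decay_common_rate[of c d]) (use f g in \<open>auto simp: laurent_expansion_def\<close>)
  define \<sigma> where "\<sigma> = sqrt r"
  have \<sigma>: "0 < \<sigma>" "\<sigma> < 1" using r by (auto simp: \<sigma>_def)
  have bound: "cmod (c j * d (k - j)) \<le> C\<^sup>2 * (\<sigma> ^ nat \<bar>j\<bar> * \<sigma> ^ nat \<bar>k\<bar>)" for j k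
    unfolding \<sigma>_def by (rule laurent_convolution_bound[OF r C c d])
  have sum_bound: "(\<Sum>j\<in>F. cmod (c j * d (k - j))) \<le> C\<^sup>2 * (2 / (1 - \<sigma>)) * \<sigma> ^ nat \<bar>k\<bar>" if "finite F" for F k
  proof -
    have "(\<Sum>j\<in>F. cmod (c j * d (k - j))) \<le> (\<Sum>j\<in>F. C\<^sup>2 * (\<sigma> ^ nat \<bar>j\<bar> * \<sigma> ^ nat \<bar>k\<bar>))"
      by (intro sum_mono bound)
    also have "\<dots> = C\<^sup>2 * (\<Sum>j\<in>F. \<sigma> ^ nat \<bar>j\<bar>) * \<sigma> ^ nat \<bar>k\<bar>"
      by (simp add: sum_distrib_left sum_distrib_right mult.assoc)
    also have "\<dots> \<le> C\<^sup>2 * (2 / (1 - \<sigma>)) * \<sigma> ^ nat \<bar>k\<bar>"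
      using \<sigma> that by (intro mult_right_mono mult_left_mono sum_geometric_int_le) auto
    finally show ?thesis .
  qed
  have decay: "laurent_decay (\<lambda>k. \<Sum>\<^sub>\<infinity>j. c j * d (k - j))"
    by (rule laurent_decayI[OF \<sigma>]) (rule abs_summable_bounded(3), rule sum_bound)
  show ?thesis
    unfolding laurent_expansion_def
  proof (intro conjI ballI decay)
    fix t :: complex assume "t \<in> unit_circle"
    then have t: "cmod t = 1" and [simp]: "t \<noteq> 0" by auto
    have ft: "((\<lambda>k. c k * t powi k) has_sum f t) UNIV" and gt: "((\<lambda>k. d k * t powi k) has_sum g t) UNIV"
      using f g t unfolding laurent_expansion_def by auto
    have shift: "((\<lambda>k. d (k - j) * t powi (k - j)) has_sum g t) UNIV" for j
    proof -
      have "bij (\<lambda>k. k - j)" by (rule bij_diff_right)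
      then show ?thesis
        using gt has_sum_reindex_bij_betw[of "\<lambda>k. k - j" UNIV UNIV "\<lambda>k. d k * t powi k" "g t"] by simp
    qed
    have "f t * g t = (\<Sum>\<^sub>\<infinity>j. c j * t powi j * g t)"
      using infsumI[OF has_sum_cmult_left[OF ft, of "g t"]] by simp
    also have "\<dots> = (\<Sum>\<^sub>\<infinity>j. \<Sum>\<^sub>\<infinity>k. c j * d (k - j) * t powi k)"
    proof (rule infsum_cong)
      fix j
      have "c j * t powi j * (d (k - j) * t powi (k - j)) = c j * d (k - j) * t powi k" for k
        using power_int_add[of t j "k - j"] by simp
      then show "c j * t powi j * g t = (\<Sum>\<^sub>\<infinity>k. c j * d (k - j) * t powi k)"
        using infsumI[OF has_sum_cmult_right[OF shift, of "c j * t powi j" j]] by (simp only:)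
    qed
    also have "\<dots> = (\<Sum>\<^sub>\<infinity>k. \<Sum>\<^sub>\<infinity>j. c j * d (k - j) * t powi k)"
    proof (rule infsum_swap_bounded)
      fix F G :: "int set" assume F: "finite F" and G: "finite G"
      have "(\<Sum>j\<in>F. \<Sum>k\<in>G. norm (c j * d (k - j) * t powi k)) = (\<Sum>k\<in>G. \<Sum>j\<in>F. cmod (c j * d (k - j)))"
        using t by (subst sum.swap) (simp add: norm_mult norm_power_int)
      also have "\<dots> \<le> (\<Sum>k\<in>G. C\<^sup>2 * (2 / (1 - \<sigma>)) * \<sigma> ^ nat \<bar>k\<bar>)"
        using F by (intro sum_mono sum_bound)
      also have "\<dots> \<le> C\<^sup>2 * (2 / (1 - \<sigma>)) * (2 / (1 - \<sigma>))"
        unfolding sum_distrib_left[symmetric] using \<sigma> G by (intro mult_left_mono sum_geometric_int_le) auto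
      finally show "(\<Sum>j\<in>F. \<Sum>k\<in>G. norm (c j * d (k - j) * t powi k)) \<le> C\<^sup>2 * (2 / (1 - \<sigma>)) * (2 / (1 - \<sigma>))" .
    qed
    also have "\<dots> = (\<Sum>\<^sub>\<infinity>k. (\<Sum>\<^sub>\<infinity>j. c j * d (k - j)) * t powi k)"
      by (simp add: infsum_cmult_left')
    finally show "((\<lambda>k. (\<Sum>\<^sub>\<infinity>j. c j * d (k - j)) * t powi k) has_sum f t * g t) UNIV"
      using laurent_decay_summable(2)[OF decay t] by simp
  qed
qed

text \<open>
  The geometric series in \<open>a / t\<close> or in \<open>t / a\<close>, according to the side of the circle on which \<open>a\<close> lies.
\<close>

lemma laurent_expansion_inverse_linear:
  assumes "cmod a \<noteq> 1"
  shows "\<exists>c. laurent_expansion (\<lambda>t. 1 / (t - a)) c"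
proof (cases "cmod a < 1")
  case True
  obtain c where "laurent_expansion (\<lambda>t. (1 / t) * (1 / (1 - a * (1 / t)))) c"
    using laurent_expansion_mult[OF laurent_expansion_reflect[OF laurent_expansion_ident]
        laurent_expansion_reflect[OF laurent_expansion_geometric[OF True]]] by blast
  then have "laurent_expansion (\<lambda>t. 1 / (t - a)) c"
  proof (rule laurent_expansion_cong)
    fix t :: complex assume "cmod t = 1"
    then have "t \<noteq> 0" by auto
    then show "(1 / t) * (1 / (1 - a * (1 / t))) = 1 / (t - a)" by (simp add: divide_simps)
  qed
  then show ?thesis by blast
next
  case False
  then have "1 < cmod a" using assms by simp
  then have [simp]: "a \<noteq> 0" by auto
  have a: "cmod (1 / a) < 1" using \<open>1 < cmod a\<close> by (simp add: norm_divide divide_less_eq)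
  obtain c where "laurent_expansion (\<lambda>t. - (1 / a) * (1 / (1 - 1 / a * t))) c"
    using laurent_expansion_mult[OF laurent_expansion_const laurent_expansion_geometric[OF a]] by blast
  then have "laurent_expansion (\<lambda>t. 1 / (t - a)) c"
  proof (rule laurent_expansion_cong)
    fix t :: complex assume "cmod t = 1"
    then have "t \<noteq> a" using assms by auto
    then have "a - t \<noteq> 0" "t - a \<noteq> 0" by auto
    have "- (1 / a) * (1 / (1 - 1 / a * t)) = - 1 / (a - t)"
      using \<open>a - t \<noteq> 0\<close> by (simp add: divide_simps)
    also have "\<dots> = 1 / (t - a)" by (metis minus_diff_eq minus_divide_divide minus_minus)
    finally show "- (1 / a) * (1 / (1 - 1 / a * t)) = 1 / (t - a)" .
  qed
  then show ?thesis by blast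
qed

lemma laurent_expansion_poly: "\<exists>c. laurent_expansion (poly p) c"
proof (induction p)
  case 0
  show ?case using laurent_expansion_const[of 0] by (auto simp: poly_0[abs_def])
next
  case (pCons a p)
  then obtain c where "laurent_expansion (poly p) c" by blast
  from laurent_expansion_add[OF laurent_expansion_const laurent_expansion_mult[OF laurent_expansion_ident this]]
  show ?case by (auto simp: poly_pCons[abs_def])
qed

text \<open>
  The denominator is split into linear factors, one root at a time.
\<close>

lemma laurent_expansion_inverse_poly:
  assumes "\<And>t. cmod t = 1 \<Longrightarrow> poly q t \<noteq> 0"
  shows "\<exists>c. laurent_expansion (\<lambda>t. 1 / poly q t) c"
  using assms
proof (induction "degree q" arbitrary: q rule: less_induct)
  case less
  show ?case
  proof (cases "constant (poly q)")
    case True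
    then have "(\<lambda>t. 1 / poly q t) = (\<lambda>_. 1 / poly q 0)" unfolding constant_def by (intro ext) metis
    then show ?thesis using laurent_expansion_const[of "1 / poly q 0"] by auto
  next
    case False
    then obtain a where a: "poly q a = 0" using fundamental_theorem_of_algebra by blast
    then have an: "cmod a \<noteq> 1" using less.prems by blast
    obtain p where q: "q = [:- a, 1:] * p" using a by (auto simp: poly_eq_0_iff_dvd)
    have "p \<noteq> 0" using less.prems[of 1] q by auto
    then have "degree p < degree q" using q by (simp add: degree_mult_eq del: mult_pCons_left)
    moreover have "\<And>t. cmod t = 1 \<Longrightarrow> poly p t \<noteq> 0" using less.prems q by auto
    ultimately obtain c where c: "laurent_expansion (\<lambda>t. 1 / poly p t) c" using less.hyps by blast
    obtain d where d: "laurent_expansion (\<lambda>t. 1 / (t - a)) d" using laurent_expansion_inverse_linear[OF an] by blast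
    have "(\<lambda>t. 1 / poly q t) = (\<lambda>t. 1 / (t - a) * (1 / poly p t))"
      unfolding q by (intro ext) (simp add: algebra_simps)
    then show ?thesis
      using laurent_expansion_mult[OF d c] by auto
  qed
qed

lemma laurent_expansion_rational:
  assumes "\<And>t. cmod t = 1 \<Longrightarrow> poly q t \<noteq> 0 \<and> f t = poly p t / poly q t"
  shows "\<exists>c. laurent_expansion f c"
proof -
  obtain c d where "laurent_expansion (poly p) c" "laurent_expansion (\<lambda>t. 1 / poly q t) d"
    using laurent_expansion_poly laurent_expansion_inverse_poly assms by metis
  from laurent_expansion_cong[OF laurent_expansion_mult[OF this], of f] assms show ?thesis by auto
qed

section \<open>Fourier coefficients\<close>

lemma exp_powi: "exp (\<i> * complex_of_real \<theta>) powi k = exp (\<i> * of_int k * complex_of_real \<theta>)"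
  using exp_power_int[of "\<i> * complex_of_real \<theta>" k] by (simp add: mult_ac)

lemma integral_exp_int:
  "((\<lambda>\<theta>. exp (\<i> * of_int k * complex_of_real \<theta>)) has_integral (if k = 0 then 2 * complex_of_real pi else 0)) {0..2 * pi}"
proof (cases "k = 0")
  case True
  have "((\<lambda>_. 1 :: complex) has_integral (2 * pi - 0) *\<^sub>R 1) {0..2 * pi}"
    using has_integral_const_real[of "1 :: complex" 0 "2 * pi"] by simp
  with True show ?thesis by (simp add: scaleR_conv_of_real)
next
  case False
  let ?F = "\<lambda>\<theta>. exp (\<i> * of_int k * complex_of_real \<theta>) / (\<i> * of_int k)"
  have "((\<lambda>\<theta>. exp (\<i> * of_int k * complex_of_real \<theta>)) has_integral (?F (2 * pi) - ?F 0)) {0..2 * pi}"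
  proof (rule fundamental_theorem_of_calculus)
    fix \<theta> assume "\<theta> \<in> {0..2 * pi}"
    show "(?F has_vector_derivative exp (\<i> * of_int k * complex_of_real \<theta>)) (at \<theta> within {0..2 * pi})"
      using False by (auto intro!: derivative_eq_intros has_vector_derivative_real_field simp: field_simps)
  qed simp
  moreover have "exp (\<i> * of_int k * complex_of_real (2 * pi)) = 1"
    using exp_integer_2pi[of "of_int k"] by (simp add: mult_ac)
  ultimately show ?thesis using False by simp
qed

text \<open>
  The series converges uniformly on the circle and may be integrated term by term; orthogonality of
  the exponentials leaves the term with index \<open>m\<close>.
\<close>

lemma fourier_coefficient_laurent:
  assumes f: "laurent_expansion f c"
  shows "1 / (2 * complex_of_real pi) *
     integral {0..2 * pi} (\<lambda>\<theta>. f (exp (\<i> * complex_of_real \<theta>)) * exp (- \<i> * of_int m * complex_of_real \<theta>)) = c m"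
proof -
  let ?g = "\<lambda>\<theta>. f (exp (\<i> * complex_of_real \<theta>)) * exp (- \<i> * of_int m * complex_of_real \<theta>)"
  let ?h = "\<lambda>k \<theta>. c k * exp (\<i> * of_int (k - m) * complex_of_real \<theta>)"
  have eq: "c k * exp (\<i> * complex_of_real \<theta>) powi k * exp (- \<i> * of_int m * complex_of_real \<theta>) = ?h k \<theta>" for k \<theta>
    unfolding exp_powi mult.assoc by (simp add: exp_add[symmetric] algebra_simps)
  have dec: "laurent_decay c" using f unfolding laurent_expansion_def by blast
  have sums: "((\<lambda>k. ?h k \<theta>) has_sum ?g \<theta>) UNIV" for \<theta>
    unfolding eq[symmetric] using f unfolding laurent_expansion_def
    by (intro has_sum_cmult_left) auto
  have "uniform_limit {0..2 * pi} (\<lambda>X \<theta>. \<Sum>k\<in>X. ?h k \<theta>) ?g (finite_subsets_at_top UNIV)"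
  proof (rule Weierstrass_m_test_general'[where M = "\<lambda>k. cmod (c k)"])
    show "norm (?h k \<theta>) \<le> cmod (c k)" for k \<theta>
      using norm_exp_i_times[of "of_int (k - m) * \<theta>"] by (simp add: norm_mult mult.assoc)
    show "(\<lambda>k. cmod (c k)) summable_on UNIV"
      using laurent_decay_summable(1)[OF dec, of 1] by simp
  qed (rule sums)
  then obtain I J where I: "\<And>X. ((\<lambda>\<theta>. \<Sum>k\<in>X. ?h k \<theta>) has_integral I X) {0..2 * pi}"
    and J: "(?g has_integral J) {0..2 * pi}" and IJ: "(I \<longlongrightarrow> J) (finite_subsets_at_top UNIV)"
    by (rule uniform_limit_integral) (auto intro!: continuous_intros)
  have "\<forall>\<^sub>F X in finite_subsets_at_top UNIV. I X = c m * (2 * complex_of_real pi)"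
    unfolding eventually_finite_subsets_at_top
  proof (intro exI[of _ "{m}"] conjI allI impI)
    fix X :: "int set" assume X: "finite X \<and> {m} \<subseteq> X \<and> X \<subseteq> UNIV"
    have "((\<lambda>\<theta>. \<Sum>k\<in>X. ?h k \<theta>) has_integral (\<Sum>k\<in>X. c k * (if k - m = 0 then 2 * complex_of_real pi else 0))) {0..2 * pi}"
      using X by (intro has_integral_sum has_integral_mult_right integral_exp_int) auto
    then have "I X = (\<Sum>k\<in>X. c k * (if k - m = 0 then 2 * complex_of_real pi else 0))"
      using I has_integral_unique by blast
    also have "\<dots> = (\<Sum>k\<in>X. if k = m then c m * (2 * complex_of_real pi) else 0)"
      by (intro sum.cong) auto
    finally show "I X = c m * (2 * complex_of_real pi)" using X by simp
  qed auto
  from tendsto_cong[OF this, of J] IJ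
  have "((\<lambda>_. c m * (2 * complex_of_real pi)) \<longlongrightarrow> J) (finite_subsets_at_top (UNIV :: int set))"
    by (simp only:)
  then have "J = c m * (2 * complex_of_real pi)"
    by (intro tendsto_unique[OF _ _ tendsto_const]) auto
  then show ?thesis using integral_unique[OF J] by simp
qed

lemma laurent_expansion_unique:
  assumes "laurent_expansion f c" "laurent_expansion f d"
  shows "c = d"
  using fourier_coefficient_laurent[OF assms(1)] fourier_coefficient_laurent[OF assms(2)] by (intro ext) simp

section \<open>Rational matrix functions and their inverses\<close>

definition rational_on_circle :: "(complex \<Rightarrow> complex) \<Rightarrow> bool" where
  "rational_on_circle f \<longleftrightarrow> (\<exists>p q. \<forall>t\<in>unit_circle. poly q t \<noteq> 0 \<and> f t = poly p t / poly q t)"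

lemma rational_on_circle_cong:
  "rational_on_circle f \<Longrightarrow> (\<And>t. t \<in> unit_circle \<Longrightarrow> f t = g t) \<Longrightarrow> rational_on_circle g"
  unfolding rational_on_circle_def by simp

lemma rational_on_circle_const: "rational_on_circle (\<lambda>_. a)"
  unfolding rational_on_circle_def by (intro exI[of _ "[:a:]"] exI[of _ 1]) simp

lemma rational_on_circle_add:
  assumes "rational_on_circle f" "rational_on_circle g"
  shows "rational_on_circle (\<lambda>t. f t + g t)"
proof -
  from assms obtain p q p' q' where
    "\<forall>t\<in>unit_circle. poly q t \<noteq> 0 \<and> f t = poly p t / poly q t"
    "\<forall>t\<in>unit_circle. poly q' t \<noteq> 0 \<and> g t = poly p' t / poly q' t"
    unfolding rational_on_circle_def by blast
  then show ?thesis
    unfolding rational_on_circle_def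
    by (intro exI[of _ "p * q' + p' * q"] exI[of _ "q * q'"]) (simp add: add_frac_eq)
qed

lemma rational_on_circle_mult:
  assumes "rational_on_circle f" "rational_on_circle g"
  shows "rational_on_circle (\<lambda>t. f t * g t)"
proof -
  from assms obtain p q p' q' where
    "\<forall>t\<in>unit_circle. poly q t \<noteq> 0 \<and> f t = poly p t / poly q t"
    "\<forall>t\<in>unit_circle. poly q' t \<noteq> 0 \<and> g t = poly p' t / poly q' t"
    unfolding rational_on_circle_def by blast
  then show ?thesis
    unfolding rational_on_circle_def
    by (intro exI[of _ "p * p'"] exI[of _ "q * q'"]) simp
qed

lemma rational_on_circle_inverse:
  assumes "rational_on_circle f" "\<And>t. t \<in> unit_circle \<Longrightarrow> f t \<noteq> 0"
  shows "rational_on_circle (\<lambda>t. 1 / f t)"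
proof -
  from assms(1) obtain p q where
    "\<forall>t\<in>unit_circle. poly q t \<noteq> 0 \<and> f t = poly p t / poly q t"
    unfolding rational_on_circle_def by blast
  then show ?thesis
    unfolding rational_on_circle_def using assms(2)
    by (intro exI[of _ q] exI[of _ p]) auto
qed

lemma rational_on_circle_sum:
  "(\<And>s. s \<in> S \<Longrightarrow> rational_on_circle (f s)) \<Longrightarrow> rational_on_circle (\<lambda>t. \<Sum>s\<in>S. f s t)"
  by (induction S rule: infinite_finite_induct)
     (simp_all add: rational_on_circle_const rational_on_circle_add)

lemma rational_on_circle_prod:
  "(\<And>s. s \<in> S \<Longrightarrow> rational_on_circle (f s)) \<Longrightarrow> rational_on_circle (\<lambda>t. \<Prod>s\<in>S. f s t)"
  by (induction S rule: infinite_finite_induct)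
     (simp_all add: rational_on_circle_const rational_on_circle_mult)

lemma rational_on_circle_det:
  assumes M: "\<And>t. t \<in> unit_circle \<Longrightarrow> M t \<in> carrier_mat n n"
    and r: "\<And>i j. i < n \<Longrightarrow> j < n \<Longrightarrow> rational_on_circle (\<lambda>t. M t $$ (i, j))"
  shows "rational_on_circle (\<lambda>t. Determinant.det (M t))"
proof (rule rational_on_circle_cong)
  show "rational_on_circle (\<lambda>t. \<Sum>p\<in>{p. p permutes {0..<n}}. signof p * (\<Prod>i = 0..<n. M t $$ (i, p i)))"
    by (intro rational_on_circle_sum rational_on_circle_mult rational_on_circle_const rational_on_circle_prod r)
       (auto dest: permutes_in_image)
  show "(\<Sum>p\<in>{p. p permutes {0..<n}}. signof p * (\<Prod>i = 0..<n. M t $$ (i, p i))) = Determinant.det (M t)"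
    if "t \<in> unit_circle" for t
    using det_def'[OF M[OF that]] by simp
qed

text \<open>
  The inverse is the adjugate divided by the determinant, and both are polynomial in the entries.
\<close>

lemma rational_matrix_inverse:
  assumes A: "A \<in> GR N"
  obtains B where "\<And>t. t \<in> unit_circle \<Longrightarrow> B t \<in> carrier_mat N N"
    "\<And>t. t \<in> unit_circle \<Longrightarrow> A t * B t = 1\<^sub>m N" "\<And>t. t \<in> unit_circle \<Longrightarrow> B t * A t = 1\<^sub>m N"
    "\<And>r s. r < N \<Longrightarrow> s < N \<Longrightarrow> rational_on_circle (\<lambda>t. B t $$ (r, s))"
proof -
  from A have carr: "\<And>t. t \<in> unit_circle \<Longrightarrow> A t \<in> carrier_mat N N"
    and det: "\<And>t. t \<in> unit_circle \<Longrightarrow> Determinant.det (A t) \<noteq> 0"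
    and rat: "\<And>r s. r < N \<Longrightarrow> s < N \<Longrightarrow> rational_on_circle (\<lambda>t. A t $$ (r, s))"
    unfolding GR_def rational_matrix_fun_def rational_on_circle_def by auto
  define B where "B t = (1 / Determinant.det (A t)) \<cdot>\<^sub>m adj_mat (A t)" for t
  show ?thesis
  proof (rule that[of B])
    fix t :: complex assume t: "t \<in> unit_circle"
    note adj = adj_mat[OF carr[OF t]]
    show "B t \<in> carrier_mat N N" using adj(1) by (simp add: B_def)
    have one: "(1 / Determinant.det (A t)) \<cdot>\<^sub>m (Determinant.det (A t) \<cdot>\<^sub>m 1\<^sub>m N) = 1\<^sub>m N"
      using det[OF t] by (intro eq_matI) auto
    show "A t * B t = 1\<^sub>m N"
      unfolding B_def using mult_smult_distrib[OF carr[OF t] adj(1)] adj(2) one by simp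
    show "B t * A t = 1\<^sub>m N"
      unfolding B_def using mult_smult_assoc_mat[OF adj(1) carr[OF t]] adj(3) one by simp
  next
    fix r s assume rs: "r < N" "s < N"
    have "rational_on_circle (\<lambda>t. Determinant.det (mat_delete (A t) s r))"
    proof (rule rational_on_circle_det)
      show "mat_delete (A t) s r \<in> carrier_mat (N - 1) (N - 1)" if "t \<in> unit_circle" for t
        using mat_delete_carrier[OF carr[OF that]] .
      show "rational_on_circle (\<lambda>t. mat_delete (A t) s r $$ (i, j))" if "i < N - 1" "j < N - 1" for i j
      proof (rule rational_on_circle_cong)
        let ?i = "if i < s then i else Suc i" and ?j = "if j < r then j else Suc j"
        show "rational_on_circle (\<lambda>t. A t $$ (?i, ?j))" using that by (intro rat) auto
        show "A t $$ (?i, ?j) = mat_delete (A t) s r $$ (i, j)" if t: "t \<in> unit_circle" for t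
          using carr[OF t] \<open>i < N - 1\<close> \<open>j < N - 1\<close> unfolding mat_delete_def by auto
      qed
    qed
    then have "rational_on_circle (\<lambda>t. 1 / Determinant.det (A t) * ((-1) ^ (s + r) * Determinant.det (mat_delete (A t) s r)))"
      by (intro rational_on_circle_mult rational_on_circle_const rational_on_circle_inverse
          rational_on_circle_det[OF carr rat] det)
    then show "rational_on_circle (\<lambda>t. B t $$ (r, s))"
    proof (rule rational_on_circle_cong)
      fix t :: complex assume t: "t \<in> unit_circle"
      show "1 / Determinant.det (A t) * ((-1) ^ (s + r) * Determinant.det (mat_delete (A t) s r)) = B t $$ (r, s)"
        using carr[OF t] rs by (auto simp: B_def adj_mat_def cofactor_def)
    qed
  qed
qed

lemma laurent_expansion_rational_on_circle:
  "rational_on_circle f \<Longrightarrow> \<exists>c. laurent_expansion f c"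
  unfolding rational_on_circle_def using laurent_expansion_rational by (metis dist_0_norm mem_sphere)

text \<open>
  The identity \<open>A(t) B(t) = 1\<close> on the circle, expressed by the Fourier coefficients of the entries.
\<close>

definition convolution_inverse ::
  "nat \<Rightarrow> (nat \<Rightarrow> nat \<Rightarrow> int \<Rightarrow> complex) \<Rightarrow> (nat \<Rightarrow> nat \<Rightarrow> int \<Rightarrow> complex) \<Rightarrow> bool" where
  "convolution_inverse N \<alpha> \<beta> \<longleftrightarrow> (\<forall>r<N. \<forall>u<N. \<forall>k.
     (\<Sum>s<N. \<Sum>\<^sub>\<infinity>j. \<alpha> r s j * \<beta> s u (k - j)) = (if r = u \<and> k = 0 then 1 else 0))"

lemma convolution_inverseI:
  assumes A: "\<And>t. t \<in> unit_circle \<Longrightarrow> A t \<in> carrier_mat N N" and B: "\<And>t. t \<in> unit_circle \<Longrightarrow> B t \<in> carrier_mat N N"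
    and AB: "\<And>t. t \<in> unit_circle \<Longrightarrow> A t * B t = 1\<^sub>m N"
    and \<alpha>: "\<And>r s. r < N \<Longrightarrow> s < N \<Longrightarrow> laurent_expansion (\<lambda>t. A t $$ (r, s)) (\<alpha> r s)"
    and \<beta>: "\<And>r s. r < N \<Longrightarrow> s < N \<Longrightarrow> laurent_expansion (\<lambda>t. B t $$ (r, s)) (\<beta> r s)"
  shows "convolution_inverse N \<alpha> \<beta>"
  unfolding convolution_inverse_def
proof (intro allI impI)
  fix r u k assume ru: "r < N" "u < N"
  have "laurent_expansion (\<lambda>t. \<Sum>s<N. A t $$ (r, s) * B t $$ (s, u)) (\<lambda>k. \<Sum>s<N. \<Sum>\<^sub>\<infinity>j. \<alpha> r s j * \<beta> s u (k - j))"
    using ru by (intro laurent_expansion_sum laurent_expansion_mult \<alpha> \<beta>) auto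
  then have "laurent_expansion (\<lambda>_. if r = u then 1 else 0) (\<lambda>k. \<Sum>s<N. \<Sum>\<^sub>\<infinity>j. \<alpha> r s j * \<beta> s u (k - j))"
  proof (rule laurent_expansion_cong)
    fix t :: complex assume "cmod t = 1"
    then have t: "t \<in> unit_circle" by simp
    have "(A t * B t) $$ (r, u) = (\<Sum>s<N. A t $$ (r, s) * B t $$ (s, u))"
      using A[OF t] B[OF t] ru by (simp add: scalar_prod_def atLeast0LessThan)
    then show "(\<Sum>s<N. A t $$ (r, s) * B t $$ (s, u)) = (if r = u then 1 else 0)"
      using ru by (simp add: AB[OF t])
  qed
  from fun_cong[OF laurent_expansion_unique[OF this laurent_expansion_const], of k]
  show "(\<Sum>s<N. \<Sum>\<^sub>\<infinity>j. \<alpha> r s j * \<beta> s u (k - j)) = (if r = u \<and> k = 0 then 1 else 0)" by simp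
qed

lemma GR_laurent_coefficients:
  assumes A: "A \<in> GR N"
  obtains \<alpha> \<beta> where
    "\<And>r s. r < N \<Longrightarrow> s < N \<Longrightarrow> laurent_expansion (\<lambda>t. A t $$ (r, s)) (\<alpha> r s)"
    "\<And>r s. r < N \<Longrightarrow> s < N \<Longrightarrow> laurent_decay (\<beta> r s)"
    "convolution_inverse N \<alpha> \<beta>" "convolution_inverse N \<beta> \<alpha>"
proof -
  from A have carr: "\<And>t. t \<in> unit_circle \<Longrightarrow> A t \<in> carrier_mat N N"
    and rat: "\<And>r s. r < N \<Longrightarrow> s < N \<Longrightarrow> rational_on_circle (\<lambda>t. A t $$ (r, s))"
    unfolding GR_def rational_matrix_fun_def rational_on_circle_def by auto
  obtain B where B: "\<And>t. t \<in> unit_circle \<Longrightarrow> B t \<in> carrier_mat N N"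
    "\<And>t. t \<in> unit_circle \<Longrightarrow> A t * B t = 1\<^sub>m N" "\<And>t. t \<in> unit_circle \<Longrightarrow> B t * A t = 1\<^sub>m N"
    and Brat: "\<And>r s. r < N \<Longrightarrow> s < N \<Longrightarrow> rational_on_circle (\<lambda>t. B t $$ (r, s))"
    using rational_matrix_inverse[OF A] by blast
  define \<alpha> where "\<alpha> r s = (SOME c. laurent_expansion (\<lambda>t. A t $$ (r, s)) c)" for r s
  define \<beta> where "\<beta> r s = (SOME c. laurent_expansion (\<lambda>t. B t $$ (r, s)) c)" for r s
  have \<alpha>: "laurent_expansion (\<lambda>t. A t $$ (r, s)) (\<alpha> r s)" if "r < N" "s < N" for r s
    unfolding \<alpha>_def using laurent_expansion_rational_on_circle[OF rat[OF that]] by (rule someI_ex)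
  have \<beta>: "laurent_expansion (\<lambda>t. B t $$ (r, s)) (\<beta> r s)" if "r < N" "s < N" for r s
    unfolding \<beta>_def using laurent_expansion_rational_on_circle[OF Brat[OF that]] by (rule someI_ex)
  show ?thesis
  proof (rule that[of \<alpha> \<beta>])
    show "laurent_expansion (\<lambda>t. A t $$ (r, s)) (\<alpha> r s)" if "r < N" "s < N" for r s
      by (rule \<alpha>[OF that])
    show "laurent_decay (\<beta> r s)" if "r < N" "s < N" for r s
      using \<beta>[OF that] unfolding laurent_expansion_def by blast
    show "convolution_inverse N \<alpha> \<beta>" by (rule convolution_inverseI[OF carr B(1) B(2) \<alpha> \<beta>])
    show "convolution_inverse N \<beta> \<alpha>" by (rule convolution_inverseI[OF B(1) carr B(3) \<beta> \<alpha>])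
  qed
qed

lemma convolution_inverse_reflect:
  assumes "convolution_inverse N \<alpha> \<beta>"
  shows "convolution_inverse N (\<lambda>r s k. \<alpha> r s (- k)) (\<lambda>r s k. \<beta> r s (- k))"
  unfolding convolution_inverse_def
proof (intro allI impI)
  fix r u and k :: int assume ru: "r < N" "u < N"
  have "(\<Sum>\<^sub>\<infinity>j. \<alpha> r s (- j) * \<beta> s u (- (k - j))) = (\<Sum>\<^sub>\<infinity>j. \<alpha> r s j * \<beta> s u (- k - j))" for s
    using infsum_reindex_bij_betw[OF bij_uminus, of "\<lambda>j. \<alpha> r s j * \<beta> s u (- k - j)"]
    by (simp add: algebra_simps)
  then show "(\<Sum>s<N. \<Sum>\<^sub>\<infinity>j. \<alpha> r s (- j) * \<beta> s u (- (k - j))) = (if r = u \<and> k = 0 then 1 else 0)"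
    using assms ru unfolding convolution_inverse_def by simp
qed

section \<open>Block Toeplitz matrices\<close>

definition block_toeplitz :: "nat \<Rightarrow> (nat \<Rightarrow> nat \<Rightarrow> int \<Rightarrow> complex) \<Rightarrow> inf_mat" where
  "block_toeplitz N \<alpha> i j = \<alpha> (i mod N) (j mod N) (int (i div N) - int (j div N))"

lemma laurent_decay_family:
  fixes N :: nat
  assumes "\<And>r s. r < N \<Longrightarrow> s < N \<Longrightarrow> laurent_decay (\<alpha> r s)"
  obtains c where "laurent_decay c" "\<And>r s k. r < N \<Longrightarrow> s < N \<Longrightarrow> cmod (\<alpha> r s k) \<le> cmod (c k)"
proof
  let ?c = "\<lambda>k. \<Sum>r<N. \<Sum>s<N. complex_of_real (cmod (\<alpha> r s k))"
  have "laurent_decay (\<lambda>k. complex_of_real (cmod (\<alpha> r s k)))" if "r < N" "s < N" for r s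
    using assms[OF that] unfolding laurent_decay_def by simp
  then show "laurent_decay ?c" by (intro laurent_decay_sum finite_lessThan) auto
  fix r s k assume rs: "r < N" "s < N"
  have "cmod (\<alpha> r s k) \<le> (\<Sum>s<N. cmod (\<alpha> r s k))"
    using rs by (intro member_le_sum) auto
  also have "\<dots> \<le> (\<Sum>r<N. \<Sum>s<N. cmod (\<alpha> r s k))"
    using rs by (intro member_le_sum[of r "{..<N}" "\<lambda>r. \<Sum>s<N. cmod (\<alpha> r s k)"]) (auto intro: sum_nonneg)
  also have "\<dots> = cmod (?c k)"
    by (simp add: sum_nonneg flip: of_real_sum)
  finally show "cmod (\<alpha> r s k) \<le> cmod (?c k)" .
qed

text \<open>
  The map from \<open>j\<close> to the pair of \<open>h (j div N)\<close> and \<open>j mod N\<close> is injective, so each power of \<open>r\<close> occurs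
  at most \<open>2 N\<close> times.
\<close>

lemma sum_blocks_geometric_le:
  fixes r :: real and h :: "nat \<Rightarrow> int"
  assumes N: "1 \<le> N" and r: "0 < r" "r < 1" and h: "inj h" and F: "finite F"
  shows "(\<Sum>j\<in>F. r ^ nat \<bar>h (j div N)\<bar>) \<le> real N * (2 / (1 - r))"
proof -
  let ?g = "\<lambda>j. (h (j div N), j mod N)"
  have inj: "inj_on ?g F"
  proof (rule inj_onI)
    fix i j assume "?g i = ?g j"
    then have "i div N = j div N" "i mod N = j mod N" using h by (auto dest: injD)
    then show "i = j" by (metis div_mult_mod_eq)
  qed
  have "(\<Sum>j\<in>F. r ^ nat \<bar>h (j div N)\<bar>) = (\<Sum>p\<in>?g ` F. r ^ nat \<bar>fst p\<bar>)"
    by (simp add: sum.reindex[OF inj])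
  also have "\<dots> \<le> (\<Sum>p\<in>fst ` ?g ` F \<times> {..<N}. r ^ nat \<bar>fst p\<bar>)"
    using F N r by (intro sum_mono2) force+
  also have "\<dots> = real N * (\<Sum>k\<in>fst ` ?g ` F. r ^ nat \<bar>k\<bar>)"
    by (simp add: sum.cartesian_product' sum_distrib_left)
  also have "\<dots> \<le> real N * (2 / (1 - r))"
    using F r by (intro mult_left_mono sum_geometric_int_le) auto
  finally show ?thesis .
qed

lemma block_toeplitz_schur_bound:
  assumes N: "1 \<le> N" and \<alpha>: "\<And>r s. r < N \<Longrightarrow> s < N \<Longrightarrow> laurent_decay (\<alpha> r s)"
  obtains C where "schur_bound C (block_toeplitz N \<alpha>)"
proof -
  obtain c where "laurent_decay c" and c: "\<And>r s k. r < N \<Longrightarrow> s < N \<Longrightarrow> cmod (\<alpha> r s k) \<le> cmod (c k)"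
    using laurent_decay_family[of N \<alpha>] \<alpha> by metis
  then obtain C r where r: "0 < r" "r < 1" and cC: "\<And>k. cmod (c k) \<le> C * r ^ nat \<bar>k\<bar>"
    unfolding laurent_decay_def by blast
  have C: "0 \<le> C" using order_trans[OF norm_ge_zero cC[of 0]] by simp
  have bound: "cmod (block_toeplitz N \<alpha> i j) \<le> C * r ^ nat \<bar>int (i div N) - int (j div N)\<bar>" for i j
    unfolding block_toeplitz_def using N by (intro order_trans[OF c cC]) auto
  have "(\<Sum>j\<in>F. cmod (block_toeplitz N \<alpha> i j)) \<le> C * (real N * (2 / (1 - r)))" if F: "finite F" for i F
  proof -
    have "(\<Sum>j\<in>F. cmod (block_toeplitz N \<alpha> i j)) \<le> C * (\<Sum>j\<in>F. r ^ nat \<bar>int (i div N) - int (j div N)\<bar>)"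
      unfolding sum_distrib_left by (intro sum_mono bound)
    also have "\<dots> \<le> C * (real N * (2 / (1 - r)))"
      using sum_blocks_geometric_le[OF N r _ F, of "\<lambda>m. int (i div N) - int m"] C
      by (intro mult_left_mono) (auto simp: inj_def)
    finally show ?thesis .
  qed
  moreover have "(\<Sum>i\<in>F. cmod (block_toeplitz N \<alpha> i j)) \<le> C * (real N * (2 / (1 - r)))" if F: "finite F" for j F
  proof -
    have "(\<Sum>i\<in>F. cmod (block_toeplitz N \<alpha> i j)) \<le> C * (\<Sum>i\<in>F. r ^ nat \<bar>int (i div N) - int (j div N)\<bar>)"
      unfolding sum_distrib_left by (intro sum_mono bound)
    also have "\<dots> \<le> C * (real N * (2 / (1 - r)))"
      using sum_blocks_geometric_le[OF N r _ F, of "\<lambda>m. int m - int (j div N)"] C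
      by (intro mult_left_mono) (auto simp: inj_def)
    finally show ?thesis .
  qed
  ultimately have "schur_bound (C * (real N * (2 / (1 - r)))) (block_toeplitz N \<alpha>)"
    unfolding schur_bound_def by blast
  then show ?thesis by (rule that)
qed

lemma has_sum_finite_sum:
  fixes f :: "'s \<Rightarrow> 'a \<Rightarrow> 'b :: {topological_comm_monoid_add}"
  assumes "finite S" "\<And>s. s \<in> S \<Longrightarrow> (f s has_sum c s) A"
  shows "((\<lambda>x. \<Sum>s\<in>S. f s x) has_sum (\<Sum>s\<in>S. c s)) A"
  using assms by (induction S rule: finite_induct) (auto intro!: has_sum_add)

lemma has_sum_blocks:
  fixes f :: "nat \<Rightarrow> complex"
  assumes N: "1 \<le> N" and f: "\<And>s. s < N \<Longrightarrow> ((\<lambda>m. f (m * N + s)) has_sum c s) UNIV"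
  shows "(f has_sum (\<Sum>s<N. c s)) UNIV"
proof -
  have "((\<lambda>j. if j mod N = s then f j else 0) has_sum c s) UNIV" if s: "s < N" for s
  proof -
    have inj: "inj (\<lambda>m. m * N + s)" using N by (auto simp: inj_def)
    have img: "range (\<lambda>m. m * N + s) = {j. j mod N = s}"
    proof (intro equalityI subsetI)
      fix j assume "j \<in> {j. j mod N = s}"
      then have "j mod N = s" by simp
      with div_mult_mod_eq[of j N] have "j = (j div N) * N + s" by linarith
      then show "j \<in> range (\<lambda>m. m * N + s)" by (rule range_eqI)
    qed (use s in auto)
    have "(f has_sum c s) {j. j mod N = s}"
      unfolding img[symmetric] has_sum_reindex[OF inj] using f[OF s] by (simp add: o_def)
    then have "((\<lambda>j. if j mod N = s then f j else 0) has_sum c s) {j. j mod N = s} "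
      by (subst has_sum_cong[where g = f]) auto
    moreover have "((\<lambda>j. if j mod N = s then f j else 0) has_sum c s) {j. j mod N = s} \<longleftrightarrow>
        ((\<lambda>j. if j mod N = s then f j else 0) has_sum c s) UNIV"
      by (rule has_sum_cong_neutral) auto
    ultimately show ?thesis by simp
  qed
  then have "((\<lambda>j. \<Sum>s<N. if j mod N = s then f j else 0) has_sum (\<Sum>s<N. c s)) UNIV"
    by (intro has_sum_finite_sum) auto
  moreover have "(\<Sum>s<N. if j mod N = s then f j else 0) = f j" for j
    using N by simp
  ultimately show ?thesis by simp
qed

text \<open>
  The product of two Toeplitz matrices contains only the terms with \<open>l \<ge> 0\<close> of the convolution
  \<open>\<Sum>\<^sub>l c (p - l) d (l - q)\<close>. The missing terms form the Hankel part: for \<open>l < 0\<close> the exponent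
  \<open>\<bar>p - l\<bar> + \<bar>l - q\<bar>\<close> equals \<open>p + q + 2 \<bar>l\<bar>\<close>.
\<close>

lemma half_convolution:
  assumes r: "0 < r" "r < 1" and C: "0 \<le> C"
    and c: "\<And>k. cmod (c k) \<le> C * r ^ nat \<bar>k\<bar>" and d: "\<And>k. cmod (d k) \<le> C * r ^ nat \<bar>k\<bar>"
  obtains y where "((\<lambda>m. c (int p - int m) * d (int m - int q)) has_sum ((\<Sum>\<^sub>\<infinity>j. c j * d (int p - int q - j)) - y)) UNIV"
    "cmod y \<le> 2 * C\<^sup>2 / (1 - r) * r ^ (p + q)"
proof -
  let ?x = "\<Sum>\<^sub>\<infinity>j. c j * d (int p - int q - j)"
  let ?f = "\<lambda>l. c (int p - l) * d (l - int q)"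
  have sq: "0 < sqrt r" "sqrt r < 1" using r by auto
  have "(\<lambda>j. c j * d (int p - int q - j)) summable_on UNIV"
  proof (rule abs_summable_bounded(2))
    fix F :: "int set" assume F: "finite F"
    have "(\<Sum>j\<in>F. norm (c j * d (int p - int q - j))) \<le>
        (\<Sum>j\<in>F. C\<^sup>2 * sqrt r ^ nat \<bar>int p - int q\<bar> * sqrt r ^ nat \<bar>j\<bar>)"
      using laurent_convolution_bound[OF r C c d, where k = "int p - int q"]
      by (intro sum_mono) (simp add: mult_ac)
    also have "\<dots> \<le> C\<^sup>2 * sqrt r ^ nat \<bar>int p - int q\<bar> * (2 / (1 - sqrt r))"
      unfolding sum_distrib_left[symmetric] using sq F by (intro mult_left_mono sum_geometric_int_le) auto
    finally show "(\<Sum>j\<in>F. norm (c j * d (int p - int q - j))) \<le> C\<^sup>2 * sqrt r ^ nat \<bar>int p - int q\<bar> * (2 / (1 - sqrt r))" .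
  qed
  then have "((\<lambda>j. c j * d (int p - int q - j)) has_sum ?x) UNIV" by (rule has_sum_infsum)
  moreover have "bij (\<lambda>l. int p - l)" by (rule bij_diff)
  ultimately have full: "(?f has_sum ?x) UNIV"
    using has_sum_reindex_bij_betw[of "\<lambda>l. int p - l" UNIV UNIV "\<lambda>j. c j * d (int p - int q - j)" ?x]
    by (simp add: algebra_simps)
  let ?neg = "\<lambda>l. if l < 0 then ?f l else 0"
  define y where "y = (\<Sum>\<^sub>\<infinity>l. ?neg l)"
  have neg_bound: "(\<Sum>l\<in>F. norm (?neg l)) \<le> 2 * C\<^sup>2 / (1 - r) * r ^ (p + q)" if F: "finite F" for F
  proof -
    have "norm (?neg l) \<le> C\<^sup>2 * r ^ (p + q) * r ^ nat \<bar>l\<bar>" for l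
    proof (cases "l < 0")
      case True
      have "norm (?f l) \<le> (C * r ^ nat \<bar>int p - l\<bar>) * (C * r ^ nat \<bar>l - int q\<bar>)"
        unfolding norm_mult using C r by (intro mult_mono c d) auto
      also have "\<dots> = C\<^sup>2 * r ^ (nat \<bar>int p - l\<bar> + nat \<bar>l - int q\<bar>)" by (simp add: power2_eq_square power_add)
      also have "\<dots> \<le> C\<^sup>2 * r ^ (p + q + nat \<bar>l\<bar>)"
        using r True by (intro mult_left_mono power_decreasing) auto
      finally show ?thesis using True by (simp add: power_add mult.assoc)
    qed (use C r in simp)
    then have "(\<Sum>l\<in>F. norm (?neg l)) \<le> (\<Sum>l\<in>F. C\<^sup>2 * r ^ (p + q) * r ^ nat \<bar>l\<bar>)"
      by (intro sum_mono)
    also have "\<dots> \<le> C\<^sup>2 * r ^ (p + q) * (2 / (1 - r))"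
      unfolding sum_distrib_left[symmetric] using r F by (intro mult_left_mono sum_geometric_int_le) auto
    finally show ?thesis by (simp add: mult_ac)
  qed
  have "((\<lambda>l. ?f l + - ?neg l) has_sum (?x + - y)) UNIV"
    unfolding y_def by (intro has_sum_add full has_sum_uminusI has_sum_infsum abs_summable_bounded(2)[OF neg_bound])
  moreover have "(\<lambda>l. ?f l + - ?neg l) = (\<lambda>l. if 0 \<le> l then ?f l else 0)" by auto
  ultimately have 1: "((\<lambda>l. if 0 \<le> l then ?f l else 0) has_sum (?x - y)) UNIV" by simp
  have nonneg: "k \<in> range int" if "0 \<le> k" for k using that by (metis nat_0_le rangeI)
  have "((\<lambda>l. if 0 \<le> l then ?f l else 0) has_sum (?x - y)) UNIV \<longleftrightarrow> (?f has_sum (?x - y)) (range int)"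
    by (rule has_sum_cong_neutral) (use nonneg in auto)
  with 1 have "(?f has_sum (?x - y)) (range int)" by simp
  then have "((?f \<circ> int) has_sum (?x - y)) UNIV" by (subst (asm) has_sum_reindex) auto
  moreover have "cmod y \<le> 2 * C\<^sup>2 / (1 - r) * r ^ (p + q)"
    unfolding y_def by (rule abs_summable_bounded(3)[OF neg_bound])
  ultimately show ?thesis by (intro that[of y]) (auto simp: o_def)
qed

text \<open>
  This converts decay in the block index into decay in the scalar index. The rate becomes its \<open>N\<close>-th
  root, and the factor \<open>1 / r\<close> pays for \<open>i \<le> N (i div N) + N\<close>.
\<close>

lemma power_div_le:
  fixes r :: real
  assumes N: "1 \<le> N" and r: "0 < r" "r < 1"
  shows "r ^ (i div N) \<le> 1 / r * root N r ^ i"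
proof -
  have \<sigma>: "0 < root N r" "root N r < 1" "root N r ^ N = r"
    using N r by (auto simp: real_root_pow_pos2)
  have "i \<le> N * (i div N) + N"
    using N mult_div_mod_eq[of N i] mod_less_divisor[of N i] by linarith
  then have "root N r ^ (N * (i div N) + N) \<le> root N r ^ i"
    using \<sigma> by (intro power_decreasing) auto
  then have "r ^ (i div N) * r \<le> root N r ^ i" by (simp add: power_add power_mult \<sigma>(3))
  then show ?thesis using r by (simp add: field_simps)
qed

text \<open>
  Widom's formula \<open>T(A) T(B) = T(A B) - H(A) H(B(1/t))\<close> for \<open>A B = 1\<close>, with \<open>K\<close> as the Hankel product.
\<close>

lemma block_toeplitz_parametrix:
  assumes N: "1 \<le> N" and \<alpha>: "\<And>r s. r < N \<Longrightarrow> s < N \<Longrightarrow> laurent_decay (\<alpha> r s)"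
    and \<beta>: "\<And>r s. r < N \<Longrightarrow> s < N \<Longrightarrow> laurent_decay (\<beta> r s)"
    and inv: "convolution_inverse N \<alpha> \<beta>"
  obtains K where "exp_decaying_mat K"
    "mat_prod (block_toeplitz N \<alpha>) (block_toeplitz N \<beta>) = (\<lambda>i j. (if i = j then 1 else 0) - K i j)"
proof -
  obtain c where c: "laurent_decay c" "\<And>r s k. r < N \<Longrightarrow> s < N \<Longrightarrow> cmod (\<alpha> r s k) \<le> cmod (c k)"
    using laurent_decay_family[of N \<alpha>] \<alpha> by metis
  obtain d where d: "laurent_decay d" "\<And>r s k. r < N \<Longrightarrow> s < N \<Longrightarrow> cmod (\<beta> r s k) \<le> cmod (d k)"
    using laurent_decay_family[of N \<beta>] \<beta> by metis
  obtain C r where r: "0 < r" "r < 1" and C: "0 \<le> C"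
    and cC: "\<And>k. cmod (c k) \<le> C * r ^ nat \<bar>k\<bar>" and dC: "\<And>k. cmod (d k) \<le> C * r ^ nat \<bar>k\<bar>"
    by (rule laurent_decay_common_rate[OF c(1) d(1)]) auto
  define K where "K i k = (if i = k then 1 else 0) - mat_prod (block_toeplitz N \<alpha>) (block_toeplitz N \<beta>) i k" for i k
  define D where "D = real N * (2 * C\<^sup>2 / (1 - r))"
  have D: "0 \<le> D" using r by (simp add: D_def)
  have K: "cmod (K i k) \<le> D * r ^ (i div N + k div N)" for i k
  proof -
    let ?p = "i div N" and ?q = "k div N" and ?r = "i mod N" and ?u = "k mod N"
    have ru: "?r < N" "?u < N" using N by auto
    have "\<exists>y. ((\<lambda>m. \<alpha> ?r s (int ?p - int m) * \<beta> s ?u (int m - int ?q)) has_sum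
            ((\<Sum>\<^sub>\<infinity>j. \<alpha> ?r s j * \<beta> s ?u (int ?p - int ?q - j)) - y)) UNIV \<and>
            cmod y \<le> 2 * C\<^sup>2 / (1 - r) * r ^ (?p + ?q)" if s: "s < N" for s
    proof -
      obtain y where "((\<lambda>m. \<alpha> ?r s (int ?p - int m) * \<beta> s ?u (int m - int ?q)) has_sum
            ((\<Sum>\<^sub>\<infinity>j. \<alpha> ?r s j * \<beta> s ?u (int ?p - int ?q - j)) - y)) UNIV"
        and "cmod y \<le> 2 * C\<^sup>2 / (1 - r) * r ^ (?p + ?q)"
        using half_convolution[OF r C order_trans[OF c(2)[OF ru(1) s] cC] order_trans[OF d(2)[OF s ru(2)] dC], of ?p ?q]
        by blast
      then show ?thesis by blast
    qed
    then have "\<forall>s\<in>{..<N}. \<exists>y. ((\<lambda>m. \<alpha> ?r s (int ?p - int m) * \<beta> s ?u (int m - int ?q)) has_sum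
            ((\<Sum>\<^sub>\<infinity>j. \<alpha> ?r s j * \<beta> s ?u (int ?p - int ?q - j)) - y)) UNIV \<and>
            cmod y \<le> 2 * C\<^sup>2 / (1 - r) * r ^ (?p + ?q)" by auto
    from bchoice[OF this] obtain y where y: "\<forall>s\<in>{..<N}. ((\<lambda>m. \<alpha> ?r s (int ?p - int m) * \<beta> s ?u (int m - int ?q)) has_sum
            ((\<Sum>\<^sub>\<infinity>j. \<alpha> ?r s j * \<beta> s ?u (int ?p - int ?q - j)) - y s)) UNIV \<and>
            cmod (y s) \<le> 2 * C\<^sup>2 / (1 - r) * r ^ (?p + ?q)"
      by (rule exE)
    have ybound: "cmod (y s) \<le> 2 * C\<^sup>2 / (1 - r) * r ^ (?p + ?q)" if "s < N" for s
      using y that by simp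
    have "((\<lambda>j. block_toeplitz N \<alpha> i j * block_toeplitz N \<beta> j k) has_sum
        (\<Sum>s<N. (\<Sum>\<^sub>\<infinity>j. \<alpha> ?r s j * \<beta> s ?u (int ?p - int ?q - j)) - y s)) UNIV"
    proof (rule has_sum_blocks[OF N])
      fix s assume "s < N"
      then show "((\<lambda>m. block_toeplitz N \<alpha> i (m * N + s) * block_toeplitz N \<beta> (m * N + s) k) has_sum
        ((\<Sum>\<^sub>\<infinity>j. \<alpha> ?r s j * \<beta> s ?u (int ?p - int ?q - j)) - y s)) UNIV"
        using y by (simp add: block_toeplitz_def)
    qed
    then have "mat_prod (block_toeplitz N \<alpha>) (block_toeplitz N \<beta>) i k =
        (\<Sum>s<N. \<Sum>\<^sub>\<infinity>j. \<alpha> ?r s j * \<beta> s ?u (int ?p - int ?q - j)) - (\<Sum>s<N. y s)"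
      unfolding mat_prod_def by (subst infsumI) (auto simp: sum_subtractf)
    also have "(\<Sum>s<N. \<Sum>\<^sub>\<infinity>j. \<alpha> ?r s j * \<beta> s ?u (int ?p - int ?q - j)) = (if ?r = ?u \<and> int ?p - int ?q = 0 then 1 else 0)"
      using inv ru unfolding convolution_inverse_def by blast
    also have "?r = ?u \<and> int ?p - int ?q = 0 \<longleftrightarrow> i = k"
      by (metis cancel_comm_monoid_add_class.diff_cancel div_mult_mod_eq eq_iff_diff_eq_0 of_nat_eq_iff)
    finally have "cmod (K i k) \<le> (\<Sum>s<N. cmod (y s))" by (simp add: K_def norm_sum)
    also have "\<dots> \<le> (\<Sum>s<N. 2 * C\<^sup>2 / (1 - r) * r ^ (?p + ?q))"
      using ybound by (intro sum_mono) auto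
    finally show ?thesis by (simp add: D_def)
  qed
  have "exp_decaying_mat K"
    unfolding exp_decaying_mat_def
  proof (intro exI conjI allI)
    show "0 < root N r" "root N r < 1" using N r by auto
    fix i k
    have "r ^ (i div N + k div N) \<le> (1 / r * root N r ^ i) * (1 / r * root N r ^ k)"
      unfolding power_add using N r by (intro mult_mono power_div_le) auto
    also have "\<dots> = (1 / r)\<^sup>2 * root N r ^ (i + k)"
      by (simp add: power_add power2_eq_square)
    finally have "D * r ^ (i div N + k div N) \<le> D * ((1 / r)\<^sup>2 * root N r ^ (i + k))"
      using D by (rule mult_left_mono)
    with K[of i k] show "cmod (K i k) \<le> D * (1 / r)\<^sup>2 * root N r ^ (i + k)"
      by (simp add: mult.assoc)
  qed
  then show ?thesis by (rule that) (auto simp: K_def)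
qed

section \<open>Exponentially small vectors of the finite sections\<close>

lemma sum_geometric_tail_le:
  fixes r :: real
  assumes r: "0 < r" "r < 1" and K: "finite K" "\<And>k. k \<in> K \<Longrightarrow> m \<le> k"
  shows "(\<Sum>k\<in>K. r ^ k) \<le> r ^ m / (1 - r)"
proof -
  have inj: "inj_on (\<lambda>k. k - m) K" using K(2) by (auto simp: inj_on_def) (metis le_add_diff_inverse2)
  have "(\<Sum>k\<in>K. r ^ k) = (\<Sum>k\<in>K. r ^ m * r ^ (k - m))"
    using K(2) by (intro sum.cong) (auto simp flip: power_add)
  also have "\<dots> = r ^ m * (\<Sum>l\<in>(\<lambda>k. k - m) ` K. r ^ l)"
    by (simp add: sum.reindex[OF inj] sum_distrib_left)
  also have "\<dots> \<le> r ^ m * (1 / (1 - r))"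
    using r K by (intro mult_left_mono sum_geometric_le) auto
  finally show ?thesis by simp
qed

text \<open>
  As \<open>a z = 0\<close>, the section applied to the truncated \<open>z\<close> equals, up to sign, \<open>a\<close> applied to the tail of
  \<open>z\<close>. The column sums of \<open>a\<close> bound this by the sum of the tail.
\<close>

lemma truncated_kernel_small:
  assumes a: "schur_bound C a" and r: "0 < r" "r < 1"
    and z: "\<And>i. cmod (z i) \<le> D * r ^ i" and ker: "mat_app a z = (\<lambda>_. 0)"
  shows "(\<Sum>j<m. cmod (\<Sum>k<m. a j k * z k)) \<le> C * D / (1 - r) * r ^ m"
proof (rule tendsto_upperbound)
  have C: "0 \<le> C" by (rule schur_bound_nonneg[OF a])
  have D: "0 \<le> D" using order_trans[OF norm_ge_zero z[of 0]] by simp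
  have zD: "cmod (z i) \<le> D" for i
    using z[of i] D r by (meson dual_order.trans less_eq_real_def mult_left_le power_le_one)
  have "((\<lambda>K. \<Sum>k\<in>K. a j k * z k) \<longlongrightarrow> mat_app a z j) (finite_subsets_at_top UNIV)" for j
    unfolding mat_app_def by (rule infsum_tendsto, rule row_summable[OF a zD])
  then have "((\<lambda>K. \<Sum>j<m. cmod ((\<Sum>k<m. a j k * z k) - (\<Sum>k\<in>K. a j k * z k)))
      \<longlongrightarrow> (\<Sum>j<m. cmod ((\<Sum>k<m. a j k * z k) - mat_app a z j))) (finite_subsets_at_top UNIV)"
    by (intro tendsto_intros)
  then show "((\<lambda>K. \<Sum>j<m. cmod ((\<Sum>k<m. a j k * z k) - (\<Sum>k\<in>K. a j k * z k)))
      \<longlongrightarrow> (\<Sum>j<m. cmod (\<Sum>k<m. a j k * z k))) (finite_subsets_at_top UNIV)"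
    by (simp add: ker)
  show "\<forall>\<^sub>F K in finite_subsets_at_top UNIV.
      (\<Sum>j<m. cmod ((\<Sum>k<m. a j k * z k) - (\<Sum>k\<in>K. a j k * z k))) \<le> C * D / (1 - r) * r ^ m"
    unfolding eventually_finite_subsets_at_top
  proof (intro exI[of _ "{..<m}"] conjI allI impI)
    fix K :: "nat set" assume K: "finite K \<and> {..<m} \<subseteq> K \<and> K \<subseteq> UNIV"
    have "(\<Sum>k\<in>K. a j k * z k) = (\<Sum>k\<in>K - {..<m}. a j k * z k) + (\<Sum>k<m. a j k * z k)" for j
      using K by (intro sum.subset_diff) auto
    then have "(\<Sum>j<m. cmod ((\<Sum>k<m. a j k * z k) - (\<Sum>k\<in>K. a j k * z k))) =
        (\<Sum>j<m. cmod (\<Sum>k\<in>K - {..<m}. a j k * z k))" by simp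
    also have "\<dots> \<le> (\<Sum>j<m. \<Sum>k\<in>K - {..<m}. cmod (a j k) * cmod (z k))"
      by (intro sum_mono order_trans[OF norm_sum]) (simp add: norm_mult)
    also have "\<dots> = (\<Sum>k\<in>K - {..<m}. (\<Sum>j<m. cmod (a j k)) * cmod (z k))"
      by (subst sum.swap) (simp add: sum_distrib_right)
    also have "\<dots> \<le> (\<Sum>k\<in>K - {..<m}. C * (D * r ^ k))"
      using C by (intro sum_mono mult_mono schur_bound_col[OF a] z) auto
    also have "\<dots> = C * D * (\<Sum>k\<in>K - {..<m}. r ^ k)" by (simp add: sum_distrib_left mult.assoc)
    also have "\<dots> \<le> C * D * (r ^ m / (1 - r))"
      using C D K r by (intro mult_left_mono sum_geometric_tail_le) auto
    finally show "(\<Sum>j<m. cmod ((\<Sum>k<m. a j k * z k) - (\<Sum>k\<in>K. a j k * z k))) \<le> C * D / (1 - r) * r ^ m"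
      by simp
  qed auto
qed simp

definition section_inverse :: "nat \<Rightarrow> inf_mat \<Rightarrow> inf_mat \<Rightarrow> bool" where
  "section_inverse m a b \<longleftrightarrow>
     (\<forall>i<m. \<forall>k<m. (\<Sum>j<m. a i j * b j k) = (if i = k then 1 else 0)) \<and>
     (\<forall>i<m. \<forall>k<m. (\<Sum>j<m. b i j * a j k) = (if i = k then 1 else 0))"

text \<open>
  Growth of the inverses of the sections is measured by their largest entry, a quantity that does
  not change under transposition and under permutation of the indices.
\<close>

definition exp_growing_inverses :: "inf_mat \<Rightarrow> bool" where
  "exp_growing_inverses a \<longleftrightarrow> (\<exists>c q m0. 0 < c \<and> 1 < q \<and>
     (\<forall>m\<ge>m0. \<forall>b S. section_inverse m a b \<longrightarrow> (\<forall>i<m. \<forall>j<m. cmod (b i j) \<le> S) \<longrightarrow> c * q ^ m \<le> S))"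

text \<open>
  An inverse \<open>b\<close> recovers the fixed nonzero entry \<open>z i\<close> from the image of the truncated \<open>z\<close> under the
  section. That image is of size \<open>O(r ^ m)\<close>, so row \<open>i\<close> of \<open>b\<close> must contain an entry of size at least
  a constant times \<open>(1 / r) ^ m\<close>.
\<close>

lemma exp_growing_inverses_kernel:
  assumes a: "schur_bound C a" and zi: "z i \<noteq> 0" and z: "exp_decaying z" and ker: "mat_app a z = (\<lambda>_. 0)"
  shows "exp_growing_inverses a"
proof -
  from z obtain D r where r: "0 < r" "r < 1" and zD: "\<And>i. cmod (z i) \<le> D * r ^ i"
    unfolding exp_decaying_def by blast
  \<comment> \<open>The maximum with 1 keeps the constant positive, so that one can divide by it.\<close>
  define E where "E = max 1 (C * D / (1 - r))"
  have E: "0 < E" by (simp add: E_def)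
  have "cmod (z i) / E * (1 / r) ^ m \<le> S"
    if m: "Suc i \<le> m" and b: "section_inverse m a b" and S: "\<forall>i<m. \<forall>j<m. cmod (b i j) \<le> S" for m b S
  proof -
    have i: "i < m" using m by simp
    have S0: "0 \<le> S" using S i norm_ge_zero order_trans by blast
    have "z i = (\<Sum>k<m. (if i = k then 1 else 0) * z k)" using i by (simp add: if_distrib[of "\<lambda>u. u * _"] cong: if_cong)
    also have "\<dots> = (\<Sum>k<m. (\<Sum>j<m. b i j * a j k) * z k)"
      using b i unfolding section_inverse_def by (intro sum.cong) auto
    also have "\<dots> = (\<Sum>j<m. b i j * (\<Sum>k<m. a j k * z k))"
      unfolding sum_distrib_left sum_distrib_right by (subst sum.swap) (simp add: mult.assoc)
    finally have "cmod (z i) \<le> (\<Sum>j<m. cmod (b i j) * cmod (\<Sum>k<m. a j k * z k))"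
      using norm_sum[of "\<lambda>j. b i j * (\<Sum>k<m. a j k * z k)" "{..<m}"] by (simp add: norm_mult)
    also have "\<dots> \<le> (\<Sum>j<m. S * cmod (\<Sum>k<m. a j k * z k))"
      using S i by (intro sum_mono mult_right_mono) auto
    also have "\<dots> \<le> S * (C * D / (1 - r) * r ^ m)"
      unfolding sum_distrib_left[symmetric] using S0
      by (intro mult_left_mono truncated_kernel_small[OF a r zD ker])
    also have "\<dots> \<le> S * (E * r ^ m)"
      using S0 r by (intro mult_left_mono mult_right_mono) (auto simp: E_def)
    finally show ?thesis using E r by (simp add: field_simps power_divide)
  qed
  moreover have "0 < cmod (z i) / E" "1 < 1 / r" using E zi r by auto
  ultimately show ?thesis unfolding exp_growing_inverses_def by blast
qed

lemma exp_growing_inverses_transpose: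
  assumes "exp_growing_inverses (\<lambda>i j. a j i)"
  shows "exp_growing_inverses a"
proof -
  from assms obtain c q m0 where cq: "0 < c" "1 < q"
    and *: "\<And>m b S. m0 \<le> m \<Longrightarrow> section_inverse m (\<lambda>i j. a j i) b \<Longrightarrow> (\<forall>i<m. \<forall>j<m. cmod (b i j) \<le> S) \<Longrightarrow> c * q ^ m \<le> S"
    unfolding exp_growing_inverses_def by blast
  have "c * q ^ m \<le> S" if "m0 \<le> m" "section_inverse m a b" "\<forall>i<m. \<forall>j<m. cmod (b i j) \<le> S" for m b S
  proof (rule *[OF that(1), of "\<lambda>i j. b j i"])
    show "section_inverse m (\<lambda>i j. a j i) (\<lambda>i j. b j i)"
      unfolding section_inverse_def
    proof (intro conjI allI impI)
      fix i k assume ik: "i < m" "k < m"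
      show "(\<Sum>j<m. a j i * b k j) = (if i = k then 1 else 0)"
        using that(2) ik unfolding section_inverse_def by (subst mult.commute) simp
      show "(\<Sum>j<m. b j i * a k j) = (if i = k then 1 else 0)"
        using that(2) ik unfolding section_inverse_def by (subst mult.commute) simp
    qed
  qed (use that(3) in auto)
  with cq show ?thesis unfolding exp_growing_inverses_def by blast
qed

definition block_reversal :: "nat \<Rightarrow> nat \<Rightarrow> nat \<Rightarrow> nat" where
  "block_reversal N n i = (n - 1 - i div N) * N + i mod N"

lemma block_reversal_div_mod:
  assumes "1 \<le> N"
  shows "block_reversal N n i div N = n - 1 - i div N" "block_reversal N n i mod N = i mod N"
  using assms div_mult_self3[of N "n - 1 - i div N" "i mod N"] by (simp_all add: block_reversal_def)

lemma block_reversal_involution: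
  assumes N: "1 \<le> N" and i: "i < n * N"
  shows "block_reversal N n i < n * N" "block_reversal N n (block_reversal N n i) = i"
proof -
  have q: "i div N < n" using N i by (simp add: less_mult_imp_div_less)
  then have "block_reversal N n i div N < n" unfolding block_reversal_div_mod[OF N] by simp
  then show "block_reversal N n i < n * N" using N by (simp add: div_less_iff_less_mult)
  have "n - 1 - (n - 1 - i div N) = i div N" using q by simp
  then have "block_reversal N n (block_reversal N n i) = (i div N) * N + i mod N"
    unfolding block_reversal_def[of N n "block_reversal N n i"] block_reversal_div_mod[OF N] by (simp only:)
  then show "block_reversal N n (block_reversal N n i) = i" by simp
qed

text \<open>
  Reversing the order of the blocks replaces the difference of two block indices by its negative.
\<close>

lemma section_inverse_block_reversal:
  assumes N: "1 \<le> N" and b: "section_inverse (n * N) (block_toeplitz N \<alpha>) b"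
  shows "section_inverse (n * N) (block_toeplitz N (\<lambda>r s k. \<alpha> r s (- k)))
    (\<lambda>i j. b (block_reversal N n i) (block_reversal N n j))"
proof -
  define \<pi> where "\<pi> = block_reversal N n"
  have rev: "\<pi> i < n * N" "\<pi> (\<pi> i) = i" if "i < n * N" for i
    unfolding \<pi>_def using block_reversal_involution[OF N that] by auto
  have rev': "\<pi> i div N = n - 1 - i div N" "\<pi> i mod N = i mod N" for i
    unfolding \<pi>_def by (rule block_reversal_div_mod[OF N])+
  have bij: "bij_betw \<pi> {..<n * N} {..<n * N}"
    by (rule bij_betw_byWitness[where f' = \<pi>]) (use rev in auto)
  have inj: "\<pi> i = \<pi> k \<longleftrightarrow> i = k" if "i < n * N" "k < n * N" for i k
    using rev(2) that by metis
  have a: "block_toeplitz N (\<lambda>r s k. \<alpha> r s (- k)) i j = block_toeplitz N \<alpha> (\<pi> i) (\<pi> j)"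
    if "i < n * N" "j < n * N" for i j
  proof -
    have "i div N < n" "j div N < n" using that N by (simp_all add: less_mult_imp_div_less)
    then have "int (n - 1 - i div N) - int (n - 1 - j div N) = - (int (i div N) - int (j div N))"
      by (simp add: of_nat_diff)
    then show ?thesis by (simp only: block_toeplitz_def rev')
  qed
  have "section_inverse (n * N) (block_toeplitz N (\<lambda>r s k. \<alpha> r s (- k))) (\<lambda>i j. b (\<pi> i) (\<pi> j))"
    unfolding section_inverse_def
  proof (intro conjI allI impI)
    fix i k assume ik: "i < n * N" "k < n * N"
    have "(\<Sum>j<n * N. block_toeplitz N (\<lambda>r s k. \<alpha> r s (- k)) i j * b (\<pi> j) (\<pi> k)) =
        (\<Sum>j<n * N. block_toeplitz N \<alpha> (\<pi> i) (\<pi> j) * b (\<pi> j) (\<pi> k))"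
      using ik by (intro sum.cong) (auto simp: a)
    also have "\<dots> = (\<Sum>j<n * N. block_toeplitz N \<alpha> (\<pi> i) j * b j (\<pi> k))"
      by (rule sum.reindex_bij_betw[OF bij])
    also have "\<dots> = (if i = k then 1 else 0)"
      using b ik rev(1) inj unfolding section_inverse_def by simp
    finally show "(\<Sum>j<n * N. block_toeplitz N (\<lambda>r s k. \<alpha> r s (- k)) i j * b (\<pi> j) (\<pi> k)) = (if i = k then 1 else 0)" .
    have "(\<Sum>j<n * N. b (\<pi> i) (\<pi> j) * block_toeplitz N (\<lambda>r s k. \<alpha> r s (- k)) j k) =
        (\<Sum>j<n * N. b (\<pi> i) (\<pi> j) * block_toeplitz N \<alpha> (\<pi> j) (\<pi> k))"
      using ik by (intro sum.cong) (auto simp: a)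
    also have "\<dots> = (\<Sum>j<n * N. b (\<pi> i) j * block_toeplitz N \<alpha> j (\<pi> k))"
      by (rule sum.reindex_bij_betw[OF bij])
    also have "\<dots> = (if i = k then 1 else 0)"
      using b ik rev(1) inj unfolding section_inverse_def by simp
    finally show "(\<Sum>j<n * N. b (\<pi> i) (\<pi> j) * block_toeplitz N (\<lambda>r s k. \<alpha> r s (- k)) j k) = (if i = k then 1 else 0)" .
  qed
  then show ?thesis unfolding \<pi>_def .
qed

section \<open>Determinants and inverses of finite matrices\<close>

lemma mat_delete_row_sum_le:
  fixes M :: "complex mat"
  assumes M: "M \<in> carrier_mat n n" and R: "\<And>i. i < n \<Longrightarrow> (\<Sum>j<n. cmod (M $$ (i, j))) \<le> R"
    and p: "p < n - 1"
  shows "(\<Sum>k<n - 1. cmod (mat_delete M i j $$ (p, k))) \<le> R"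
proof -
  let ?g = "\<lambda>k. if k < j then k else Suc k" and ?p = "if p < i then p else Suc p"
  have inj: "inj_on ?g {..<n - 1}" by (auto simp: inj_on_def split: if_splits)
  have "(\<Sum>k<n - 1. cmod (mat_delete M i j $$ (p, k))) = (\<Sum>k<n - 1. cmod (M $$ (?p, ?g k)))"
    using M p by (intro sum.cong) (auto simp: mat_delete_def)
  also have "\<dots> = (\<Sum>k\<in>?g ` {..<n - 1}. cmod (M $$ (?p, k)))"
    by (subst sum.reindex[OF inj]) (simp add: o_def)
  also have "\<dots> \<le> (\<Sum>k<n. cmod (M $$ (?p, k)))" by (intro sum_mono2) auto
  also have "\<dots> \<le> R" using p by (intro R) auto
  finally show ?thesis .
qed

lemma norm_det_le_row_sums:
  fixes M :: "complex mat"
  assumes "M \<in> carrier_mat n n" "0 \<le> R" "\<And>i. i < n \<Longrightarrow> (\<Sum>j<n. cmod (M $$ (i, j))) \<le> R"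
  shows "cmod (Determinant.det M) \<le> R ^ n"
  using assms
proof (induction n arbitrary: M)
  case 0
  then show ?case by simp
next
  case (Suc n)
  have cof: "cmod (cofactor M 0 j) \<le> R ^ n" if j: "j < Suc n" for j
  proof -
    have "cmod (Determinant.det (mat_delete M 0 j)) \<le> R ^ n"
    proof (rule Suc.IH)
      show "mat_delete M 0 j \<in> carrier_mat n n" using mat_delete_carrier[OF Suc.prems(1), of 0 j] by simp
      show "(\<Sum>k<n. cmod (mat_delete M 0 j $$ (i, k))) \<le> R" if "i < n" for i
        using mat_delete_row_sum_le[OF Suc.prems(1,3), of i 0 j] that by simp
    qed (rule Suc.prems(2))
    then show ?thesis by (simp add: cofactor_def norm_mult norm_power)
  qed
  have "Determinant.det M = (\<Sum>j<Suc n. M $$ (0, j) * cofactor M 0 j)"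
    using laplace_expansion_row[OF Suc.prems(1), of 0] by simp
  then have "cmod (Determinant.det M) \<le> (\<Sum>j<Suc n. cmod (M $$ (0, j)) * cmod (cofactor M 0 j))"
    using norm_sum[of "\<lambda>j. M $$ (0, j) * cofactor M 0 j" "{..<Suc n}"] by (simp only: norm_mult)
  also have "\<dots> \<le> (\<Sum>j<Suc n. cmod (M $$ (0, j)) * R ^ n)"
    by (intro sum_mono mult_left_mono cof) auto
  also have "\<dots> = (\<Sum>j<Suc n. cmod (M $$ (0, j))) * R ^ n" by (simp only: sum_distrib_right)
  also have "\<dots> \<le> R * R ^ n"
    using Suc.prems by (intro mult_right_mono) auto
  finally show ?case by simp
qed

text \<open>
  The determinant is the product of the diagonal of a triangular Schur form, and this diagonal
  consists of eigenvalues.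
\<close>

lemma norm_det_ge_spectrum:
  assumes M: "M \<in> carrier_mat n n" and \<epsilon>: "0 < \<epsilon>" "\<And>e. e \<in> spectrum M \<Longrightarrow> \<epsilon> \<le> cmod e"
  shows "\<epsilon> ^ n \<le> cmod (Determinant.det M)"
proof -
  obtain es where es: "char_poly M = (\<Prod>a\<leftarrow>es. [:- a, 1:])" "length es = n"
    using char_poly_factorized[OF M] by blast
  obtain B P Q where "schur_decomposition M es = (B, P, Q)" by (cases "schur_decomposition M es") auto
  from schur_decomposition[OF M es(1) this]
  have B: "similar_mat_wit M B P Q" "upper_triangular B" "diag_mat B = es" by auto
  have Bc: "B \<in> carrier_mat n n" using similar_mat_witD2[OF M B(1)] by auto
  have "similar_mat M B" using B(1) unfolding similar_mat_def by blast
  then have "Determinant.det M = prod_list es"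
    using det_similar[OF \<open>similar_mat M B\<close>] det_upper_triangular[OF B(2) Bc] B(3) by simp
  moreover have "\<epsilon> ^ length xs \<le> cmod (prod_list xs)" if "set xs \<subseteq> set es" for xs
    using that
  proof (induction xs)
    case (Cons x xs)
    then have "poly (char_poly M) x = 0" unfolding es(1) by (auto simp: poly_prod_list prod_list_zero_iff image_iff)
    then have "x \<in> spectrum M"
      using eigenvalue_root_char_poly[OF M] by (simp add: spectrum_def)
    then have "\<epsilon> * \<epsilon> ^ length xs \<le> cmod x * cmod (prod_list xs)"
      using \<epsilon> Cons by (intro mult_mono) auto
    then show ?case by (simp add: norm_mult)
  qed simp
  ultimately show ?thesis using es(2) by auto
qed

text \<open>
  Cramer's rule: an entry of the inverse is a cofactor divided by the determinant.
\<close>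

lemma norm_inverse_entry_le:
  fixes M B :: "complex mat"
  assumes M: "M \<in> carrier_mat n n" and B: "B \<in> carrier_mat n n" and BM: "B * M = 1\<^sub>m n"
    and R: "1 \<le> R" "\<And>i. i < n \<Longrightarrow> (\<Sum>j<n. cmod (M $$ (i, j))) \<le> R"
    and \<delta>: "0 < \<delta>" "\<delta> \<le> cmod (Determinant.det M)" and ij: "i < n" "j < n"
  shows "cmod (B $$ (i, j)) \<le> R ^ n / \<delta>"
proof -
  note adj = adj_mat[OF M]
  have "adj_mat M = (B * M) * adj_mat M" using adj(1) BM by simp
  also have "\<dots> = B * (Determinant.det M \<cdot>\<^sub>m 1\<^sub>m n)" using assoc_mult_mat[OF B M adj(1)] adj(2) by simp
  also have "\<dots> = Determinant.det M \<cdot>\<^sub>m B" using B by (simp add: mult_smult_distrib[OF B one_carrier_mat])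
  finally have "adj_mat M $$ (i, j) = (Determinant.det M \<cdot>\<^sub>m B) $$ (i, j)" by simp
  then have "Determinant.det M * B $$ (i, j) = cofactor M j i"
    using M B ij by (simp add: adj_mat_def)
  then have eq: "cmod (Determinant.det M) * cmod (B $$ (i, j)) = cmod (Determinant.det (mat_delete M j i))"
    by (simp add: cofactor_def norm_mult norm_power flip: norm_mult[of "Determinant.det M"])
  have "cmod (Determinant.det (mat_delete M j i)) \<le> R ^ (n - 1)"
  proof (rule norm_det_le_row_sums[OF mat_delete_carrier[OF M]])
    show "(\<Sum>k<n - 1. cmod (mat_delete M j i $$ (p, k))) \<le> R" if "p < n - 1" for p
      using mat_delete_row_sum_le[OF M R(2) that] .
  qed (use R in auto)
  also have "\<dots> \<le> R ^ n" using R(1) by (intro power_increasing) auto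
  finally have "cmod (Determinant.det M) * cmod (B $$ (i, j)) \<le> R ^ n" unfolding eq .
  moreover have "\<delta> * cmod (B $$ (i, j)) \<le> cmod (Determinant.det M) * cmod (B $$ (i, j))"
    using \<delta> by (intro mult_right_mono) auto
  ultimately show ?thesis using \<delta> by (simp add: pos_le_divide_eq mult.commute)
qed

section \<open>The spectral norm\<close>

lemma vnorm_le_sum: "vnorm v \<le> (\<Sum>i<dim_vec v. cmod (v $ i))"
  unfolding vnorm_def by (rule L2_set_le_sum) auto

lemma entry_le_vnorm: "i < dim_vec v \<Longrightarrow> cmod (v $ i) \<le> vnorm v"
  unfolding vnorm_def by (rule member_le_L2_set) auto

lemma vnorm_mult_le:
  assumes M: "M \<in> carrier_mat m m" and v: "v \<in> carrier_vec m" "vnorm v \<le> 1"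
  shows "vnorm (M *\<^sub>v v) \<le> (\<Sum>i<m. \<Sum>j<m. cmod (M $$ (i, j)))"
proof -
  have "vnorm (M *\<^sub>v v) \<le> (\<Sum>i<m. cmod ((M *\<^sub>v v) $ i))"
    using vnorm_le_sum[of "M *\<^sub>v v"] M by simp
  also have "\<dots> \<le> (\<Sum>i<m. \<Sum>j<m. cmod (M $$ (i, j)))"
  proof (intro sum_mono)
    fix i assume i: "i \<in> {..<m}"
    have "(M *\<^sub>v v) $ i = (\<Sum>j<m. M $$ (i, j) * v $ j)"
      using M v i by (simp add: scalar_prod_def atLeast0LessThan)
    then have "cmod ((M *\<^sub>v v) $ i) \<le> (\<Sum>j<m. cmod (M $$ (i, j) * v $ j))" by (simp add: norm_sum)
    also have "\<dots> \<le> (\<Sum>j<m. cmod (M $$ (i, j)))"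
    proof (intro sum_mono)
      fix j assume "j \<in> {..<m}"
      then have "cmod (v $ j) \<le> 1" using entry_le_vnorm[of j v] v by auto
      then show "cmod (M $$ (i, j) * v $ j) \<le> cmod (M $$ (i, j))"
        by (simp add: norm_mult mult_left_le)
    qed
    finally show "cmod ((M *\<^sub>v v) $ i) \<le> (\<Sum>j<m. cmod (M $$ (i, j)))" .
  qed
  finally show ?thesis .
qed

lemma spectral_norm_le:
  assumes M: "M \<in> carrier_mat m m"
  shows "spectral_norm M \<le> (\<Sum>i<m. \<Sum>j<m. cmod (M $$ (i, j)))"
  unfolding spectral_norm_def
proof (rule cSUP_least)
  have "0\<^sub>v m \<in> {v \<in> carrier_vec (dim_col M). vnorm v \<le> 1}"
    using M by (simp add: vnorm_def L2_set_def)
  then show "{v \<in> carrier_vec (dim_col M). vnorm v \<le> 1} \<noteq> {}" by blast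
qed (use M vnorm_mult_le[OF M] in auto)

lemma entry_le_spectral_norm:
  assumes M: "M \<in> carrier_mat m m" and ij: "i < m" "j < m"
  shows "cmod (M $$ (i, j)) \<le> spectral_norm M"
proof -
  have u: "vnorm (unit_vec m j) = 1"
  proof -
    have "(\<Sum>k<m. (cmod (unit_vec m j $ k))\<^sup>2) = (\<Sum>k<m. if k = j then 1 else 0)"
      using ij by (intro sum.cong) auto
    then show ?thesis using ij by (simp add: vnorm_def L2_set_def)
  qed
  have "cmod (M $$ (i, j)) = cmod ((M *\<^sub>v unit_vec m j) $ i)" using M ij by simp
  also have "\<dots> \<le> vnorm (M *\<^sub>v unit_vec m j)" using M ij by (intro entry_le_vnorm) simp
  also have "\<dots> \<le> spectral_norm M"
    unfolding spectral_norm_def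
  proof (rule cSUP_upper)
    show "unit_vec m j \<in> {v \<in> carrier_vec (dim_col M). vnorm v \<le> 1}" using M u by auto
    show "bdd_above ((\<lambda>v. vnorm (M *\<^sub>v v)) ` {v \<in> carrier_vec (dim_col M). vnorm v \<le> 1})"
      using vnorm_mult_le[OF M] M by (intro bdd_aboveI2[of _ _ "\<Sum>i<m. \<Sum>j<m. cmod (M $$ (i, j))"]) auto
  qed
  finally show ?thesis .
qed

section \<open>Block sequences as scalar sequences\<close>

definition flatten :: "nat \<Rightarrow> (nat \<Rightarrow> complex vec) \<Rightarrow> nat \<Rightarrow> complex" where
  "flatten N x i = x (i div N) $ (i mod N)"

definition of_ell2 :: "nat \<Rightarrow> (nat \<Rightarrow> complex vec) \<Rightarrow> sqsum" where
  "of_ell2 N x = Abs_sqsum (flatten N x)"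

definition to_ell2 :: "nat \<Rightarrow> sqsum \<Rightarrow> nat \<Rightarrow> complex vec" where
  "to_ell2 N y j = vec N (\<lambda>r. coords y (j * N + r))"

lemma vnorm_sq: "v \<in> carrier_vec N \<Longrightarrow> (vnorm v)\<^sup>2 = (\<Sum>r<N. (cmod (v $ r))\<^sup>2)"
  unfolding vnorm_def L2_set_def by (auto simp: sum_nonneg)

lemma sum_blocks:
  fixes g :: "nat \<Rightarrow> real"
  shows "(\<Sum>j<M. \<Sum>r<N. g (j * N + r)) = (\<Sum>i<M * N. g i)"
proof -
  have "(\<Sum>r<N. g (j * N + r)) = sum g {j * N..<j * N + N}" for j
    using sum.atLeastLessThan_shift_bounds[of g 0 "j * N" N]
    by (simp add: atLeast0LessThan add.commute o_def)
  then show ?thesis by (simp add: sum.nat_group)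
qed

lemma flatten_sq_sum_le:
  assumes N: "1 \<le> N" and x: "x \<in> ell2 N" and F: "finite F"
  shows "(\<Sum>i\<in>F. (cmod (flatten N x i))\<^sup>2) \<le> (ell2_norm x)\<^sup>2"
proof -
  from x have carr: "\<And>j. x j \<in> carrier_vec N" and s: "summable (\<lambda>j. (vnorm (x j))\<^sup>2)"
    by (auto simp: ell2_def)
  obtain M where M: "F \<subseteq> {..<M}" using F finite_nat_iff_bounded by blast
  also have "{..<M} \<subseteq> {..<M * N}" using N by auto
  finally have "(\<Sum>i\<in>F. (cmod (flatten N x i))\<^sup>2) \<le> (\<Sum>i<M * N. (cmod (flatten N x i))\<^sup>2)"
    by (intro sum_mono2) auto
  also have "\<dots> = (\<Sum>j<M. \<Sum>r<N. (cmod (flatten N x (j * N + r)))\<^sup>2)" by (rule sum_blocks[symmetric])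
  also have "\<dots> = (\<Sum>j<M. (vnorm (x j))\<^sup>2)"
    by (intro sum.cong refl) (simp add: vnorm_sq[OF carr] flatten_def)
  also have "\<dots> \<le> (\<Sum>j. (vnorm (x j))\<^sup>2)" by (intro sum_le_suminf s) auto
  also have "\<dots> = (ell2_norm x)\<^sup>2" unfolding ell2_norm_def by (simp add: suminf_nonneg s)
  finally show ?thesis .
qed

lemma coords_of_ell2: "1 \<le> N \<Longrightarrow> x \<in> ell2 N \<Longrightarrow> coords (of_ell2 N x) = flatten N x"
  unfolding of_ell2_def by (rule Abs_sqsum_bounded) (rule flatten_sq_sum_le)

lemma ell2_norm_nonneg: "x \<in> ell2 N \<Longrightarrow> 0 \<le> ell2_norm x"
  unfolding ell2_norm_def ell2_def by (auto intro: suminf_nonneg)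

lemma norm_of_ell2_le: "1 \<le> N \<Longrightarrow> x \<in> ell2 N \<Longrightarrow> norm (of_ell2 N x) \<le> ell2_norm x"
  by (rule norm_sqsum_leI) (auto simp: coords_of_ell2 flatten_sq_sum_le ell2_norm_nonneg)

lemma to_ell2_partial_sums:
  "(\<Sum>j<M. (vnorm (to_ell2 N y j))\<^sup>2) \<le> (norm y)\<^sup>2"
proof -
  have carr: "to_ell2 N y j \<in> carrier_vec N" for j by (simp add: to_ell2_def)
  have "(\<Sum>j<M. (vnorm (to_ell2 N y j))\<^sup>2) = (\<Sum>j<M. \<Sum>r<N. (cmod (coords y (j * N + r)))\<^sup>2)"
    unfolding vnorm_sq[OF carr] by (simp add: to_ell2_def)
  also have "\<dots> = (\<Sum>i<M * N. (cmod (coords y i))\<^sup>2)" by (rule sum_blocks)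
  also have "\<dots> \<le> (norm y)\<^sup>2" by (rule sum_le_norm_sqsum) simp
  finally show ?thesis .
qed

lemma to_ell2_in: "to_ell2 N y \<in> ell2 N"
  unfolding ell2_def using to_ell2_partial_sums[of N y]
  by (auto intro!: summableI_nonneg_bounded simp: to_ell2_def)

lemma ell2_norm_to_ell2_le: "ell2_norm (to_ell2 N y) \<le> norm y"
proof -
  have "(\<Sum>j. (vnorm (to_ell2 N y j))\<^sup>2) \<le> (norm y)\<^sup>2"
    using to_ell2_in[of N y] to_ell2_partial_sums by (intro suminf_le_const) (auto simp: ell2_def)
  then show ?thesis unfolding ell2_norm_def by (rule real_le_lsqrt[OF norm_ge_zero])
qed

lemma of_to_ell2: "1 \<le> N \<Longrightarrow> of_ell2 N (to_ell2 N y) = y"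
  by (rule coords_eqI) (simp add: coords_of_ell2 to_ell2_in, simp add: flatten_def to_ell2_def)

lemma to_of_ell2:
  assumes "1 \<le> N" "x \<in> ell2 N"
  shows "to_ell2 N (of_ell2 N x) = x"
proof
  fix j
  have "x j \<in> carrier_vec N" using assms(2) by (simp add: ell2_def)
  then show "to_ell2 N (of_ell2 N x) j = x j"
    unfolding to_ell2_def coords_of_ell2[OF assms] by (intro eq_vecI) (auto simp: flatten_def)
qed

text \<open>
  Here \<open>F\<close> is \<open>L\<close> under the identification of \<open>ell2 N\<close> with \<open>sqsum\<close>. The latter is only a real vector
  space, which is why complex homogeneity of \<open>L\<close> is a separate condition on coordinates.
\<close>

lemma bounded_op_transport:
  assumes N: "1 \<le> N"
    and F: "\<And>x. x \<in> ell2 N \<Longrightarrow> F x = to_ell2 N (L (of_ell2 N x))"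
    and add: "\<And>x y. L (x + y) = L x + L y"
    and scale: "\<And>c x y. coords y = (\<lambda>i. c * coords x i) \<Longrightarrow> coords (L y) = (\<lambda>i. c * coords (L x) i)"
    and K: "0 \<le> K" "\<And>x. norm (L x) \<le> K * norm x"
  shows "bounded_op N F"
  unfolding bounded_op_def
proof (intro conjI ballI allI)
  fix x assume x: "x \<in> ell2 N"
  show "F x \<in> ell2 N" unfolding F[OF x] by (rule to_ell2_in)
  fix y assume y: "y \<in> ell2 N"
  have "(\<lambda>j. x j + y j) = (\<lambda>j. to_ell2 N (of_ell2 N x) j + to_ell2 N (of_ell2 N y) j)"
    by (simp add: to_of_ell2[OF N x] to_of_ell2[OF N y])
  also have "\<dots> = to_ell2 N (of_ell2 N x + of_ell2 N y)"
    by (intro ext eq_vecI) (auto simp: to_ell2_def plus_sqsum.rep_eq)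
  finally have xy: "(\<lambda>j. x j + y j) = to_ell2 N (of_ell2 N x + of_ell2 N y)" .
  have "F (\<lambda>j. x j + y j) = to_ell2 N (L (of_ell2 N x) + L (of_ell2 N y))"
    unfolding xy F[OF to_ell2_in] of_to_ell2[OF N] add ..
  also have "\<dots> = (\<lambda>j. F x j + F y j)"
    unfolding F[OF x] F[OF y] by (intro ext eq_vecI) (auto simp: to_ell2_def plus_sqsum.rep_eq)
  finally show "F (\<lambda>j. x j + y j) = (\<lambda>j. F x j + F y j)" .
next
  fix c x assume x: "x \<in> ell2 N"
  define X where "X = of_ell2 N x"
  define Y where "Y = Abs_sqsum (\<lambda>i. c * coords X i)"
  have Y: "coords Y = (\<lambda>i. c * coords X i)"
    unfolding Y_def by (intro Abs_sqsum_inverse) (simp add: summable_sq_scale sqsum_summable)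
  have "(\<lambda>j. c \<cdot>\<^sub>v x j) = (\<lambda>j. c \<cdot>\<^sub>v to_ell2 N X j)" by (simp add: X_def to_of_ell2[OF N x])
  also have "\<dots> = to_ell2 N Y" by (intro ext eq_vecI) (auto simp: to_ell2_def Y)
  finally have cx: "(\<lambda>j. c \<cdot>\<^sub>v x j) = to_ell2 N Y" .
  have "F (\<lambda>j. c \<cdot>\<^sub>v x j) = to_ell2 N (L Y)" unfolding cx F[OF to_ell2_in] of_to_ell2[OF N] ..
  also have "\<dots> = (\<lambda>j. c \<cdot>\<^sub>v F x j)"
    unfolding F[OF x] X_def[symmetric] by (intro ext eq_vecI) (auto simp: to_ell2_def scale[OF Y])
  finally show "F (\<lambda>j. c \<cdot>\<^sub>v x j) = (\<lambda>j. c \<cdot>\<^sub>v F x j)" .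
next
  show "\<exists>C. \<forall>x\<in>ell2 N. ell2_norm (F x) \<le> C * ell2_norm x"
  proof (intro exI[of _ K] ballI)
    fix x assume x: "x \<in> ell2 N"
    have "ell2_norm (F x) \<le> norm (L (of_ell2 N x))" unfolding F[OF x] by (rule ell2_norm_to_ell2_le)
    also have "\<dots> \<le> K * norm (of_ell2 N x)" by (rule K(2))
    also have "\<dots> \<le> K * ell2_norm x" using norm_of_ell2_le[OF N x] K(1) by (rule mult_left_mono)
    finally show "ell2_norm (F x) \<le> K * ell2_norm x" .
  qed
qed

lemma toeplitz_op_eq_mat_op:
  assumes N: "1 \<le> N" and a: "schur_bound C (block_toeplitz N \<alpha>)"
    and \<alpha>: "\<And>r s k. r < N \<Longrightarrow> s < N \<Longrightarrow> fourier_coeff N A k $$ (r, s) = \<alpha> r s k"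
    and x: "x \<in> ell2 N"
  shows "toeplitz_op N A x = to_ell2 N (mat_op (block_toeplitz N \<alpha>) (of_ell2 N x))"
proof
  fix j
  have carr: "x k \<in> carrier_vec N" for k using x by (simp add: ell2_def)
  have "(\<Sum>k. (fourier_coeff N A (int j - int k) *\<^sub>v x k) $ r) = mat_app (block_toeplitz N \<alpha>) (flatten N x) (j * N + r)"
    if r: "r < N" for r
  proof -
    let ?f = "\<lambda>i. block_toeplitz N \<alpha> (j * N + r) i * flatten N x i"
    have f: "?f summable_on UNIV"
      using row_summable[OF a coord_le_norm[of "of_ell2 N x"], of "j * N + r"] by (simp add: coords_of_ell2[OF N x])
    have sub: "(\<lambda>k. ?f (k * N + s)) summable_on UNIV" for s
    proof -
      have inj: "inj (\<lambda>k. k * N + s)" using N by (auto simp: inj_def)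
      have "?f summable_on range (\<lambda>k. k * N + s)" by (rule summable_on_subset_banach[OF f]) simp
      then show ?thesis unfolding summable_on_reindex[OF inj] by (simp add: o_def)
    qed
    have block: "(fourier_coeff N A (int j - int k) *\<^sub>v x k) $ r = (\<Sum>s<N. ?f (k * N + s))" for k
      using r carr[of k] by (auto simp: fourier_coeff_def scalar_prod_def atLeast0LessThan block_toeplitz_def flatten_def
          \<alpha>[symmetric] intro!: sum.cong)
    have "(?f has_sum (\<Sum>s<N. \<Sum>\<^sub>\<infinity>k. ?f (k * N + s))) UNIV"
      by (rule has_sum_blocks[OF N]) (rule has_sum_infsum[OF sub])
    then have 1: "mat_app (block_toeplitz N \<alpha>) (flatten N x) (j * N + r) = (\<Sum>s<N. \<Sum>\<^sub>\<infinity>k. ?f (k * N + s))"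
      unfolding mat_app_def by (rule infsumI)
    have "((\<lambda>k. \<Sum>s<N. ?f (k * N + s)) has_sum (\<Sum>s<N. \<Sum>\<^sub>\<infinity>k. ?f (k * N + s))) UNIV"
      by (rule has_sum_finite_sum) (auto intro: has_sum_infsum[OF sub])
    from sums_unique[OF has_sum_imp_sums[OF this]] show ?thesis unfolding block 1 by simp
  qed
  then show "toeplitz_op N A x j = to_ell2 N (mat_op (block_toeplitz N \<alpha>) (of_ell2 N x)) j"
    unfolding toeplitz_op_def to_ell2_def coords_mat_op[OF a] coords_of_ell2[OF N x]
    by (intro eq_vecI) auto
qed

lemma mat_op_scale:
  assumes "schur_bound C a" "coords y = (\<lambda>i. c * coords x i)"
  shows "coords (mat_op a y) = (\<lambda>i. c * coords (mat_op a x) i)"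
  unfolding coords_mat_op[OF assms(1)] assms(2) by (intro ext mat_app_scale)

lemma invertible_toeplitz_op:
  assumes N: "1 \<le> N" and a: "schur_bound C (block_toeplitz N \<alpha>)"
    and \<alpha>: "\<And>r s k. r < N \<Longrightarrow> s < N \<Longrightarrow> fourier_coeff N A k $$ (r, s) = \<alpha> r s k"
    and c: "0 < c" "\<And>x. c * norm x \<le> norm (mat_op (block_toeplitz N \<alpha>) x)"
    and surj: "surj (mat_op (block_toeplitz N \<alpha>))"
  shows "invertible_op N (toeplitz_op N A)"
proof -
  define L where "L = mat_op (block_toeplitz N \<alpha>)"
  define J where "J = inv_into UNIV L"
  interpret L: bounded_linear L unfolding L_def by (rule bounded_linear_mat_op[OF a])
  have F: "toeplitz_op N A x = to_ell2 N (L (of_ell2 N x))" if "x \<in> ell2 N" for x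
    unfolding L_def by (rule toeplitz_op_eq_mat_op[OF N a _ that]) (rule \<alpha>)
  have inj: "inj L"
  proof (rule injI)
    fix x y assume "L x = L y"
    then have "L (x - y) = 0" by (simp add: L.diff)
    then have "c * norm (x - y) \<le> 0" using c(2)[of "x - y"] by (simp add: L_def)
    then show "x = y" using c(1) by (simp add: mult_le_0_iff)
  qed
  have LI: "L (J y) = y" for y unfolding J_def using surj by (simp add: L_def surj_f_inv_f)
  have IL: "J (L x) = x" for x unfolding J_def using inj by simp
  obtain K where K: "0 \<le> K" "\<And>x. norm (L x) \<le> norm x * K" using L.nonneg_bounded by blast
  have bF: "bounded_op N (toeplitz_op N A)"
  proof (rule bounded_op_transport[OF N, where L = L and K = K])
    show "toeplitz_op N A x = to_ell2 N (L (of_ell2 N x))" if "x \<in> ell2 N" for x by (rule F[OF that])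
    show "L (x + y) = L x + L y" for x y by (rule L.add)
    show "coords (L y) = (\<lambda>i. c * coords (L x) i)" if "coords y = (\<lambda>i. c * coords x i)" for c x y
      unfolding L_def by (rule mat_op_scale[OF a that])
    show "norm (L x) \<le> K * norm x" for x using K(2) by (simp add: mult.commute)
  qed (use K in auto)
  define G where "G x = to_ell2 N (J (of_ell2 N x))" for x
  have bG: "bounded_op N G"
  proof (rule bounded_op_transport[OF N, where L = J and K = "1 / c"])
    show "J (x + y) = J x + J y" for x y using IL[of "J x + J y"] by (simp add: L.add LI)
    show "coords (J y) = (\<lambda>i. e * coords (J x) i)" if xy: "coords y = (\<lambda>i. e * coords x i)" for e x y
    proof -
      define z where "z = Abs_sqsum (\<lambda>i. e * coords (J x) i)"
      have z: "coords z = (\<lambda>i. e * coords (J x) i)"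
        unfolding z_def by (intro Abs_sqsum_inverse) (simp add: summable_sq_scale sqsum_summable)
      have "coords (L z) = coords y"
        using mat_op_scale[OF a z, folded L_def] by (simp add: LI xy)
      then have "L z = y" by (simp add: coords_inject)
      then have "J y = z" using IL[of z] by simp
      then show ?thesis using z by simp
    qed
    show "norm (J x) \<le> 1 / c * norm x" for x
      using c(2)[of "J x", folded L_def] c(1) by (simp add: LI field_simps)
  qed (use c(1) in \<open>auto simp: G_def\<close>)
  have "G (toeplitz_op N A x) = x \<and> toeplitz_op N A (G x) = x" if x: "x \<in> ell2 N" for x
    unfolding F[OF x] G_def F[OF to_ell2_in] of_to_ell2[OF N] LI IL by (simp add: to_of_ell2[OF N x])
  with bF bG show ?thesis unfolding invertible_op_def by blast
qed

text \<open>
  Non-invertibility excludes the first case of the Fredholm alternative, and in each of the other two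
  cases a decaying null vector makes the inverses of the sections grow.
\<close>

lemma not_invertible_imp_exp_growing_inverses:
  assumes N: "1 \<le> N" and \<alpha>: "\<And>r s. r < N \<Longrightarrow> s < N \<Longrightarrow> laurent_decay (\<alpha> r s)"
    and \<beta>: "\<And>r s. r < N \<Longrightarrow> s < N \<Longrightarrow> laurent_decay (\<beta> r s)"
    and inv: "convolution_inverse N \<alpha> \<beta>" "convolution_inverse N \<beta> \<alpha>"
    and fc: "\<And>r s k. r < N \<Longrightarrow> s < N \<Longrightarrow> fourier_coeff N A k $$ (r, s) = \<alpha> r s k"
    and ninv: "\<not> invertible_op N (toeplitz_op N A)"
  shows "exp_growing_inverses (block_toeplitz N \<alpha>)"
proof -
  obtain Ca where a: "schur_bound Ca (block_toeplitz N \<alpha>)" using block_toeplitz_schur_bound[of N \<alpha>] N \<alpha> by blast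
  obtain Cb where b: "schur_bound Cb (block_toeplitz N \<beta>)" using block_toeplitz_schur_bound[of N \<beta>] N \<beta> by blast
  obtain K where K: "exp_decaying_mat K"
    "mat_prod (block_toeplitz N \<alpha>) (block_toeplitz N \<beta>) = (\<lambda>i j. (if i = j then 1 else 0) - K i j)"
    using block_toeplitz_parametrix[of N \<alpha> \<beta>] N \<alpha> \<beta> inv(1) by blast
  obtain L where L: "exp_decaying_mat L"
    "mat_prod (block_toeplitz N \<beta>) (block_toeplitz N \<alpha>) = (\<lambda>i j. (if i = j then 1 else 0) - L i j)"
    using block_toeplitz_parametrix[of N \<beta> \<alpha>] N \<alpha> \<beta> inv(2) by blast
  show ?thesis
  proof (cases rule: invertible_or_decaying_kernel[OF a b L K])
    case (1 c)
    then show ?thesis using invertible_toeplitz_op[OF N a fc 1] ninv by blast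
  next
    case (2 z i)
    then show ?thesis by (rule exp_growing_inverses_kernel[OF a])
  next
    case (3 z i)
    have "schur_bound Ca (\<lambda>i j. block_toeplitz N \<alpha> j i)" using a unfolding schur_bound_def by blast
    from exp_growing_inverses_kernel[OF this 3] show ?thesis by (rule exp_growing_inverses_transpose)
  qed
qed

lemma fourier_coeff_laurent:
  assumes "laurent_expansion (\<lambda>t. A t $$ (r, s)) c" "r < N" "s < N"
  shows "fourier_coeff N A k $$ (r, s) = c k"
  using fourier_coefficient_laurent[OF assms(1), of k] assms(2,3) by (simp add: fourier_coeff_def)

section \<open>The limit set and the condition numbers\<close>

text \<open>
  Otherwise there are sections of increasing size with eigenvalues tending to zero.
\<close>

lemma spectrum_bounded_away:
  assumes "0 \<notin> limit_set N A"
  obtains (away) \<epsilon> n0 where "0 < \<epsilon>" "\<And>n e. n0 \<le> n \<Longrightarrow> e \<in> spectrum (toeplitz_mat N A n) \<Longrightarrow> \<epsilon> \<le> cmod e"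
proof (rule ccontr)
  assume "\<not> thesis"
  then have ex: "\<exists>n e. n0 \<le> n \<and> e \<in> spectrum (toeplitz_mat N A n) \<and> cmod e < \<epsilon>" if "0 < \<epsilon>" for \<epsilon> n0
    using away[of \<epsilon> n0] that by (meson not_le)
  have "\<exists>f. \<forall>k. (1 \<le> fst (f k) \<and> snd (f k) \<in> spectrum (toeplitz_mat N A (fst (f k))) \<and> cmod (snd (f k)) < inverse (real (Suc k))) \<and>
      fst (f k) < fst (f (Suc k))"
  proof (rule dependent_nat_choice)
    show "\<exists>p :: nat \<times> complex. 1 \<le> fst p \<and> snd p \<in> spectrum (toeplitz_mat N A (fst p)) \<and> cmod (snd p) < inverse (real (Suc 0))"
      using ex[of "inverse (real (Suc 0))" 1] by auto
    show "\<exists>p' :: nat \<times> complex. (1 \<le> fst p' \<and> snd p' \<in> spectrum (toeplitz_mat N A (fst p')) \<and> cmod (snd p') < inverse (real (Suc (Suc k)))) \<and> fst p < fst p'"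
      for p :: "nat \<times> complex" and k
    proof -
      obtain n e where "Suc (fst p) \<le> n" "e \<in> spectrum (toeplitz_mat N A n)" "cmod e < inverse (real (Suc (Suc k)))"
        using ex[of "inverse (real (Suc (Suc k)))" "Suc (fst p)"] by auto
      then show ?thesis by (intro exI[of _ "(n, e)"]) simp
    qed
  qed
  then obtain f where f: "\<And>k. 1 \<le> fst (f k)" "\<And>k. snd (f k) \<in> spectrum (toeplitz_mat N A (fst (f k)))"
    "\<And>k. cmod (snd (f k)) < inverse (real (Suc k))" "\<And>k. fst (f k) < fst (f (Suc k))" by blast
  have "(\<lambda>k. snd (f k)) \<longlonglongrightarrow> 0"
    by (rule Lim_null_comparison[OF _ LIMSEQ_inverse_real_of_nat]) (use f(3) in \<open>auto intro: less_imp_le always_eventually\<close>)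
  moreover have "strict_mono (\<lambda>k. fst (f k))" using f(4) by (simp add: strict_mono_Suc_iff)
  ultimately have "0 \<in> limit_set N A"
    unfolding limit_set_def using f(1,2)
    by (intro CollectI exI[of _ "\<lambda>k. fst (f k)"] exI[of _ "\<lambda>k. snd (f k)"] conjI allI)
  with assms show False by blast
qed

lemma cond_number_eq:
  assumes M: "M \<in> carrier_mat m m" and det: "Determinant.det M \<noteq> 0"
  obtains B where "B \<in> carrier_mat m m" "M * B = 1\<^sub>m m" "B * M = 1\<^sub>m m"
    "cond_number M = ereal (spectral_norm M * spectral_norm B)"
proof -
  have "mat_inverse M \<noteq> None"
    using mat_inverse(1)[OF M, of "()"] det_non_zero_imp_unit[OF M det, of "()"] by blast
  then obtain B where "mat_inverse M = Some B" by blast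
  with mat_inverse(2)[OF M this] show ?thesis by (intro that[of B]) (auto simp: cond_number_def)
qed

text \<open>
  The cube stems from bounding spectral norms by sums of entries: one factor \<open>m\<close> for the section and
  two for its inverse.
\<close>

lemma cubic_times_power_le_exp:
  fixes x :: real
  assumes "0 < x"
  shows "real m ^ 3 * x ^ m \<le> exp ((3 + \<bar>ln x\<bar>) * real m)"
proof -
  have "real m \<le> exp (real m)" using exp_ge_add_one_self[of "real m"] by linarith
  then have "real m ^ 3 \<le> exp (real m) ^ 3" by (intro power_mono) auto
  also have "\<dots> = exp (3 * real m)" by (simp add: exp_of_nat_mult[symmetric])
  finally have 1: "real m ^ 3 \<le> exp (3 * real m)" .
  have "x ^ m = exp (real m * ln x)" using assms by (simp add: exp_of_nat_mult)
  also have "\<dots> \<le> exp (real m * \<bar>ln x\<bar>)" by (simp add: mult_left_mono)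
  finally have "real m ^ 3 * x ^ m \<le> exp (3 * real m) * exp (real m * \<bar>ln x\<bar>)"
    using 1 assms by (intro mult_mono) auto
  then show ?thesis by (simp add: exp_add[symmetric] algebra_simps)
qed

theorem theorem3p3:
  fixes N :: nat and A :: "complex \<Rightarrow> complex mat"
  assumes "1 \<le> N"
    and "A \<in> GR N"
    and "\<not> invertible_op N (toeplitz_op N A) \<or>
         \<not> invertible_op N (toeplitz_op N (reflect_symbol A))"
    and "0 \<notin> limit_set N A"
  shows "\<exists>d1 d2 \<alpha> \<beta> :: real. d1 > 0 \<and> d2 > 0 \<and> \<alpha> > 0 \<and> \<beta> > 0 \<and>
           (\<forall>\<^sub>F n in sequentially.
              ereal (d1 * exp (\<alpha> * real n)) \<le> cond_number (toeplitz_mat N A n) \<and>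
              cond_number (toeplitz_mat N A n) \<le> ereal (d2 * exp (\<beta> * real n)))"
proof -
  note N = assms(1)
  obtain \<alpha> \<beta> where lau: "\<And>r s. r < N \<Longrightarrow> s < N \<Longrightarrow> laurent_expansion (\<lambda>t. A t $$ (r, s)) (\<alpha> r s)"
    and \<beta>: "\<And>r s. r < N \<Longrightarrow> s < N \<Longrightarrow> laurent_decay (\<beta> r s)"
    and inv: "convolution_inverse N \<alpha> \<beta>" "convolution_inverse N \<beta> \<alpha>"
    using GR_laurent_coefficients[OF assms(2)] by blast
  have \<alpha>: "laurent_decay (\<alpha> r s)" if "r < N" "s < N" for r s
    using lau[OF that] unfolding laurent_expansion_def by blast
  have fc: "fourier_coeff N A k $$ (r, s) = \<alpha> r s k" if "r < N" "s < N" for r s k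
    using fourier_coeff_laurent[OF lau[OF that] that] .
  define a where "a = block_toeplitz N \<alpha>"
  define T where "T = toeplitz_mat N A"
  have T: "T n \<in> carrier_mat (n * N) (n * N)" for n by (simp add: T_def toeplitz_mat_def)
  have Ta: "T n $$ (i, j) = a i j" if "i < n * N" "j < n * N" for n i j
    using that N by (simp add: T_def toeplitz_mat_def a_def block_toeplitz_def fc)
  obtain C where aC: "schur_bound C a"
    using block_toeplitz_schur_bound[of N \<alpha>] N \<alpha> unfolding a_def by blast

  \<comment> \<open>Growth of the inverses of the sections of \<open>a\<close>; in the second case by reversing the blocks.\<close>
  have "\<exists>c q n1. 0 < c \<and> 1 < q \<and> (\<forall>n\<ge>n1. \<forall>b S. section_inverse (n * N) a b \<longrightarrow>
      (\<forall>i<n * N. \<forall>j<n * N. cmod (b i j) \<le> S) \<longrightarrow> c * q ^ (n * N) \<le> S)"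
    using assms(3)
  proof
    assume "\<not> invertible_op N (toeplitz_op N A)"
    then have "exp_growing_inverses a"
      unfolding a_def using not_invertible_imp_exp_growing_inverses[of N \<alpha> \<beta> A] N \<alpha> \<beta> inv fc by blast
    then obtain c q m0 where "0 < c" "1 < q" "\<And>m b S. m0 \<le> m \<Longrightarrow> section_inverse m a b \<Longrightarrow>
        (\<forall>i<m. \<forall>j<m. cmod (b i j) \<le> S) \<Longrightarrow> c * q ^ m \<le> S"
      unfolding exp_growing_inverses_def by blast
    moreover have "m0 \<le> n * N" if "m0 \<le> n" for n using that N by (metis le_trans mult.right_neutral mult_le_mono2)
    ultimately show ?thesis by blast
  next
    assume ninv: "\<not> invertible_op N (toeplitz_op N (reflect_symbol A))"
    let ?\<alpha> = "\<lambda>r s k. \<alpha> r s (- k)" and ?\<beta> = "\<lambda>r s k. \<beta> r s (- k)"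
    have lau': "laurent_expansion (\<lambda>t. reflect_symbol A t $$ (r, s)) (?\<alpha> r s)" if "r < N" "s < N" for r s
      unfolding reflect_symbol_def by (rule laurent_expansion_reflect[OF lau[OF that]])
    have "exp_growing_inverses (block_toeplitz N ?\<alpha>)"
    proof (rule not_invertible_imp_exp_growing_inverses[where \<beta> = ?\<beta> and A = "reflect_symbol A"])
      show "laurent_decay (?\<alpha> r s)" if "r < N" "s < N" for r s by (rule laurent_decay_reflect[OF \<alpha>[OF that]])
      show "laurent_decay (?\<beta> r s)" if "r < N" "s < N" for r s by (rule laurent_decay_reflect[OF \<beta>[OF that]])
      show "convolution_inverse N ?\<alpha> ?\<beta>" by (rule convolution_inverse_reflect[OF inv(1)])
      show "convolution_inverse N ?\<beta> ?\<alpha>" by (rule convolution_inverse_reflect[OF inv(2)])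
      show "fourier_coeff N (reflect_symbol A) k $$ (r, s) = \<alpha> r s (- k)" if "r < N" "s < N" for r s k
        by (rule fourier_coeff_laurent[OF lau'[OF that] that])
    qed (rule N ninv)+
    then obtain c q m0 where cq: "0 < c" "1 < q" and grow: "\<And>m b S. m0 \<le> m \<Longrightarrow> section_inverse m (block_toeplitz N ?\<alpha>) b \<Longrightarrow>
        (\<forall>i<m. \<forall>j<m. cmod (b i j) \<le> S) \<Longrightarrow> c * q ^ m \<le> S"
      unfolding exp_growing_inverses_def by blast
    have "c * q ^ (n * N) \<le> S" if n: "m0 \<le> n" and b: "section_inverse (n * N) a b"
      and S: "\<forall>i<n * N. \<forall>j<n * N. cmod (b i j) \<le> S" for n b S
    proof (rule grow)
      show "m0 \<le> n * N" using n N by (metis le_trans mult.right_neutral mult_le_mono2)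
      show "section_inverse (n * N) (block_toeplitz N ?\<alpha>) (\<lambda>i j. b (block_reversal N n i) (block_reversal N n j))"
        using section_inverse_block_reversal[OF N] b unfolding a_def by blast
      show "\<forall>i<n * N. \<forall>j<n * N. cmod (b (block_reversal N n i) (block_reversal N n j)) \<le> S"
        using S block_reversal_involution(1)[OF N] by blast
    qed
    with cq show ?thesis by blast
  qed
  then obtain c q n1 where c: "0 < c" and q: "1 < q" and grow: "\<And>n b S. n1 \<le> n \<Longrightarrow> section_inverse (n * N) a b \<Longrightarrow>
      (\<forall>i<n * N. \<forall>j<n * N. cmod (b i j) \<le> S) \<Longrightarrow> c * q ^ (n * N) \<le> S" by blast

  obtain \<epsilon> n0 where \<epsilon>: "0 < \<epsilon>" and spec: "\<And>n e. n0 \<le> n \<Longrightarrow> e \<in> spectrum (T n) \<Longrightarrow> \<epsilon> \<le> cmod e"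
    using spectrum_bounded_away[OF assms(4)] unfolding T_def by blast
  have det: "\<epsilon> ^ (n * N) \<le> cmod (Determinant.det (T n))" if "n0 \<le> n" for n
    using norm_det_ge_spectrum[OF T \<epsilon>] spec that by blast
  have inverse: "\<exists>B. B \<in> carrier_mat (n * N) (n * N) \<and> B * T n = 1\<^sub>m (n * N) \<and> section_inverse (n * N) a (\<lambda>i j. B $$ (i, j)) \<and>
      cond_number (T n) = ereal (spectral_norm (T n) * spectral_norm B)" if n: "n0 \<le> n" for n
  proof -
    have "Determinant.det (T n) \<noteq> 0" using det[OF n] \<epsilon> by (metis norm_zero not_le zero_less_power)
    then obtain B where B: "B \<in> carrier_mat (n * N) (n * N)" "T n * B = 1\<^sub>m (n * N)" "B * T n = 1\<^sub>m (n * N)"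
      "cond_number (T n) = ereal (spectral_norm (T n) * spectral_norm B)"
      using cond_number_eq[OF T] by blast
    have "section_inverse (n * N) a (\<lambda>i j. B $$ (i, j))"
      unfolding section_inverse_def
    proof (intro conjI allI impI)
      fix i k assume ik: "i < n * N" "k < n * N"
      have "(\<Sum>j<n * N. a i j * B $$ (j, k)) = (T n * B) $$ (i, k)"
        using T[of n] B(1) ik by (simp add: scalar_prod_def atLeast0LessThan Ta)
      then show "(\<Sum>j<n * N. a i j * B $$ (j, k)) = (if i = k then 1 else 0)" using ik by (simp add: B(2))
      have "(\<Sum>j<n * N. B $$ (i, j) * a j k) = (B * T n) $$ (i, k)"
        using T[of n] B(1) ik by (simp add: scalar_prod_def atLeast0LessThan Ta)
      then show "(\<Sum>j<n * N. B $$ (i, j) * a j k) = (if i = k then 1 else 0)" using ik by (simp add: B(3))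
    qed
    with B show ?thesis by blast
  qed

  \<comment> \<open>An invertible section has a nonzero entry in its first row; that entry bounds the norms of all later sections from below.\<close>
  have "\<exists>j. j < Suc n0 * N \<and> a 0 j \<noteq> 0"
  proof (rule ccontr)
    assume "\<not> ?thesis"
    then have 0: "a 0 j = 0" if "j < Suc n0 * N" for j using that by blast
    obtain B where "section_inverse (Suc n0 * N) a (\<lambda>i j. B $$ (i, j))" using inverse[of "Suc n0"] by auto
    moreover have "0 < Suc n0 * N" using N by simp
    ultimately have "(\<Sum>j<Suc n0 * N. a 0 j * B $$ (j, 0)) = 1" unfolding section_inverse_def by presburger
    then show False using 0 by simp
  qed
  then obtain j0 where j0: "j0 < Suc n0 * N" "a 0 j0 \<noteq> 0" by blast

  \<comment> \<open>Powers of \<open>R\<close> are used as increasing, hence \<open>R \<ge> 1\<close>.\<close>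
  define R where "R = max 1 C"
  have R: "1 \<le> R" "C \<le> R" by (auto simp: R_def)
  let ?d1 = "cmod (a 0 j0) * c" and ?\<gamma> = "real N * ln q" and ?\<delta> = "real N * (3 + \<bar>ln (R / \<epsilon>)\<bar>)"
  have "ereal (?d1 * exp (?\<gamma> * real n)) \<le> cond_number (T n) \<and> cond_number (T n) \<le> ereal (R * exp (?\<delta> * real n))"
    if n: "Suc n0 + n1 \<le> n" for n
  proof -
    define m where "m = n * N"
    obtain B where B: "B \<in> carrier_mat m m" "B * T n = 1\<^sub>m m" "section_inverse m a (\<lambda>i j. B $$ (i, j))"
      "cond_number (T n) = ereal (spectral_norm (T n) * spectral_norm B)"
      using inverse[of n] n unfolding m_def by auto
    have Tm: "T n \<in> carrier_mat m m" unfolding m_def by (rule T)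
    have "Suc n0 * N \<le> m" using n unfolding m_def by (intro mult_le_mono1) simp
    then have j0m: "j0 < m" "0 < m" using j0(1) by auto

    have "c * q ^ m \<le> spectral_norm B"
      unfolding m_def using entry_le_spectral_norm[OF B(1)] n
      by (intro grow[OF _ B(3)[unfolded m_def]]) (auto simp: m_def)
    moreover have "cmod (a 0 j0) \<le> spectral_norm (T n)"
      using entry_le_spectral_norm[OF Tm j0m(2,1)] Ta[of 0 n j0] j0m by (simp add: m_def)
    ultimately have "cmod (a 0 j0) * (c * q ^ m) \<le> spectral_norm (T n) * spectral_norm B"
      using c q by (intro mult_mono) (auto intro: order_trans[OF norm_ge_zero])
    moreover have "q ^ m = exp (?\<gamma> * real n)"
    proof -
      have "q ^ m = exp (real m * ln q)" using q by (simp add: exp_of_nat_mult)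
      then show ?thesis by (simp add: m_def mult_ac)
    qed
    ultimately have lower: "?d1 * exp (?\<gamma> * real n) \<le> spectral_norm (T n) * spectral_norm B"
      by (simp add: mult.assoc)

    have rows: "(\<Sum>j<m. cmod (T n $$ (i, j))) \<le> R" if "i < m" for i
    proof -
      have "(\<Sum>j<m. cmod (T n $$ (i, j))) = (\<Sum>j<m. cmod (a i j))"
        using that by (intro sum.cong) (auto simp: m_def Ta)
      also have "\<dots> \<le> C" by (rule schur_bound_row[OF aC]) simp
      finally show ?thesis using R by simp
    qed
    have "spectral_norm (T n) \<le> (\<Sum>i<m. \<Sum>j<m. cmod (T n $$ (i, j)))" by (rule spectral_norm_le[OF Tm])
    also have "\<dots> \<le> (\<Sum>i<m. R)" by (intro sum_mono rows) simp
    finally have sT: "spectral_norm (T n) \<le> real m * R" by simp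
    have ent: "cmod (B $$ (i, j)) \<le> (R / \<epsilon>) ^ m" if "i < m" "j < m" for i j
      using norm_inverse_entry_le[OF Tm B(1,2) R(1) rows _ det[of n, folded m_def] that] \<epsilon> n
      by (simp add: power_divide)
    have "spectral_norm B \<le> (\<Sum>i<m. \<Sum>j<m. cmod (B $$ (i, j)))" by (rule spectral_norm_le[OF B(1)])
    also have "\<dots> \<le> (\<Sum>i<m. \<Sum>j<m. (R / \<epsilon>) ^ m)" by (intro sum_mono ent) auto
    finally have sB: "spectral_norm B \<le> real m * (real m * (R / \<epsilon>) ^ m)" by simp
    have "0 \<le> spectral_norm B"
      using entry_le_spectral_norm[OF B(1) j0m(2) j0m(2)] norm_ge_zero order_trans by blast
    then have "spectral_norm (T n) * spectral_norm B \<le> (real m * R) * (real m * (real m * (R / \<epsilon>) ^ m))"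
      using R by (intro mult_mono sT sB) auto
    also have "\<dots> = R * (real m ^ 3 * (R / \<epsilon>) ^ m)" by (simp add: power3_eq_cube mult_ac)
    also have "\<dots> \<le> R * exp ((3 + \<bar>ln (R / \<epsilon>)\<bar>) * real m)"
      using R \<epsilon> by (intro mult_left_mono cubic_times_power_le_exp) auto
    also have "\<dots> = R * exp (?\<delta> * real n)" by (simp add: m_def mult_ac)
    finally show ?thesis using lower by (simp add: B(4))
  qed
  then have "\<forall>\<^sub>F n in sequentially. ereal (?d1 * exp (?\<gamma> * real n)) \<le> cond_number (T n) \<and>
      cond_number (T n) \<le> ereal (R * exp (?\<delta> * real n))"
    by (rule eventually_sequentiallyI)
  moreover have "?d1 > 0" "R > 0" "?\<gamma> > 0" "?\<delta> > 0"
    using j0(2) c R(1) q N by (auto intro!: mult_pos_pos add_pos_nonneg)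
  ultimately show ?thesis unfolding T_def by blast
qed

end
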